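(* Let $\Gamma$ be a cocompact lattice in $\mathrm{Isom}(\mathbb H^3)$, let $g\ge2$, and let $\Lambda$ be a central extension $1\to\mathbb Z\to\Lambda\to\pi_1(\Sigma_g)\to1$ of the fundamental group of the closed orientable surface $\Sigma_g$ of genus $g$ (either the trivial extension $\pi_1(\Sigma_g)\times\mathbb Z$ or a non-trivial one). Then for every $\epsilon>0$, $\Gamma$ and $\Lambda$ are not $L^{2+\epsilon}$-measure equivalent.
   Context: Two countable discrete groups $\Gamma,\Lambda$ are measure equivalent if there is a nonzero $\sigma$-finite measure space $(X,\mu)$ with commuting, free, $\mu$-preserving actions of $\Gamma$ and $\Lambda$, each having a finite-measure fundamental domain $X_\Gamma$, resp. $X_\Lambda$: $X=\bigsqcup_{\gamma\in\Gamma}\gamma X_\Gamma=\bigsqcup_{\lambda\in\Lambda}\lambda X_\Lambda$. The associated cocycles $\alpha:\Gamma\times X_\Lambda\to\Lambda$ and $\beta:\Lambda\times X_\Gamma\to\Gamma$ are defined by $\alpha(\gamma,x)\gamma x\in X_\Lambda$ for $x\in X_\Lambda$ and $\beta(\lambda,y)\lambda y\in X_\Gamma$ for $y\in X_\Gamma$. For finitely generated groups with word lengths $|\cdot|$ and $q\ge1$, they are $L^q$-measure equivalent if such a coupling can be chosen with $\int_{X_\Lambda}|\alpha(\gamma,x)|^q\,d\mu(x)<\infty$ for all $\gamma\in\Gamma$ and $\int_{X_\Gamma}|\beta(\lambda,y)|^q\,d\mu(y)<\infty$ for all $\lambda\in\Lambda$. *)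

theory Defs
  imports "HOL-Analysis.Analysis" "HOL-Algebra.Group_Action" "HOL-Algebra.Elementary_Groups"
begin

section \<open>Hyperbolic 3-space and cocompact lattices\<close>

text \<open>The upper half-space model: points \<open>(z, t)\<close> with \<open>z\<close> complex and \<open>t > 0\<close>.\<close>

definition H3 :: "(complex \<times> real) set" where
  "H3 = {p. snd p > 0}"

text \<open>The value 0 off \<open>H3\<close> is only there because \<^locale>\<open>Metric_space\<close> asks for nonnegativity on
  the whole type.\<close>

definition hyp_dist :: "complex \<times> real \<Rightarrow> complex \<times> real \<Rightarrow> real" where
  "hyp_dist p q =
     (if p \<in> H3 \<and> q \<in> H3 then arcosh (1 + (dist p q)\<^sup>2 / (2 * snd p * snd q)) else 0)"

lemma ptolemy_zero:
  fixes p q r :: "'a :: real_inner"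
  shows "norm (p - r) * norm q \<le> norm (p - q) * norm r + norm (q - r) * norm p"
proof (cases "p = 0 \<or> q = 0 \<or> r = 0")
  case True
  then show ?thesis
    by (auto simp: mult.commute norm_minus_commute)
next
  case False
  define iv where "iv = (\<lambda>x::'a. x /\<^sub>R (norm x)\<^sup>2)"
  have iv: "norm (iv x - iv y) = norm (x - y) / (norm x * norm y)"
    if "x \<noteq> 0" "y \<noteq> 0" for x y
  proof -
    have "(norm (iv x - iv y))\<^sup>2 = (norm (x - y) / (norm x * norm y))\<^sup>2"
      using that unfolding iv_def
      by (simp add: power2_norm_eq_inner inner_diff_left inner_diff_right inner_commute
          power_divide power_mult_distrib divide_simps)
    then show ?thesis
      by (simp add: power2_eq_iff_nonneg)
  qed
  have "norm (iv p - iv r) \<le> norm (iv p - iv q) + norm (iv q - iv r)"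
    using norm_triangle_ineq[of "iv p - iv q" "iv q - iv r"] by simp
  then show ?thesis
    using False by (simp add: iv divide_simps mult_ac)
qed

lemma ptolemy:
  fixes p q r s :: "'a :: real_inner"
  shows "dist p r * dist q s \<le> dist p q * dist r s + dist q r * dist p s"
  using ptolemy_zero[of "p - s" "r - s" "q - s"] by (simp add: dist_norm)

lemma hyp_dist_half:
  assumes "p \<in> H3" "q \<in> H3"
  shows "hyp_dist p q \<ge> 0"
    and "sinh (hyp_dist p q / 2) = dist p q / (2 * sqrt (snd p * snd q))"
    and "cosh (hyp_dist p q / 2) = dist p (fst q, - snd q) / (2 * sqrt (snd p * snd q))"
proof -
  let ?d = "hyp_dist p q"
  have pos: "snd p > 0" "snd q > 0"
    using assms by (auto simp: H3_def)
  have ge1: "1 + (dist p q)\<^sup>2 / (2 * snd p * snd q) \<ge> 1"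
    using pos by simp
  show nn: "?d \<ge> 0"
    using assms ge1 unfolding hyp_dist_def by simp
  have ch: "cosh ?d = 1 + (dist p q)\<^sup>2 / (2 * snd p * snd q)"
    using assms ge1 unfolding hyp_dist_def by (simp add: cosh_arcosh_real)
  have dbl: "cosh ?d = 1 + 2 * (sinh (?d / 2))\<^sup>2"
    using cosh_double[of "?d / 2"] cosh_square_eq[of "?d / 2"] by simp
  have sq: "(sqrt (snd p * snd q))\<^sup>2 = snd p * snd q"
    using pos by simp
  have s2: "(sinh (?d / 2))\<^sup>2 = (dist p q / (2 * sqrt (snd p * snd q)))\<^sup>2"
    using ch dbl sq pos by (simp add: power_divide power_mult_distrib field_simps)
  moreover have "sinh (?d / 2) \<ge> 0" "dist p q / (2 * sqrt (snd p * snd q)) \<ge> 0"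
    using nn pos by auto
  ultimately show "sinh (?d / 2) = dist p q / (2 * sqrt (snd p * snd q))"
    using power2_eq_iff_nonneg by blast
  have "(dist u v)\<^sup>2 = (dist (fst u) (fst v))\<^sup>2 + (snd u - snd v)\<^sup>2" for u v :: "complex \<times> real"
    by (simp add: dist_prod_def dist_real_def)
  from this[of p q] this[of p "(fst q, - snd q)"]
  have "(dist p (fst q, - snd q))\<^sup>2 = (dist p q)\<^sup>2 + 4 * (snd p * snd q)"
    by (simp add: power2_sum power2_diff)
  then have "(dist p (fst q, - snd q) / (2 * sqrt (snd p * snd q)))\<^sup>2
      = (dist p q / (2 * sqrt (snd p * snd q)))\<^sup>2 + 1"
    using pos sq by (simp add: power_divide power_mult_distrib add_divide_distrib)
  also have "\<dots> = (cosh (?d / 2))\<^sup>2"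
    using s2 by (simp add: cosh_square_eq)
  finally show "cosh (?d / 2) = dist p (fst q, - snd q) / (2 * sqrt (snd p * snd q))"
    using pos by (simp add: power2_eq_iff_nonneg)
qed

lemma Metric_space_hyp_dist: "Metric_space H3 hyp_dist"
proof
  show "0 \<le> hyp_dist x y" for x y
    using hyp_dist_half(1) by (cases "x \<in> H3 \<and> y \<in> H3") (auto simp: hyp_dist_def)
  show "hyp_dist x y = hyp_dist y x" for x y
    by (simp add: hyp_dist_def dist_commute mult.commute mult.left_commute conj_commute)
  show "hyp_dist x y = 0 \<longleftrightarrow> x = y" if "x \<in> H3" "y \<in> H3" for x y
  proof -
    have "hyp_dist x y = 0 \<longleftrightarrow> sinh (hyp_dist x y / 2) = 0"
      by simp
    also have "\<dots> \<longleftrightarrow> x = y"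
      using that unfolding hyp_dist_half(2)[OF that] by (auto simp: H3_def)
    finally show ?thesis .
  qed
  show "hyp_dist x z \<le> hyp_dist x y + hyp_dist y z"
    if H: "x \<in> H3" "y \<in> H3" "z \<in> H3" for x y z
  proof -
    obtain a b c where abc: "a = snd x" "b = snd y" "c = snd z" "a > 0" "b > 0" "c > 0"
      using H by (auto simp: H3_def)
    let ?x = "(fst x, - snd x)" and ?y = "(fst y, - snd y)" and ?z = "(fst z, - snd z)"
    have refl: "dist y ?z = dist z ?y"
      by (cases y; cases z) (simp add: dist_Pair_Pair dist_real_def dist_commute add.commute)
    have yy: "dist y ?y = 2 * b"
      using abc by (cases y) (simp add: dist_Pair_Pair dist_real_def real_sqrt_mult)
    have "sinh (hyp_dist x z / 2) = (dist x z * dist y ?y) / (4 * b * sqrt (a * c))"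
      using H abc(4-6) unfolding yy by (simp add: hyp_dist_half abc(1-3))
    also have "\<dots> \<le> (dist x y * dist z ?y + dist y z * dist x ?y) / (4 * b * sqrt (a * c))"
      using abc by (intro divide_right_mono ptolemy) auto
    also have "4 * b * sqrt (a * c) = (2 * sqrt (a * b)) * (2 * sqrt (b * c))"
      using abc(4-6) by (simp add: real_sqrt_mult)
    also have "(dist x y * dist z ?y + dist y z * dist x ?y) / \<dots>
        = sinh (hyp_dist x y / 2) * cosh (hyp_dist y z / 2)
          + cosh (hyp_dist x y / 2) * sinh (hyp_dist y z / 2)"
      using H by (simp add: hyp_dist_half abc(1-3) refl add_divide_distrib mult.commute)
    also have "\<dots> = sinh (hyp_dist x y / 2 + hyp_dist y z / 2)"
      by (simp add: sinh_add)
    finally show ?thesis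
      by (simp add: sinh_real_le_iff)
  qed
qed

definition isometries :: "'a set \<Rightarrow> ('a \<Rightarrow> 'a \<Rightarrow> real) \<Rightarrow> ('a \<Rightarrow> 'a) set" where
  "isometries M d = {f \<in> Bij M. \<forall>x\<in>M. \<forall>y\<in>M. d (f x) (f y) = d x y}"

definition Isom :: "'a set \<Rightarrow> ('a \<Rightarrow> 'a \<Rightarrow> real) \<Rightarrow> ('a \<Rightarrow> 'a) monoid" where
  "Isom M d = (BijGroup M)\<lparr>carrier := isometries M d\<rparr>"

text \<open>The topology of pointwise convergence, which on an isometry group coincides with the
  compact-open topology.\<close>

definition Isom_topology :: "'a set \<Rightarrow> ('a \<Rightarrow> 'a \<Rightarrow> real) \<Rightarrow> ('a \<Rightarrow> 'a) topology" where
  "Isom_topology M d =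
     subtopology (product_topology (\<lambda>_. Metric_space.mtopology M d) M) (isometries M d)"

text \<open>In a topological group, a discrete subgroup with compact coset space (for the quotient
  topology, here the topology \<open>Q\<close>) is automatically a lattice.\<close>

definition cocompact_lattice :: "('g, 'm) monoid_scheme \<Rightarrow> 'g topology \<Rightarrow> 'g set \<Rightarrow> bool" where
  "cocompact_lattice G T \<Gamma> \<longleftrightarrow>
     subgroup \<Gamma> G \<and>
     subtopology T \<Gamma> = discrete_topology \<Gamma> \<and>
     (\<exists>Q. quotient_map T Q (\<lambda>g. g <#\<^bsub>G\<^esub> \<Gamma>) \<and> compact_space Q)"

section \<open>Fundamental groups and closed orientable surfaces\<close>

definition loops_at :: "'a topology \<Rightarrow> 'a \<Rightarrow> (real \<Rightarrow> 'a) set" where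
  "loops_at X x = {p. pathin X p \<and> p 0 = x \<and> p 1 = x}"

definition loop_homotopy :: "'a topology \<Rightarrow> 'a \<Rightarrow> ((real \<Rightarrow> 'a) \<times> (real \<Rightarrow> 'a)) set" where
  "loop_homotopy X x =
     {(p, q). p \<in> loops_at X x \<and> q \<in> loops_at X x \<and>
        homotopic_with (\<lambda>r. r 0 = x \<and> r 1 = x) (top_of_set {0..1}) X p q}"

text \<open>The same formula as \<^const>\<open>joinpaths\<close>, which is confined to the type class
  \<^class>\<open>topological_space\<close>.\<close>

definition concat_paths :: "(real \<Rightarrow> 'a) \<Rightarrow> (real \<Rightarrow> 'a) \<Rightarrow> real \<Rightarrow> 'a" where
  "concat_paths p q = (\<lambda>t. if t \<le> 1/2 then p (2 * t) else q (2 * t - 1))"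

definition fundamental_group :: "'a topology \<Rightarrow> 'a \<Rightarrow> (real \<Rightarrow> 'a) set monoid" where
  "fundamental_group X x =
     \<lparr>carrier = loops_at X x // loop_homotopy X x,
      mult = (\<lambda>A B. \<Union>p\<in>A. \<Union>q\<in>B. loop_homotopy X x `` {concat_paths p q}),
      one = loop_homotopy X x `` {\<lambda>_. x}\<rparr>"

text \<open>The boundary circle of the unit disc is cut into \<open>4 * g\<close> edges, numbered anticlockwise from
  0; this is the point at parameter \<open>s\<close> in \<open>[0,1]\<close> on edge \<open>k\<close>.\<close>

definition edge_point :: "nat \<Rightarrow> nat \<Rightarrow> real \<Rightarrow> complex" where
  "edge_point g k s = cis (2 * pi * (real k + s) / (4 * real g))"

text \<open>Edges \<open>4j, 4j+1, 4j+2, 4j+3\<close> are labelled \<open>a, b, a\<inverse>, b\<inverse>\<close> (for the \<open>j\<close>-th pair of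
  generators), so that edge \<open>4j\<close> is glued to \<open>4j+2\<close> and \<open>4j+1\<close> to \<open>4j+3\<close>, reversing direction.\<close>

definition edge_gluing :: "nat \<Rightarrow> (complex \<times> complex) set" where
  "edge_gluing g =
     {(edge_point g (4 * j + i) s, edge_point g (4 * j + i + 2) (1 - s)) | j i s.
        j < g \<and> i \<in> {0, 1} \<and> s \<in> {0..1}}"

text \<open>A space homeomorphic to the \<open>4g\<close>-gon with its edges glued according to the word
  \<open>[a\<^sub>1, b\<^sub>1] \<dots> [a\<^sub>g, b\<^sub>g]\<close> (for \<open>g > 0\<close>).\<close>

definition closed_orientable_surface :: "nat \<Rightarrow> 'a topology \<Rightarrow> bool" where
  "closed_orientable_surface g S \<longleftrightarrow>
     (\<exists>\<pi>. quotient_map (top_of_set (cball 0 1)) S \<pi> \<and>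
        (\<forall>x\<in>cball 0 1. \<forall>y\<in>cball 0 1.
           \<pi> x = \<pi> y \<longleftrightarrow> (x, y) \<in> (edge_gluing g \<union> (edge_gluing g)\<inverse>)\<^sup>*))"

section \<open>Central extensions\<close>

definition central_extension ::
  "('a, 'm) monoid_scheme \<Rightarrow> ('e, 'n) monoid_scheme \<Rightarrow> ('q, 'k) monoid_scheme \<Rightarrow> bool" where
  "central_extension A E Q \<longleftrightarrow>
     group E \<and>
     (\<exists>i p. i \<in> mon A E \<and> p \<in> epi E Q \<and> i ` carrier A = kernel E Q p \<and>
        (\<forall>a\<in>carrier A. \<forall>e\<in>carrier E. i a \<otimes>\<^bsub>E\<^esub> e = e \<otimes>\<^bsub>E\<^esub> i a))"

section \<open>Measure equivalence\<close>

definition finite_generating_set :: "('g, 'm) monoid_scheme \<Rightarrow> 'g set \<Rightarrow> bool" where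
  "finite_generating_set G S \<longleftrightarrow> finite S \<and> S \<subseteq> carrier G \<and> generate G S = carrier G"

definition word_length :: "('g, 'm) monoid_scheme \<Rightarrow> 'g set \<Rightarrow> 'g \<Rightarrow> nat" where
  "word_length G S g =
     (LEAST n. \<exists>w. length w = n \<and> set w \<subseteq> S \<union> m_inv G ` S \<and> foldr (mult G) w \<one>\<^bsub>G\<^esub> = g)"

definition free_mp_action ::
  "('g, 'm) monoid_scheme \<Rightarrow> 'x measure \<Rightarrow> ('g \<Rightarrow> 'x \<Rightarrow> 'x) \<Rightarrow> bool" where
  "free_mp_action G M \<phi> \<longleftrightarrow>
     group_action G (space M) \<phi> \<and>
     (\<forall>g\<in>carrier G. \<phi> g \<in> M \<rightarrow>\<^sub>M M \<and> distr M M (\<phi> g) = M) \<and>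
     (\<forall>g\<in>carrier G. \<forall>x\<in>space M. \<phi> g x = x \<longrightarrow> g = \<one>\<^bsub>G\<^esub>)"

definition finite_fundamental_domain ::
  "('g, 'm) monoid_scheme \<Rightarrow> 'x measure \<Rightarrow> ('g \<Rightarrow> 'x \<Rightarrow> 'x) \<Rightarrow> 'x set \<Rightarrow> bool" where
  "finite_fundamental_domain G M \<phi> F \<longleftrightarrow>
     F \<in> sets M \<and> emeasure M F < \<infinity> \<and>
     disjoint_family_on (\<lambda>g. \<phi> g ` F) (carrier G) \<and>
     (\<Union>g\<in>carrier G. \<phi> g ` F) = space M"

text \<open>\<open>F\<^sub>G\<close> and \<open>F\<^sub>H\<close> are fundamental domains of \<open>G\<close> and \<open>H\<close> respectively.\<close>

definition measure_coupling ::
  "('g, 'm) monoid_scheme \<Rightarrow> ('h, 'n) monoid_scheme \<Rightarrow> 'x measure \<Rightarrow>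
   ('g \<Rightarrow> 'x \<Rightarrow> 'x) \<Rightarrow> ('h \<Rightarrow> 'x \<Rightarrow> 'x) \<Rightarrow> 'x set \<Rightarrow> 'x set \<Rightarrow> bool" where
  "measure_coupling G H M \<phi> \<psi> F\<^sub>G F\<^sub>H \<longleftrightarrow>
     sigma_finite_measure M \<and> emeasure M (space M) \<noteq> 0 \<and>
     free_mp_action G M \<phi> \<and> free_mp_action H M \<psi> \<and>
     (\<forall>g\<in>carrier G. \<forall>h\<in>carrier H. \<forall>x\<in>space M. \<phi> g (\<psi> h x) = \<psi> h (\<phi> g x)) \<and>
     finite_fundamental_domain G M \<phi> F\<^sub>G \<and> finite_fundamental_domain H M \<psi> F\<^sub>H"

text \<open>For \<open>x\<close> in the fundamental domain \<open>F\<close> of \<open>H\<close>, the unique \<open>h\<close> that brings \<open>\<phi> g x\<close> back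
  into \<open>F\<close>.\<close>

definition me_cocycle ::
  "('h, 'n) monoid_scheme \<Rightarrow> ('g \<Rightarrow> 'x \<Rightarrow> 'x) \<Rightarrow> ('h \<Rightarrow> 'x \<Rightarrow> 'x) \<Rightarrow> 'x set \<Rightarrow> 'g \<Rightarrow> 'x \<Rightarrow> 'h" where
  "me_cocycle H \<phi> \<psi> F g x = (THE h. h \<in> carrier H \<and> \<psi> h (\<phi> g x) \<in> F)"

text \<open>The type argument is the type of the points of the coupling space; a statement about all
  coupling spaces is polymorphic in it. The choice of the generating sets is immaterial, since
  the word lengths of any two finite generating sets are bi-Lipschitz equivalent.\<close>

definition Lq_measure_equivalent ::
  "'x itself \<Rightarrow> real \<Rightarrow> ('g, 'm) monoid_scheme \<Rightarrow> ('h, 'n) monoid_scheme \<Rightarrow> bool" where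
  "Lq_measure_equivalent _ q G H \<longleftrightarrow>
     (\<exists>S T (M :: 'x measure) \<phi> \<psi> F\<^sub>G F\<^sub>H.
        finite_generating_set G S \<and> finite_generating_set H T \<and>
        measure_coupling G H M \<phi> \<psi> F\<^sub>G F\<^sub>H \<and>
        (\<forall>g\<in>carrier G.
           (\<integral>\<^sup>+x\<in>F\<^sub>H. ennreal (real (word_length H T (me_cocycle H \<phi> \<psi> F\<^sub>H g x)) powr q) \<partial>M) < \<infinity>) \<and>
        (\<forall>h\<in>carrier H.
           (\<integral>\<^sup>+y\<in>F\<^sub>G. ennreal (real (word_length G S (me_cocycle G \<psi> \<phi> F\<^sub>G h y)) powr q) \<partial>M) < \<infinity>))"

end

theory Submission
  imports Defs
begin

text \<open>The surface group plays no role: all that matters about \<open>\<Lambda>\<close> is that it has infinitely many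
  central elements \<open>\<zeta>\<^sub>n\<close>. Label the points of the coupling by \<open>\<Gamma>\<close> equivariantly, with fibre \<open>F\<^sub>\<Gamma>\<close> over the
  identity, and pull back a bounded function \<open>f\<close> on \<open>\<Gamma>\<close> whose right differences are \<open>p\<close>-summable. By
  the \<open>L\<^sup>p\<close> condition on the cocycle the \<open>\<Lambda>\<close>-differences of the pullback lie in \<open>L\<^sup>p\<close> of the coupling,
  so their mass on the disjoint sets \<open>\<zeta>\<^sub>n F\<^sub>\<Lambda>\<close> tends to 0. Since \<open>\<zeta>\<^sub>n\<close> is central, the distributions on
  \<open>\<Gamma>\<close> of the labels of \<open>\<zeta>\<^sub>n F\<^sub>\<Lambda>\<close> are therefore asymptotically invariant on such functions under left
  translation.

  On hyperbolic space, the orbit of a lattice has critical exponent at most 2, so for \<open>p > 2\<close> this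
  applies to \<open>u\<^sub>\<gamma>(x) = ln (cosh d(\<gamma>o, x) / cosh d(o, x))\<close>, which extends to a Lipschitz function on
  the closed Klein ball. The cocycle identity \<open>u\<^sub>\<gamma>(\<gamma>x) = - u\<^sub>\<delta>(x)\<close> with \<open>\<delta> = \<gamma>\<inverse>\<close> shows that the
  sum of the \<open>u\<^sub>\<gamma>\<close> over a finite symmetric set must have mean 0 asymptotically. But over the set
  of all \<open>\<gamma>\<close> with \<open>cosh d(o, \<gamma>o) \<le> T\<close> and \<open>T\<close> large this sum is at least 1 everywhere, because about
  \<open>T\<^sup>2\<close> of the summands are at least 1 and only \<open>O(T)\<close> are not, each of them being at least
  \<open>- ln (2 T)\<close>.\<close>

section \<open>Word lengths\<close>

lemma (in group) foldr_mult_closed: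
  assumes "set w \<subseteq> carrier G"
  shows "foldr (\<otimes>) w \<one> \<in> carrier G"
  using assms by (induction w) auto

lemma (in group) foldr_mult_append:
  assumes "set v \<subseteq> carrier G" "set w \<subseteq> carrier G"
  shows "foldr (\<otimes>) (v @ w) \<one> = foldr (\<otimes>) v \<one> \<otimes> foldr (\<otimes>) w \<one>"
  using assms by (induction v) (auto simp: m_assoc foldr_mult_closed simp del: foldr_append)

lemma (in group) generate_word:
  assumes "S \<subseteq> carrier G" "x \<in> generate G S"
  obtains w where "set w \<subseteq> S \<union> m_inv G ` S" "foldr (\<otimes>) w \<one> = x"
proof -
  have letters: "S \<union> m_inv G ` S \<subseteq> carrier G"
    using assms(1) by auto
  from assms(2) have "\<exists>w. set w \<subseteq> S \<union> m_inv G ` S \<and> foldr (\<otimes>) w \<one> = x"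
  proof induction
    case one
    show ?case by (intro exI[of _ "[]"]) auto
  next
    case (incl h)
    then show ?case using assms(1) by (intro exI[of _ "[h]"]) auto
  next
    case (inv h)
    then show ?case using assms(1) by (intro exI[of _ "[inv h]"]) auto
  next
    case (eng h1 h2)
    then obtain v w where "set v \<subseteq> S \<union> m_inv G ` S" "foldr (\<otimes>) v \<one> = h1"
      "set w \<subseteq> S \<union> m_inv G ` S" "foldr (\<otimes>) w \<one> = h2"
      by blast
    moreover from this have "foldr (\<otimes>) (v @ w) \<one> = h1 \<otimes> h2"
      using foldr_mult_append[OF subset_trans[OF _ letters] subset_trans[OF _ letters], of v w] by simp
    ultimately show ?case
      by (intro exI[of _ "v @ w"] conjI) (simp_all del: foldr_append)
  qed
  then show thesis using that by (elim exE conjE)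
qed

text \<open>On the generated subgroup the \<open>LEAST\<close> in \<open>word_length\<close> is a
  true minimum and not a default value.\<close>

lemma (in group) word_length_attained:
  assumes "S \<subseteq> carrier G" "x \<in> generate G S"
  obtains w where "length w = word_length G S x" "set w \<subseteq> S \<union> m_inv G ` S" "foldr (\<otimes>) w \<one> = x"
proof -
  obtain v where "set v \<subseteq> S \<union> m_inv G ` S" "foldr (\<otimes>) v \<one> = x"
    using generate_word[OF assms] .
  then have "\<exists>n w. length w = n \<and> set w \<subseteq> S \<union> m_inv G ` S \<and> foldr (\<otimes>) w \<one> = x"
    by (intro exI[of _ "length v"] exI[of _ v]) simp
  from LeastI_ex[OF this]
  have "\<exists>w. length w = word_length G S x \<and> set w \<subseteq> S \<union> m_inv G ` S \<and> foldr (\<otimes>) w \<one> = x"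
    unfolding word_length_def .
  then show thesis using that by (elim exE conjE)
qed

lemma (in group) finite_generating_set_countable:
  assumes "finite_generating_set G S"
  shows "countable (carrier G)"
proof -
  have S: "finite S" "S \<subseteq> carrier G" "generate G S = carrier G"
    using assms by (auto simp: finite_generating_set_def)
  have "carrier G \<subseteq> (\<lambda>w. foldr (\<otimes>) w \<one>) ` lists (S \<union> m_inv G ` S)"
  proof
    fix x assume "x \<in> carrier G"
    then have "x \<in> generate G S" using S by simp
    then obtain w where "set w \<subseteq> S \<union> m_inv G ` S" "foldr (\<otimes>) w \<one> = x"
      using generate_word[OF S(2)] by blast
    then show "x \<in> (\<lambda>w. foldr (\<otimes>) w \<one>) ` lists (S \<union> m_inv G ` S)"
      by (intro image_eqI[of _ _ w]) (simp_all add: in_lists_conv_set subset_iff)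
  qed
  moreover have "countable (lists (S \<union> m_inv G ` S))"
    using S by (intro countable_lists countable_finite) auto
  ultimately show ?thesis
    by (meson countable_image countable_subset)
qed

section \<open>Sums over the group and right translations\<close>

lemma (in group) nn_integral_count_space_mult_right:
  assumes "x \<in> carrier G"
  shows "(\<integral>\<^sup>+\<gamma>. f (\<gamma> \<otimes> x) \<partial>count_space (carrier G)) = (\<integral>\<^sup>+\<gamma>. f \<gamma> \<partial>count_space (carrier G))"
proof (rule nn_integral_bij_count_space)
  show "bij_betw (\<lambda>\<gamma>. \<gamma> \<otimes> x) (carrier G) (carrier G)"
    using assms
    by (intro bij_betw_byWitness[where f' = "\<lambda>\<gamma>. \<gamma> \<otimes> inv x"]) (auto simp: m_assoc)
qed

text \<open>Convexity of the p-th power with the weights \<open>1 / (n + 1)\<close> and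
  \<open>n / (n + 1)\<close>. With these weights, induction along a word reproduces
  \<open>K * n powr p\<close> exactly, as Minkowski's inequality would.\<close>

lemma powr_add_le:
  fixes a b n p :: real
  assumes "a \<ge> 0" "b \<ge> 0" "n > 0" "p \<ge> 1"
  shows "(a + b) powr p \<le> (n + 1) powr (p - 1) * (a powr p + b powr p / n powr (p - 1))"
proof (cases "a = 0 \<or> b = 0")
  case True
  \<comment> \<open>A vanishing summand is treated apart: it suffices that both coefficients on the
    right are at least 1.\<close>
  have "(n + 1) powr (p - 1) \<ge> 1"
    using assms by (intro ge_one_powr_ge_zero) auto
  moreover have "(n + 1) powr (p - 1) / n powr (p - 1) \<ge> 1"
    using assms powr_mono2[of "p - 1" n "n + 1"] by simp
  ultimately have "a powr p * 1 \<le> a powr p * (n + 1) powr (p - 1)"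
    "b powr p * 1 \<le> b powr p * ((n + 1) powr (p - 1) / n powr (p - 1))"
    by (intro mult_left_mono; simp)+
  with True show ?thesis
    using assms by (elim disjE) (simp_all add: mult.commute[of "(n + 1) powr (p - 1)"])
next
  case False
  then have ab: "a > 0" "b > 0" using assms by auto
  let ?t = "n / (n + 1)"
  have t: "1 - ?t = 1 / (n + 1)"
    using assms by (simp add: field_simps)
  have "((1 - ?t) *\<^sub>R ((n + 1) * a) + ?t *\<^sub>R ((n + 1) * b / n)) powr p
      \<le> (1 - ?t) * ((n + 1) * a) powr p + ?t * ((n + 1) * b / n) powr p"
    using assms ab by (intro convex_onD[OF powr_convex[OF assms(4)]]) auto
  also have "(1 - ?t) *\<^sub>R ((n + 1) * a) + ?t *\<^sub>R ((n + 1) * b / n) = a + b"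
    unfolding t using assms by simp
  also have "(1 - ?t) * ((n + 1) * a) powr p = (n + 1) powr (p - 1) * a powr p"
  proof -
    have "(n + 1) powr p = (n + 1) * (n + 1) powr (p - 1)"
      using assms powr_add[of "n + 1" 1 "p - 1"] by simp
    then have "(1 - ?t) * ((n + 1) * a) powr p = 1 / (n + 1) * ((n + 1) * (n + 1) powr (p - 1) * a powr p)"
      unfolding t using assms ab by (simp only: powr_mult)
    then show ?thesis using assms by simp
  qed
  also have "?t * ((n + 1) * b / n) powr p = (n + 1) powr (p - 1) * (b powr p / n powr (p - 1))"
  proof -
    have "(n + 1) powr p = (n + 1) * (n + 1) powr (p - 1)" "n powr p = n * n powr (p - 1)"
      using assms powr_add[of "n + 1" 1 "p - 1"] powr_add[of n 1 "p - 1"] by auto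
    then have "?t * ((n + 1) * b / n) powr p
        = ?t * ((n + 1) * (n + 1) powr (p - 1) * b powr p / (n * n powr (p - 1)))"
      using assms ab by (simp only: powr_mult powr_divide)
    then show ?thesis using assms by simp
  qed
  finally show ?thesis by (simp add: distrib_left)
qed


text \<open>Minkowski's inequality along the word, in a form without roots.\<close>

lemma (in group) nn_integral_right_translate_le:
  fixes f :: "'a \<Rightarrow> real"
  assumes p: "p \<ge> 1" and T: "T \<subseteq> carrier G" and w: "set w \<subseteq> T"
    and K: "\<And>s. s \<in> T \<Longrightarrow>
      (\<integral>\<^sup>+\<gamma>. ennreal (\<bar>f (\<gamma> \<otimes> s) - f \<gamma>\<bar> powr p) \<partial>count_space (carrier G)) \<le> ennreal K"
    and "K \<ge> 0"
  shows "(\<integral>\<^sup>+\<gamma>. ennreal (\<bar>f (\<gamma> \<otimes> foldr (\<otimes>) w \<one>) - f \<gamma>\<bar> powr p) \<partial>count_space (carrier G))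
    \<le> ennreal (K * real (length w) powr p)"
  using w
proof (induction w)
  case Nil
  have "(\<integral>\<^sup>+\<gamma>. ennreal (\<bar>f (\<gamma> \<otimes> \<one>) - f \<gamma>\<bar> powr p) \<partial>count_space (carrier G))
      = (\<integral>\<^sup>+\<gamma>. 0 \<partial>count_space (carrier G))"
    by (intro nn_integral_cong) simp
  then show ?case by simp
next
  case (Cons s w)
  let ?x = "foldr (\<otimes>) w \<one>" and ?n = "real (length w)"
  let ?C = "count_space (carrier G)"
  have s: "s \<in> T" "s \<in> carrier G" and x: "?x \<in> carrier G"
    using Cons.prems T by (auto intro!: foldr_mult_closed)
  show ?case
  proof (cases "w = []")
    \<comment> \<open>A single letter is treated apart since \<open>powr_add_le\<close> needs a
      positive number of remaining letters.\<close>
    case True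
    then show ?thesis using K[OF s(1)] s by simp
  next
    case False
    then have n: "?n > 0" by simp
    define a where "a = (\<lambda>\<gamma>. \<bar>f (\<gamma> \<otimes> s) - f \<gamma>\<bar>)"
    define b where "b = (\<lambda>\<gamma>. \<bar>f (\<gamma> \<otimes> s \<otimes> ?x) - f (\<gamma> \<otimes> s)\<bar>)"
    have ia: "(\<integral>\<^sup>+\<gamma>. ennreal (a \<gamma> powr p) \<partial>?C) \<le> ennreal K"
      unfolding a_def by (rule K[OF s(1)])
    have "(\<integral>\<^sup>+\<gamma>. ennreal (b \<gamma> powr p) \<partial>?C) = (\<integral>\<^sup>+\<gamma>. ennreal (\<bar>f (\<gamma> \<otimes> ?x) - f \<gamma>\<bar> powr p) \<partial>?C)"
      unfolding b_def by (rule nn_integral_count_space_mult_right[OF s(2)])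
    also have "\<dots> \<le> ennreal (K * ?n powr p)"
      using Cons by simp
    finally have ib: "(\<integral>\<^sup>+\<gamma>. ennreal (b \<gamma> powr p) \<partial>?C) \<le> ennreal (K * ?n powr p)" .
    let ?u = "(?n + 1) powr (p - 1)" and ?v = "?n powr (p - 1)"
    have v: "?v > 0" "?u > 0" using n by auto
    have pt: "ennreal (\<bar>f (\<gamma> \<otimes> (s \<otimes> ?x)) - f \<gamma>\<bar> powr p)
        \<le> ennreal ?u * (ennreal (a \<gamma> powr p) + ennreal (1 / ?v) * ennreal (b \<gamma> powr p))"
      if "\<gamma> \<in> carrier G" for \<gamma>
    proof -
      have "\<bar>f (\<gamma> \<otimes> (s \<otimes> ?x)) - f \<gamma>\<bar> powr p \<le> (a \<gamma> + b \<gamma>) powr p"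
        unfolding a_def b_def using p that s x by (intro powr_mono2) (auto simp: m_assoc)
      also have "\<dots> \<le> ?u * (a \<gamma> powr p + b \<gamma> powr p / ?v)"
        by (rule powr_add_le[OF _ _ n p]) (auto simp: a_def b_def)
      finally show ?thesis
        using v by (simp flip: ennreal_mult ennreal_plus)
    qed
    have "(\<integral>\<^sup>+\<gamma>. ennreal (\<bar>f (\<gamma> \<otimes> (s \<otimes> ?x)) - f \<gamma>\<bar> powr p) \<partial>?C)
        \<le> (\<integral>\<^sup>+\<gamma>. ennreal ?u * (ennreal (a \<gamma> powr p) + ennreal (1 / ?v) * ennreal (b \<gamma> powr p)) \<partial>?C)"
      by (rule nn_integral_mono) (use pt in simp)
    also have "\<dots> = ennreal ?u * ((\<integral>\<^sup>+\<gamma>. ennreal (a \<gamma> powr p) \<partial>?C)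
        + ennreal (1 / ?v) * (\<integral>\<^sup>+\<gamma>. ennreal (b \<gamma> powr p) \<partial>?C))"
      by (simp add: nn_integral_cmult nn_integral_add)
    also have "\<dots> \<le> ennreal ?u * (ennreal K + ennreal (1 / ?v) * ennreal (K * ?n powr p))"
      by (intro mult_left_mono add_mono ia ib) auto
    also have "\<dots> = ennreal (?u * (K + 1 / ?v * (K * ?n powr p)))"
      using \<open>K \<ge> 0\<close> v by (simp flip: ennreal_mult ennreal_plus)
    also have "?u * (K + 1 / ?v * (K * ?n powr p)) = K * (?n + 1) powr p"
    proof -
      have "?n powr p = ?n * ?v" "(?n + 1) powr p = (?n + 1) * ?u"
        using n powr_add[of ?n 1 "p - 1"] powr_add[of "?n + 1" 1 "p - 1"] by auto
      then show ?thesis using v by (simp add: algebra_simps)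
    qed
    finally show ?thesis by (simp add: add.commute)
  qed
qed

section \<open>Fundamental domains of free actions\<close>

locale fundamental_domain =
  fixes G (structure) and M :: "'x measure" and \<phi> :: "'g \<Rightarrow> 'x \<Rightarrow> 'x" and F :: "'x set"
  assumes free_mp: "free_mp_action G M \<phi>"
    and domain: "finite_fundamental_domain G M \<phi> F"
    and countable: "countable (carrier G)"
begin

lemma group_action: "group_action G (space M) \<phi>"
  using free_mp by (simp add: free_mp_action_def)

sublocale group_action G "space M" \<phi>
  by (rule group_action)

sublocale group G
  using group_hom by (simp add: group_hom_def)

lemma measurable_act [measurable]: "g \<in> carrier G \<Longrightarrow> \<phi> g \<in> M \<rightarrow>\<^sub>M M"
  using free_mp by (simp add: free_mp_action_def)

lemma act_closed: "g \<in> carrier G \<Longrightarrow> x \<in> space M \<Longrightarrow> \<phi> g x \<in> space M"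
  by (rule element_image) auto

lemma act_one: "x \<in> space M \<Longrightarrow> \<phi> \<one> x = x"
  using id_eq_one by (metis restrict_apply')

lemma act_inv: "g \<in> carrier G \<Longrightarrow> x \<in> space M \<Longrightarrow> \<phi> (inv g) (\<phi> g x) = x"
  by (metis act_one composition_rule inv_closed l_inv)

lemma act_inv': "g \<in> carrier G \<Longrightarrow> x \<in> space M \<Longrightarrow> \<phi> g (\<phi> (inv g) x) = x"
  by (metis act_one composition_rule inv_closed r_inv)

lemma nn_integral_act:
  assumes "g \<in> carrier G" and [measurable]: "f \<in> borel_measurable M"
  shows "(\<integral>\<^sup>+x. f (\<phi> g x) \<partial>M) = (\<integral>\<^sup>+x. f x \<partial>M)"
proof -
  have "distr M M (\<phi> g) = M"
    using assms(1) free_mp by (simp add: free_mp_action_def)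
  then have "(\<integral>\<^sup>+x. f x \<partial>M) = (\<integral>\<^sup>+x. f x \<partial>distr M M (\<phi> g))"
    by simp
  also have "\<dots> = (\<integral>\<^sup>+x. f (\<phi> g x) \<partial>M)"
    using assms by (intro nn_integral_distr) auto
  finally show ?thesis ..
qed

lemma domain_measurable [measurable]: "F \<in> sets M"
  and domain_finite: "emeasure M F < \<infinity>"
  and domain_cover: "(\<Union>g\<in>carrier G. \<phi> g ` F) = space M"
  and domain_disjoint: "disjoint_family_on (\<lambda>g. \<phi> g ` F) (carrier G)"
  using domain by (auto simp: finite_fundamental_domain_def)

lemma domain_subset: "F \<subseteq> space M"
  using domain_measurable by (rule sets.sets_into_space)

text \<open>The group coordinate in the identification of the space with the product of the group
  and \<open>F\<close>.\<close>

definition label :: "'x \<Rightarrow> 'g" where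
  "label x = (THE g. g \<in> carrier G \<and> x \<in> \<phi> g ` F)"

lemma label_eqI: "g \<in> carrier G \<Longrightarrow> x \<in> \<phi> g ` F \<Longrightarrow> label x = g"
  unfolding label_def using domain_disjoint
  by (intro the_equality) (auto simp: disjoint_family_on_def)

lemma label_in_image: "x \<in> space M \<Longrightarrow> label x \<in> carrier G \<and> x \<in> \<phi> (label x) ` F"
  using domain_cover label_eqI by (metis UN_E)

lemma label_closed: "x \<in> space M \<Longrightarrow> label x \<in> carrier G"
  using label_in_image by blast

lemma label_eq_iff:
  assumes "g \<in> carrier G" "x \<in> space M"
  shows "label x = g \<longleftrightarrow> \<phi> (inv g) x \<in> F"
proof
  assume "label x = g"
  then obtain y where "y \<in> F" "x = \<phi> g y"
    using label_in_image[OF assms(2)] by blast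
  then show "\<phi> (inv g) x \<in> F"
    using act_inv[OF assms(1)] domain_subset by auto
next
  assume "\<phi> (inv g) x \<in> F"
  then have "x \<in> \<phi> g ` F"
    using act_inv'[OF assms] by (metis imageI)
  then show "label x = g" by (rule label_eqI[OF assms(1)])
qed

lemma label_act:
  assumes "g \<in> carrier G" "x \<in> space M"
  shows "label (\<phi> g x) = g \<otimes> label x"
proof -
  obtain y where y: "y \<in> F" "x = \<phi> (label x) y" and l: "label x \<in> carrier G"
    using label_in_image[OF assms(2)] by blast
  have "\<phi> g x = \<phi> (g \<otimes> label x) y"
    using assms l y domain_subset by (subst y(2)) (auto simp: composition_rule)
  then show ?thesis
    using y assms l by (intro label_eqI) auto
qed

lemma label_domain: "x \<in> F \<Longrightarrow> label x = \<one>"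
  using label_eq_iff[of \<one> x] domain_subset act_one by auto

text \<open>The link to \<open>me_cocycle\<close>: applied to the image of a point under the other
  group, this expresses the cocycle by labels, whence its measurability.\<close>

lemma cocycle_eq_inv_label:
  assumes "x \<in> space M"
  shows "(THE g. g \<in> carrier G \<and> \<phi> g x \<in> F) = inv (label x)"
proof (rule the_equality)
  show "inv (label x) \<in> carrier G \<and> \<phi> (inv (label x)) x \<in> F"
    using assms label_closed label_eq_iff by auto
  show "g = inv (label x)" if "g \<in> carrier G \<and> \<phi> g x \<in> F" for g
    using that assms label_eq_iff[of "inv g" x] by auto
qed

lemma measurable_label [measurable]: "label \<in> M \<rightarrow>\<^sub>M count_space (carrier G)"
  unfolding measurable_count_space_eq_countable[OF countable]
proof (intro conjI ballI)
  show "label \<in> space M \<rightarrow> carrier G" using label_closed by auto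
  fix g assume g: "g \<in> carrier G"
  then have "label -` {g} \<inter> space M = \<phi> (inv g) -` F \<inter> space M"
    using label_eq_iff by auto
  also have "\<dots> \<in> sets M"
    using g by (intro measurable_sets[OF measurable_act]) auto
  finally show "label -` {g} \<inter> space M \<in> sets M" .
qed

lemma measurable_compose_label [measurable (raw)]:
  assumes [measurable]: "t \<in> N \<rightarrow>\<^sub>M M"
  shows "(\<lambda>x. (f :: 'g \<Rightarrow> 'b :: topological_space) (label (t x))) \<in> borel_measurable N"
proof -
  have "f \<in> count_space (carrier G) \<rightarrow>\<^sub>M borel" by simp
  moreover have "(\<lambda>x. label (t x)) \<in> N \<rightarrow>\<^sub>M count_space (carrier G)" by measurable
  ultimately show ?thesis by (rule measurable_compose[rotated])
qed

lemma sum_indicator_label: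
  assumes "x \<in> space M"
  shows "(\<integral>\<^sup>+g. indicator {x. label x = g} x \<partial>count_space (carrier G)) = (1::ennreal)"
proof -
  have "(\<integral>\<^sup>+g. indicator {x. label x = g} x \<partial>count_space (carrier G))
      = (\<integral>\<^sup>+g. indicator {label x} g \<partial>count_space (carrier G))"
    by (intro nn_integral_cong) (auto simp: indicator_def)
  also have "\<dots> = 1"
    using label_closed[OF assms] by (subst nn_integral_indicator) (auto simp: one_ennreal_def)
  finally show ?thesis .
qed

section \<open>Integration over the translates of the domain\<close>

lemma nn_integral_split_label:
  assumes [measurable]: "f \<in> borel_measurable M"
  shows "(\<integral>\<^sup>+x. f x \<partial>M) =
    (\<integral>\<^sup>+g. (\<integral>\<^sup>+x. f x * indicator {x. label x = g} x \<partial>M) \<partial>count_space (carrier G))"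
proof -
  have meas: "(\<lambda>x. f x * indicator {x. label x = g} x) \<in> borel_measurable M" for g
  proof -
    have "(\<lambda>x. (if label x = g then 1 else 0::ennreal)) \<in> borel_measurable M"
      using measurable_compose_label[of "\<lambda>x. x" M "\<lambda>h. if h = g then 1 else 0::ennreal"] by simp
    then have "(\<lambda>x. f x * (if label x = g then 1 else 0)) \<in> borel_measurable M"
      by measurable
    then show ?thesis by (simp add: indicator_def of_bool_def)
  qed
  have "(\<integral>\<^sup>+x. f x \<partial>M)
      = (\<integral>\<^sup>+x. (\<integral>\<^sup>+g. f x * indicator {x. label x = g} x \<partial>count_space (carrier G)) \<partial>M)"
    by (intro nn_integral_cong) (simp add: nn_integral_cmult sum_indicator_label)
  also have "\<dots> = (\<integral>\<^sup>+g. (\<integral>\<^sup>+x. f x * indicator {x. label x = g} x \<partial>M) \<partial>count_space (carrier G))"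
    using countable meas by (intro nn_integral_count_space_nn_integral) auto
  finally show ?thesis .
qed

text \<open>On the piece with label \<open>g\<close>, the measure preserving map
  \<open>\<phi> (inv g)\<close> is a bijection onto \<open>F\<close>.\<close>

lemma nn_integral_unfold:
  assumes [measurable]: "f \<in> borel_measurable M"
  shows "(\<integral>\<^sup>+x. f x \<partial>M) = (\<integral>\<^sup>+g. (\<integral>\<^sup>+x\<in>F. f (\<phi> g x) \<partial>M) \<partial>count_space (carrier G))"
proof -
  have "(\<integral>\<^sup>+x. f x * indicator {x. label x = g} x \<partial>M) = (\<integral>\<^sup>+x\<in>F. f (\<phi> g x) \<partial>M)"
    if g: "g \<in> carrier G" for g
  proof -
    have "(\<integral>\<^sup>+x. f x * indicator {x. label x = g} x \<partial>M)
        = (\<integral>\<^sup>+x. f (\<phi> g (\<phi> (inv g) x)) * indicator F (\<phi> (inv g) x) \<partial>M)"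
      using g by (intro nn_integral_cong) (auto simp: act_inv' label_eq_iff indicator_def)
    also have "\<dots> = (\<integral>\<^sup>+x. f (\<phi> g x) * indicator F x \<partial>M)"
      using g by (intro nn_integral_act) auto
    finally show ?thesis .
  qed
  then show ?thesis
    unfolding nn_integral_split_label[OF assms]
    by (rule nn_integral_cong) simp
qed

text \<open>Mass transport: an invariant function has the same integral over all fundamental domains. The
  second domain is here the preimage of \<open>F\<close> under \<open>t'\<close>.\<close>

lemma nn_integral_invariant:
  assumes t: "t \<in> M \<rightarrow>\<^sub>M M" "t' \<in> M \<rightarrow>\<^sub>M M"
    and mp: "\<And>u. u \<in> borel_measurable M \<Longrightarrow> (\<integral>\<^sup>+x. u (t x) \<partial>M) = (\<integral>\<^sup>+x. (u x :: ennreal) \<partial>M)"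
    and inv: "\<And>x. x \<in> space M \<Longrightarrow> t' (t x) = x"
    and comm: "\<And>g x. g \<in> carrier G \<Longrightarrow> x \<in> space M \<Longrightarrow> t' (\<phi> g x) = \<phi> g (t' x)"
    and k: "k \<in> borel_measurable M" "\<And>g x. g \<in> carrier G \<Longrightarrow> x \<in> space M \<Longrightarrow> k (\<phi> g x) = k x"
  shows "(\<integral>\<^sup>+x\<in>F. k (t x) \<partial>M) = (\<integral>\<^sup>+x\<in>F. k x \<partial>M)"
proof -
  note [measurable] = t k(1)
  let ?C = "count_space (carrier G)"
  have t'M: "t' x \<in> space M" if "x \<in> space M" for x
    using measurable_space[OF t(2) that] .
  \<comment> \<open>The indicator is rewritten so that the integrand depends on \<open>t x\<close>
    only; then \<open>t\<close> can be removed.\<close>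
  have "(\<integral>\<^sup>+x\<in>F. k (t x) \<partial>M) = (\<integral>\<^sup>+x. k (t x) * indicator F (t' (t x)) \<partial>M)"
    by (intro nn_integral_cong) (simp add: inv)
  also have "\<dots> = (\<integral>\<^sup>+x. k x * indicator F (t' x) \<partial>M)"
    by (intro mp) measurable
  also have "\<dots> = (\<integral>\<^sup>+g. (\<integral>\<^sup>+x\<in>F. k (\<phi> g x) * indicator F (t' (\<phi> g x)) \<partial>M) \<partial>?C)"
    by (intro nn_integral_unfold) measurable
  also have "\<dots> = (\<integral>\<^sup>+g. (\<integral>\<^sup>+x\<in>F. k x * indicator F (\<phi> g (t' x)) \<partial>M) \<partial>?C)"
    by (intro nn_integral_cong) (simp add: k(2) comm)
  also have "\<dots> = (\<integral>\<^sup>+x. (\<integral>\<^sup>+g. k x * indicator F (\<phi> g (t' x)) * indicator F x \<partial>?C) \<partial>M)"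
    using countable by (intro nn_integral_count_space_nn_integral[symmetric]) auto
  also have "\<dots> = (\<integral>\<^sup>+x\<in>F. k x \<partial>M)"
  proof (rule nn_integral_cong)
    fix x assume x: "x \<in> space M"
    \<comment> \<open>Exactly one group element moves \<open>t' x\<close> into \<open>F\<close>, so
      the sum over \<open>g\<close> reduces to a single term.\<close>
    have "(\<integral>\<^sup>+g. k x * indicator F (\<phi> g (t' x)) * indicator F x \<partial>?C)
        = (\<integral>\<^sup>+g. (k x * indicator F x) * indicator {inv (label (t' x))} g \<partial>?C)"
    proof (rule nn_integral_cong)
      fix g assume "g \<in> space ?C"
      then have "\<phi> g (t' x) \<in> F \<longleftrightarrow> g = inv (label (t' x))"
        using t'M[OF x] label_eq_iff[of "inv g" "t' x"] label_closed[OF t'M[OF x]] by auto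
      then show "k x * indicator F (\<phi> g (t' x)) * indicator F x
          = (k x * indicator F x) * indicator {inv (label (t' x))} g"
        by (simp add: indicator_def)
    qed
    also have "\<dots> = k x * indicator F x"
      using label_closed[OF t'M[OF x]]
      by (subst nn_integral_cmult_indicator) (auto simp: one_ennreal_def[symmetric])
    finally show "(\<integral>\<^sup>+g. k x * indicator F (\<phi> g (t' x)) * indicator F x \<partial>?C) = k x * indicator F x" .
  qed
  finally show ?thesis .
qed

text \<open>Translates of \<open>F\<close> by distinct elements are disjoint, so these are terms of a convergent series.\<close>

lemma nn_integral_translates_tendsto_0:
  fixes \<zeta> :: "nat \<Rightarrow> 'g"
  assumes \<zeta>: "inj \<zeta>" "range \<zeta> \<subseteq> carrier G"
    and w: "w \<in> borel_measurable M" "(\<integral>\<^sup>+x. w x \<partial>M) < \<infinity>"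
  shows "(\<lambda>n. \<integral>\<^sup>+x\<in>F. w (\<phi> (\<zeta> n) x) \<partial>M) \<longlonglongrightarrow> 0"
proof -
  let ?a = "\<lambda>n. \<integral>\<^sup>+x\<in>F. w (\<phi> (\<zeta> n) x) \<partial>M"
  have "(\<Sum>n. ?a n) = (\<integral>\<^sup>+n. ?a n \<partial>count_space UNIV)"
    by (simp add: nn_integral_count_space_nat)
  also have "\<dots> = (\<integral>\<^sup>+g. (\<integral>\<^sup>+x\<in>F. w (\<phi> g x) \<partial>M) \<partial>count_space (range \<zeta>))"
    by (rule nn_integral_bij_count_space) (use \<zeta> in \<open>simp add: bij_betw_def\<close>)
  also have "\<dots> \<le> (\<integral>\<^sup>+g. (\<integral>\<^sup>+x\<in>F. w (\<phi> g x) \<partial>M) \<partial>count_space (carrier G))"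
    by (subst (1 2) nn_integral_count_space_indicator)
      (use \<zeta>(2) in \<open>auto intro!: nn_integral_mono simp: indicator_def range_subsetD\<close>)
  also have "\<dots> = (\<integral>\<^sup>+x. w x \<partial>M)"
    by (rule nn_integral_unfold[OF w(1), symmetric])
  finally have "(\<Sum>n. ?a n) \<noteq> \<infinity>"
    using w(2) by auto
  then have fin: "?a n \<noteq> \<infinity>" for n
    using ennreal_suminf_lessD[of ?a \<infinity> n] by (simp add: less_top)
  have s: "summable (\<lambda>n. enn2real (?a n))"
    using \<open>(\<Sum>n. ?a n) \<noteq> \<infinity>\<close> fin
    by (intro summable_suminf_not_top) (auto simp: ennreal_enn2real_if)
  have "(\<lambda>n. ennreal (enn2real (?a n))) \<longlonglongrightarrow> ennreal 0"
    by (intro tendsto_ennrealI summable_LIMSEQ_zero s)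
  then show ?thesis using fin by (simp add: ennreal_enn2real_if)
qed

end

section \<open>Measure couplings\<close>

lemma tendsto_0_ennrealI:
  assumes "\<And>e::real. e > 0 \<Longrightarrow> eventually (\<lambda>n. a n \<le> ennreal e) F"
  shows "(a \<longlongrightarrow> (0::ennreal)) F"
proof (rule order_tendstoI)
  fix b :: ennreal assume "0 < b"
  then obtain c where c: "0 < c" "c < b" using dense by blast
  then obtain e where "c = ennreal e" "e > 0"
    by (cases c) auto
  with assms[of e] c show "eventually (\<lambda>n. a n < b) F"
    by (auto elim!: eventually_mono)
qed auto

text \<open>On a set of finite measure, convergence to 0 in L^p gives it in L^1: where
  \<open>d n x\<close> is below a small constant its integral is small, and elsewhere it is at most
  a constant multiple of its p-th power.\<close>

lemma nn_integral_powr_tendsto_0: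
  fixes d :: "nat \<Rightarrow> 'a \<Rightarrow> real"
  assumes [measurable]: "\<And>n. d n \<in> borel_measurable M" "A \<in> sets M"
    and nn: "\<And>n x. d n x \<ge> 0" and p: "p \<ge> 1" and A: "emeasure M A < \<infinity>"
    and lim: "(\<lambda>n. \<integral>\<^sup>+x\<in>A. ennreal (d n x powr p) \<partial>M) \<longlonglongrightarrow> 0"
  shows "(\<lambda>n. \<integral>\<^sup>+x\<in>A. ennreal (d n x) \<partial>M) \<longlonglongrightarrow> 0"
proof (rule tendsto_0_ennrealI)
  fix e :: real assume e: "e > 0"
  define m where "m = measure M A"
  have m: "emeasure M A = ennreal m" "m \<ge> 0"
    using A by (auto simp: m_def emeasure_eq_ennreal_measure less_top)
  \<comment> \<open>Values up to \<open>\<delta>\<close> contribute at most \<open>e / 2\<close>;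
    the summand 1 allows for \<open>m = 0\<close>.\<close>
  define \<delta> where "\<delta> = e / (2 * (m + 1))"
  have \<delta>: "\<delta> > 0" "\<delta> * m \<le> e / 2"
    using e m by (auto simp: \<delta>_def field_simps)
  let ?c = "\<delta> powr (1 - p)"
  have c: "?c > 0" using \<delta> by simp
  \<comment> \<open>This avoids the Hoelder inequality.\<close>
  have pt: "d n x \<le> \<delta> + ?c * d n x powr p" for n x
  proof (cases "d n x \<le> \<delta>")
    case True
    then show ?thesis using c by (simp add: add_increasing2)
  next
    case False
    then have "d n x = d n x powr (1 - p) * d n x powr p"
      using \<delta> by (simp flip: powr_add)
    also have "\<dots> \<le> ?c * d n x powr p"
      using False \<delta> p by (intro mult_right_mono powr_mono2') auto
    finally show ?thesis using \<delta> by simp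
  qed
  have "eventually (\<lambda>n. (\<integral>\<^sup>+x\<in>A. ennreal (d n x powr p) \<partial>M) < ennreal (e / (2 * ?c))) sequentially"
    using e c by (intro order_tendstoD(2)[OF lim]) auto
  then show "eventually (\<lambda>n. (\<integral>\<^sup>+x\<in>A. ennreal (d n x) \<partial>M) \<le> ennreal e) sequentially"
  proof eventually_elim
    case (elim n)
    have "(\<integral>\<^sup>+x\<in>A. ennreal (d n x) \<partial>M)
        \<le> (\<integral>\<^sup>+x. ennreal \<delta> * indicator A x + ennreal ?c * (ennreal (d n x powr p) * indicator A x) \<partial>M)"
      using pt[of n] c \<delta>
      by (intro nn_integral_mono) (auto simp: indicator_def simp flip: ennreal_mult ennreal_plus)
    also have "\<dots> = ennreal \<delta> * ennreal m + ennreal ?c * (\<integral>\<^sup>+x\<in>A. ennreal (d n x powr p) \<partial>M)"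
      using m by (simp add: nn_integral_add nn_integral_cmult)
    also have "\<dots> \<le> ennreal (e / 2) + ennreal ?c * ennreal (e / (2 * ?c))"
      using \<delta> m elim by (intro add_mono mult_left_mono) (auto intro!: ennreal_leI simp flip: ennreal_mult)
    also have "\<dots> = ennreal e"
      using e c by (simp flip: ennreal_mult ennreal_plus)
    finally show ?case .
  qed
qed

locale coupling =
  G: fundamental_domain G M \<phi> F\<^sub>G + H: fundamental_domain H M \<psi> F\<^sub>H
  for G (structure) and H (structure) and M :: "'x measure"
    and \<phi> :: "'g \<Rightarrow> 'x \<Rightarrow> 'x" and \<psi> :: "'h \<Rightarrow> 'x \<Rightarrow> 'x" and F\<^sub>G F\<^sub>H +
  assumes commute: "\<lbrakk>g \<in> carrier G; h \<in> carrier H; x \<in> space M\<rbrakk> \<Longrightarrow> \<phi> g (\<psi> h x) = \<psi> h (\<phi> g x)"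
begin

text \<open>For \<open>x\<close> in \<open>F\<^sub>G\<close> the label of
  \<open>\<psi> h (\<phi> \<gamma> x)\<close> is \<open>\<gamma>\<close> times
  \<open>G.label (\<psi> h x)\<close>, so after unfolding over \<open>F\<^sub>G\<close> the sum over
  \<open>\<gamma>\<close> is the sum of p-th powers of a right difference of \<open>f\<close>. The
  bound of such sums by word lengths reduces the claim to the integrability of the cocycle.\<close>

lemma nn_integral_gradient:
  fixes f :: "'g \<Rightarrow> real"
  assumes p: "p \<ge> 1" and S: "finite_generating_set G S"
    and grad: "\<And>s. s \<in> carrier G \<Longrightarrow>
      (\<integral>\<^sup>+\<gamma>. ennreal (\<bar>f (\<gamma> \<otimes>\<^bsub>G\<^esub> s) - f \<gamma>\<bar> powr p) \<partial>count_space (carrier G)) < \<infinity>"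
    and h: "h \<in> carrier H"
    and int: "(\<integral>\<^sup>+y\<in>F\<^sub>G. ennreal (real (word_length G S (me_cocycle G \<psi> \<phi> F\<^sub>G h y)) powr p) \<partial>M) < \<infinity>"
  shows "(\<integral>\<^sup>+x. ennreal (\<bar>f (G.label (\<psi> h x)) - f (G.label x)\<bar> powr p) \<partial>M) < \<infinity>"
proof -
  note [measurable] = H.measurable_act[OF h]
  let ?C = "count_space (carrier G)"
  have S': "finite S" "S \<subseteq> carrier G" "generate G S = carrier G"
    using S by (auto simp: finite_generating_set_def)
  let ?T = "S \<union> m_inv G ` S"
  have T: "finite ?T" "?T \<subseteq> carrier G" using S' by auto
  let ?I = "\<lambda>s. \<integral>\<^sup>+\<gamma>. ennreal (\<bar>f (\<gamma> \<otimes>\<^bsub>G\<^esub> s) - f \<gamma>\<bar> powr p) \<partial>?C"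
  define K where "K = (\<Sum>s\<in>?T. enn2real (?I s))"
  have "K \<ge> 0" unfolding K_def by (intro sum_nonneg) simp
  have K: "?I s \<le> ennreal K" if "s \<in> ?T" for s
  proof -
    have "?I s = ennreal (enn2real (?I s))"
      using grad[of s] that T by (auto simp: ennreal_enn2real_if)
    also have "\<dots> \<le> ennreal K"
      unfolding K_def using that T by (intro ennreal_leI member_le_sum) auto
    finally show ?thesis .
  qed
  \<comment> \<open>The word length is that of the inverse because the cocycle is the inverse of a
    label; a right translation of the summation variable exchanges \<open>x\<close> with its
    inverse.\<close>
  have bound: "?I x \<le> ennreal (K * real (word_length G S (inv\<^bsub>G\<^esub> x)) powr p)" if x: "x \<in> carrier G" for x
  proof -
    have "inv\<^bsub>G\<^esub> x \<in> generate G S" using x S' by simp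
    then obtain w where w: "length w = word_length G S (inv\<^bsub>G\<^esub> x)" "set w \<subseteq> ?T"
      "foldr (\<otimes>\<^bsub>G\<^esub>) w \<one>\<^bsub>G\<^esub> = inv\<^bsub>G\<^esub> x"
      using G.word_length_attained[OF S'(2)] by blast
    have "?I x = (\<integral>\<^sup>+\<gamma>. ennreal (\<bar>f ((\<gamma> \<otimes>\<^bsub>G\<^esub> x) \<otimes>\<^bsub>G\<^esub> inv\<^bsub>G\<^esub> x) - f (\<gamma> \<otimes>\<^bsub>G\<^esub> x)\<bar> powr p) \<partial>?C)"
      using x by (intro nn_integral_cong) (auto simp: G.m_assoc abs_minus_commute)
    also have "\<dots> = ?I (inv\<^bsub>G\<^esub> x)"
      by (rule G.nn_integral_count_space_mult_right[OF x])
    also have "\<dots> \<le> ennreal (K * real (length w) powr p)"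
      using G.nn_integral_right_translate_le[OF p T(2) w(2) K \<open>K \<ge> 0\<close>] w(3) by simp
    finally show ?thesis using w(1) by simp
  qed
  have "(\<integral>\<^sup>+x. ennreal (\<bar>f (G.label (\<psi> h x)) - f (G.label x)\<bar> powr p) \<partial>M)
      = (\<integral>\<^sup>+\<gamma>. (\<integral>\<^sup>+x\<in>F\<^sub>G. ennreal (\<bar>f (G.label (\<psi> h (\<phi> \<gamma> x))) - f (G.label (\<phi> \<gamma> x))\<bar> powr p) \<partial>M) \<partial>?C)"
    by (intro G.nn_integral_unfold) measurable
  also have "\<dots> = (\<integral>\<^sup>+x. (\<integral>\<^sup>+\<gamma>. ennreal (\<bar>f (G.label (\<psi> h (\<phi> \<gamma> x))) - f (G.label (\<phi> \<gamma> x))\<bar> powr p)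
      * indicator F\<^sub>G x \<partial>?C) \<partial>M)"
    using G.countable by (intro nn_integral_count_space_nn_integral[symmetric]) auto
  also have "\<dots> \<le> (\<integral>\<^sup>+x. ennreal K * (ennreal (real (word_length G S (me_cocycle G \<psi> \<phi> F\<^sub>G h x)) powr p)
      * indicator F\<^sub>G x) \<partial>M)"
  proof (rule nn_integral_mono)
    fix x assume x: "x \<in> space M"
    let ?l = "G.label (\<psi> h x)"
    have l: "?l \<in> carrier G"
      using h x by (intro G.label_closed H.act_closed)
    have c: "me_cocycle G \<psi> \<phi> F\<^sub>G h x = inv\<^bsub>G\<^esub> ?l"
      unfolding me_cocycle_def using h x by (intro G.cocycle_eq_inv_label H.act_closed)
    show "(\<integral>\<^sup>+\<gamma>. ennreal (\<bar>f (G.label (\<psi> h (\<phi> \<gamma> x))) - f (G.label (\<phi> \<gamma> x))\<bar> powr p)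
        * indicator F\<^sub>G x \<partial>?C)
      \<le> ennreal K * (ennreal (real (word_length G S (me_cocycle G \<psi> \<phi> F\<^sub>G h x)) powr p) * indicator F\<^sub>G x)"
    proof (cases "x \<in> F\<^sub>G")
      case True
      have "(\<integral>\<^sup>+\<gamma>. ennreal (\<bar>f (G.label (\<psi> h (\<phi> \<gamma> x))) - f (G.label (\<phi> \<gamma> x))\<bar> powr p)
        * indicator F\<^sub>G x \<partial>?C) = ?I ?l"
      proof (rule nn_integral_cong)
        fix \<gamma> assume "\<gamma> \<in> space ?C"
        then have \<gamma>: "\<gamma> \<in> carrier G" by simp
        have "G.label (\<psi> h (\<phi> \<gamma> x)) = \<gamma> \<otimes>\<^bsub>G\<^esub> ?l" "G.label (\<phi> \<gamma> x) = \<gamma>"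
          using \<gamma> h x True commute[OF \<gamma> h x, symmetric]
          by (auto simp: G.label_act H.act_closed G.label_domain)
        then show "ennreal (\<bar>f (G.label (\<psi> h (\<phi> \<gamma> x))) - f (G.label (\<phi> \<gamma> x))\<bar> powr p) * indicator F\<^sub>G x
          = ennreal (\<bar>f (\<gamma> \<otimes>\<^bsub>G\<^esub> ?l) - f \<gamma>\<bar> powr p)"
          using True by simp
      qed
      also have "\<dots> \<le> ennreal (K * real (word_length G S (inv\<^bsub>G\<^esub> ?l)) powr p)"
        by (rule bound[OF l])
      finally show ?thesis
        using True c \<open>K \<ge> 0\<close> by (simp add: ennreal_mult)
    qed simp
  qed
  also have "\<dots> = ennreal K * (\<integral>\<^sup>+y\<in>F\<^sub>G. ennreal (real (word_length G S (me_cocycle G \<psi> \<phi> F\<^sub>G h y)) powr p) \<partial>M)"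
  proof (rule nn_integral_cmult)
    have "(\<lambda>x. ennreal (real (word_length G S (inv\<^bsub>G\<^esub> G.label (\<psi> h x))) powr p) * indicator F\<^sub>G x)
        \<in> borel_measurable M"
      using G.measurable_compose_label[OF H.measurable_act[OF h],
          of "\<lambda>g. ennreal (real (word_length G S (inv\<^bsub>G\<^esub> g)) powr p)"]
      by measurable
    then show "(\<lambda>x. ennreal (real (word_length G S (me_cocycle G \<psi> \<phi> F\<^sub>G h x)) powr p) * indicator F\<^sub>G x)
        \<in> borel_measurable M"
    proof (rule measurable_cong[THEN iffD1, rotated])
      fix x assume x: "x \<in> space M"
      have "me_cocycle G \<psi> \<phi> F\<^sub>G h x = inv\<^bsub>G\<^esub> G.label (\<psi> h x)"
        unfolding me_cocycle_def using h x by (intro G.cocycle_eq_inv_label H.act_closed)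
      then show "ennreal (real (word_length G S (inv\<^bsub>G\<^esub> G.label (\<psi> h x))) powr p) * indicator F\<^sub>G x
        = ennreal (real (word_length G S (me_cocycle G \<psi> \<phi> F\<^sub>G h x)) powr p) * indicator F\<^sub>G x"
        by simp
    qed
  qed
  also have "\<dots> < \<infinity>"
    using int by (simp add: ennreal_mult_less_top)
  finally show ?thesis .
qed

end

section \<open>Asymptotic invariance along a central sequence\<close>

context coupling begin

text \<open>Below, \<open>k n\<close> is the \<open>H\<close>-invariant function that agrees with \<open>u n\<close> on \<open>F\<^sub>H\<close>, so its integrals
  over \<open>F\<^sub>H\<close> and over the translate of \<open>F\<^sub>H\<close> by \<open>g\<close> agree. As \<open>\<zeta> n\<close> is central, \<open>u n - k n\<close> is
  given by \<open>p\<close>-integrable coboundaries evaluated far away.\<close>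

lemma asymptotic_invariance:
  fixes f :: "'g \<Rightarrow> real" and \<zeta> :: "nat \<Rightarrow> 'h"
  assumes p: "p \<ge> 1" and f: "\<And>\<gamma>. 0 \<le> f \<gamma>" "\<And>\<gamma>. f \<gamma> \<le> B"
    and grad: "\<And>h. h \<in> carrier H \<Longrightarrow>
      (\<integral>\<^sup>+x. ennreal (\<bar>f (G.label (\<psi> h x)) - f (G.label x)\<bar> powr p) \<partial>M) < \<infinity>"
    and \<zeta>: "inj \<zeta>" "range \<zeta> \<subseteq> carrier H"
    and central: "\<And>n h. h \<in> carrier H \<Longrightarrow> \<zeta> n \<otimes>\<^bsub>H\<^esub> h = h \<otimes>\<^bsub>H\<^esub> \<zeta> n"
    and g: "g \<in> carrier G"
  obtains e where "e \<longlonglongrightarrow> (0::ennreal)"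
    "\<And>n. (\<integral>\<^sup>+x\<in>F\<^sub>H. ennreal (f (G.label (\<psi> (\<zeta> n) x))) \<partial>M)
      \<le> (\<integral>\<^sup>+x\<in>F\<^sub>H. ennreal (f (g \<otimes>\<^bsub>G\<^esub> G.label (\<psi> (\<zeta> n) x))) \<partial>M) + e n"
proof -
  have \<zeta>H [simp]: "\<zeta> n \<in> carrier H" for n using \<zeta>(2) by auto
  let ?g' = "inv\<^bsub>G\<^esub> g"
  have g': "?g' \<in> carrier G" using g by simp
  note [measurable] = G.measurable_act[OF g] G.measurable_act[OF g'] H.measurable_act[OF \<zeta>H]
  let ?C = "count_space (carrier H)"
  \<comment> \<open>\<open>\<pi>\<close> moves each point along its \<open>H\<close>-orbit into
    \<open>F\<^sub>H\<close>; it is \<open>H\<close>-invariant and the identity on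
    \<open>F\<^sub>H\<close>.\<close>
  define \<pi> where "\<pi> = (\<lambda>x. \<psi> (inv\<^bsub>H\<^esub> H.label x) x)"
  have \<pi>_meas [measurable]: "\<pi> \<in> M \<rightarrow>\<^sub>M M"
    unfolding \<pi>_def
    by (rule measurable_compose_countable'[OF _ H.measurable_label H.countable]) auto
  have \<pi>_closed: "\<pi> x \<in> space M" if "x \<in> space M" for x
    using measurable_space[OF \<pi>_meas that] .
  have \<pi>_inv: "\<pi> (\<psi> h x) = \<pi> x" if h: "h \<in> carrier H" and x: "x \<in> space M" for h x
  proof -
    have l: "H.label x \<in> carrier H" using H.label_closed x by simp
    have "\<pi> (\<psi> h x) = \<psi> (inv\<^bsub>H\<^esub> (h \<otimes>\<^bsub>H\<^esub> H.label x)) (\<psi> h x)"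
      unfolding \<pi>_def using H.label_act[OF h x] by simp
    also have "\<dots> = \<psi> (inv\<^bsub>H\<^esub> H.label x \<otimes>\<^bsub>H\<^esub> inv\<^bsub>H\<^esub> h \<otimes>\<^bsub>H\<^esub> h) x"
      using h x l by (simp add: H.inv_mult_group H.composition_rule H.act_closed)
    also have "\<dots> = \<pi> x"
      using h x l by (simp add: \<pi>_def H.m_assoc)
    finally show ?thesis .
  qed
  have \<pi>_domain: "\<pi> x = x" if "x \<in> F\<^sub>H" for x
    using that H.domain_subset H.label_domain[OF that] H.act_one by (auto simp: \<pi>_def)
  define u where "u = (\<lambda>n x. f (G.label (\<psi> (\<zeta> n) x)))"
  define k where "k = (\<lambda>n x. u n (\<pi> x))"
  have [measurable]: "u n \<in> borel_measurable M" "k n \<in> borel_measurable M" for n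
    unfolding u_def k_def by measurable
  define r where "r = (\<lambda>n x. \<bar>u n x - k n x\<bar>)"
  have [measurable]: "r n \<in> borel_measurable M" for n
    unfolding r_def by measurable
  have rB: "r n x \<le> B" for n x
    unfolding r_def u_def k_def using f(1)[of "G.label (\<psi> (\<zeta> n) x)"] f(2)[of "G.label (\<psi> (\<zeta> n) x)"]
      f(1)[of "G.label (\<psi> (\<zeta> n) (\<pi> x))"] f(2)[of "G.label (\<psi> (\<zeta> n) (\<pi> x))"] by linarith
  define e where "e = (\<lambda>n. \<integral>\<^sup>+x\<in>F\<^sub>H. ennreal (r n (\<phi> g x)) \<partial>M)"
  have le: "(\<integral>\<^sup>+x\<in>F\<^sub>H. ennreal (f (G.label (\<psi> (\<zeta> n) x))) \<partial>M)
      \<le> (\<integral>\<^sup>+x\<in>F\<^sub>H. ennreal (f (g \<otimes>\<^bsub>G\<^esub> G.label (\<psi> (\<zeta> n) x))) \<partial>M) + e n" for n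
  proof -
    have "(\<integral>\<^sup>+x\<in>F\<^sub>H. ennreal (f (G.label (\<psi> (\<zeta> n) x))) \<partial>M) = (\<integral>\<^sup>+x\<in>F\<^sub>H. ennreal (k n x) \<partial>M)"
      by (intro nn_integral_cong) (auto simp: k_def u_def \<pi>_domain indicator_def)
    \<comment> \<open>\<open>k n\<close> is \<open>H\<close>-invariant and \<open>\<phi> g\<close>
      commutes with \<open>H\<close>, so mass transport for \<open>H\<close> applies.\<close>
    also have "\<dots> = (\<integral>\<^sup>+x\<in>F\<^sub>H. ennreal (k n (\<phi> g x)) \<partial>M)"
      by (rule H.nn_integral_invariant[where t' = "\<phi> ?g'", symmetric])
        (use g g' in \<open>auto simp: G.nn_integral_act G.act_inv commute k_def \<pi>_inv\<close>)
    also have "\<dots> \<le> (\<integral>\<^sup>+x. ennreal (u n (\<phi> g x)) * indicator F\<^sub>H x + ennreal (r n (\<phi> g x)) * indicator F\<^sub>H x \<partial>M)"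
    proof (rule nn_integral_mono)
      fix x
      have "k n (\<phi> g x) \<le> u n (\<phi> g x) + r n (\<phi> g x)" unfolding r_def by linarith
      moreover have "u n (\<phi> g x) \<ge> 0" "r n (\<phi> g x) \<ge> 0" by (auto simp: u_def r_def f)
      ultimately show "ennreal (k n (\<phi> g x)) * indicator F\<^sub>H x
          \<le> ennreal (u n (\<phi> g x)) * indicator F\<^sub>H x + ennreal (r n (\<phi> g x)) * indicator F\<^sub>H x"
        by (auto simp: indicator_def intro!: ennreal_leI simp flip: ennreal_plus)
    qed
    also have "\<dots> = (\<integral>\<^sup>+x\<in>F\<^sub>H. ennreal (u n (\<phi> g x)) \<partial>M) + e n"
      unfolding e_def by (intro nn_integral_add) measurable
    also have "(\<integral>\<^sup>+x\<in>F\<^sub>H. ennreal (u n (\<phi> g x)) \<partial>M)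
        = (\<integral>\<^sup>+x\<in>F\<^sub>H. ennreal (f (g \<otimes>\<^bsub>G\<^esub> G.label (\<psi> (\<zeta> n) x))) \<partial>M)"
      by (intro nn_integral_cong)
        (use g in \<open>simp add: u_def commute[symmetric] G.label_act H.act_closed\<close>)
    finally show ?thesis .
  qed
  \<comment> \<open>\<open>t n h\<close> is the part of the error from the points with
    \<open>H\<close>-label \<open>h\<close> in the translate of \<open>F\<^sub>H\<close> by
    \<open>g\<close>. On this part \<open>\<pi>\<close> is the single transformation
    \<open>\<psi> (inv h)\<close>.\<close>
  define t where "t = (\<lambda>n h. \<integral>\<^sup>+x. ennreal (r n x) * indicator F\<^sub>H (\<phi> ?g' x) * indicator {x. H.label x = h} x \<partial>M)"
  have e_t: "e n = (\<integral>\<^sup>+h. t n h \<partial>?C)" for n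
  proof -
    have "e n = (\<integral>\<^sup>+x. ennreal (r n (\<phi> g x)) * indicator F\<^sub>H (\<phi> ?g' (\<phi> g x)) \<partial>M)"
      unfolding e_def by (intro nn_integral_cong) (use g in \<open>simp add: G.act_inv\<close>)
    also have "\<dots> = (\<integral>\<^sup>+x. ennreal (r n x) * indicator F\<^sub>H (\<phi> ?g' x) \<partial>M)"
      using g by (intro G.nn_integral_act) measurable
    also have "\<dots> = (\<integral>\<^sup>+h. t n h \<partial>?C)"
      unfolding t_def by (intro H.nn_integral_split_label) measurable
    finally show ?thesis .
  qed
  \<comment> \<open>The error is at most \<open>B\<close> pointwise, so the masses of the parts give
    a summable majorant for dominated convergence over \<open>h\<close>.\<close>
  define m where "m = (\<lambda>h. \<integral>\<^sup>+x. ennreal B * indicator F\<^sub>H (\<phi> ?g' x) * indicator {x. H.label x = h} x \<partial>M)"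
  have m_int: "(\<integral>\<^sup>+h. m h \<partial>?C) < \<infinity>"
  proof -
    have "(\<integral>\<^sup>+h. m h \<partial>?C) = (\<integral>\<^sup>+x. ennreal B * indicator F\<^sub>H (\<phi> ?g' x) \<partial>M)"
      unfolding m_def by (intro H.nn_integral_split_label[symmetric]) measurable
    also have "\<dots> = (\<integral>\<^sup>+x. ennreal B * indicator F\<^sub>H x \<partial>M)"
      using g' by (intro G.nn_integral_act) measurable
    also have "\<dots> < \<infinity>"
      using H.domain_finite by (simp add: nn_integral_cmult_indicator ennreal_mult_less_top)
    finally show ?thesis .
  qed
  have t_m: "t n h \<le> m h" for n h
    unfolding t_def m_def by (intro nn_integral_mono mult_right_mono ennreal_leI rB) auto
  have t_lim: "(\<lambda>n. t n h) \<longlonglongrightarrow> 0" if h: "h \<in> carrier H" for h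
  proof -
    let ?h' = "inv\<^bsub>H\<^esub> h"
    have h': "?h' \<in> carrier H" using h by simp
    define d where "d = (\<lambda>x. \<bar>f (G.label (\<psi> ?h' x)) - f (G.label x)\<bar>)"
    have d_meas [measurable]: "d \<in> borel_measurable M"
      unfolding d_def using H.measurable_act[OF h'] by measurable
    have "(\<lambda>n. \<integral>\<^sup>+x\<in>F\<^sub>H. ennreal (d (\<phi> g (\<psi> (\<zeta> n) x)) powr p) \<partial>M) \<longlonglongrightarrow> 0"
    proof (rule H.nn_integral_translates_tendsto_0[OF \<zeta>, of "\<lambda>x. ennreal (d (\<phi> g x) powr p)"])
      have "(\<integral>\<^sup>+x. ennreal (d (\<phi> g x) powr p) \<partial>M) = (\<integral>\<^sup>+x. ennreal (d x powr p) \<partial>M)"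
        using g by (intro G.nn_integral_act) measurable
      also have "\<dots> < \<infinity>" unfolding d_def by (rule grad[OF h'])
      finally show "(\<integral>\<^sup>+x. ennreal (d (\<phi> g x) powr p) \<partial>M) < \<infinity>" .
    qed measurable
    then have lim: "(\<lambda>n. \<integral>\<^sup>+x\<in>F\<^sub>H. ennreal (d (\<phi> g (\<psi> (\<zeta> n) x))) \<partial>M) \<longlonglongrightarrow> 0"
    proof (rule nn_integral_powr_tendsto_0[OF _ H.domain_measurable _ p H.domain_finite,
          of "\<lambda>n x. d (\<phi> g (\<psi> (\<zeta> n) x))", rotated 2])
      show "(\<lambda>x. d (\<phi> g (\<psi> (\<zeta> n) x))) \<in> borel_measurable M" for n by measurable
      show "0 \<le> d (\<phi> g (\<psi> (\<zeta> n) x))" for n x by (simp add: d_def)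
    qed
    have "t n h \<le> (\<integral>\<^sup>+x\<in>F\<^sub>H. ennreal (d (\<phi> g (\<psi> (\<zeta> n) x))) \<partial>M)" for n
    proof -
      have "t n h \<le> (\<integral>\<^sup>+x. ennreal (d (\<psi> (\<zeta> n) x)) * indicator F\<^sub>H (\<phi> ?g' x) \<partial>M)"
        unfolding t_def
      proof (rule nn_integral_mono)
        fix x assume x: "x \<in> space M"
        have "r n x = d (\<psi> (\<zeta> n) x)" if "H.label x = h"
        proof -
          \<comment> \<open>Centrality enters here: \<open>\<psi> ?h'\<close> moves past
            \<open>\<psi> (\<zeta> n)\<close>, and the error becomes the coboundary of
            \<open>f\<close> for \<open>?h'\<close> at the far point
            \<open>\<psi> (\<zeta> n) x\<close>.\<close>
          have "\<psi> (\<zeta> n) (\<pi> x) = \<psi> ?h' (\<psi> (\<zeta> n) x)"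
            unfolding \<pi>_def that using h' x central[OF h', of n]
            by (simp flip: H.composition_rule)
          then show ?thesis by (simp add: r_def u_def k_def d_def abs_minus_commute)
        qed
        then show "ennreal (r n x) * indicator F\<^sub>H (\<phi> ?g' x) * indicator {x. H.label x = h} x
          \<le> ennreal (d (\<psi> (\<zeta> n) x)) * indicator F\<^sub>H (\<phi> ?g' x)"
          by (auto simp: indicator_def)
      qed
      also have "\<dots> = (\<integral>\<^sup>+x. ennreal (d (\<psi> (\<zeta> n) (\<phi> g x))) * indicator F\<^sub>H (\<phi> ?g' (\<phi> g x)) \<partial>M)"
        using g by (intro G.nn_integral_act[symmetric]) measurable
      also have "\<dots> = (\<integral>\<^sup>+x\<in>F\<^sub>H. ennreal (d (\<phi> g (\<psi> (\<zeta> n) x))) \<partial>M)"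
        by (intro nn_integral_cong) (use g in \<open>simp add: G.act_inv commute\<close>)
      finally show ?thesis .
    qed
    then show ?thesis
      by (intro tendsto_sandwich[OF _ _ tendsto_const lim]) auto
  qed
  have "(\<lambda>n. \<integral>\<^sup>+h. t n h \<partial>?C) \<longlonglongrightarrow> (\<integral>\<^sup>+h. 0 \<partial>?C)"
    by (rule nn_integral_dominated_convergence[where w = m])
      (use m_int t_m t_lim in \<open>auto simp: AE_count_space\<close>)
  then have "e \<longlonglongrightarrow> 0" by (simp flip: e_t)
  then show thesis using le that by blast
qed

text \<open>Integrate the contraction inequality over \<open>F\<^sub>H\<close> at the labels of
  \<open>\<psi> (\<zeta> n) x\<close>. The constant 1 contributes the measure of
  \<open>F\<^sub>H\<close>, which is thus bounded by the errors of asymptotic invariance. So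
  \<open>F\<^sub>H\<close> is null, and with it the union of its countably many translates.\<close>

theorem no_strictly_contracted_family:
  fixes f :: "'g \<Rightarrow> 'g \<Rightarrow> real" and \<zeta> :: "nat \<Rightarrow> 'h"
  assumes p: "p \<ge> 1" and S: "finite_generating_set G S"
    and int: "\<And>h. h \<in> carrier H \<Longrightarrow>
      (\<integral>\<^sup>+y\<in>F\<^sub>G. ennreal (real (word_length G S (me_cocycle G \<psi> \<phi> F\<^sub>G h y)) powr p) \<partial>M) < \<infinity>"
    and \<zeta>: "inj \<zeta>" "range \<zeta> \<subseteq> carrier H"
    and central: "\<And>n h. h \<in> carrier H \<Longrightarrow> \<zeta> n \<otimes>\<^bsub>H\<^esub> h = h \<otimes>\<^bsub>H\<^esub> \<zeta> n"
    and A: "finite A" "A \<subseteq> carrier G"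
    and bounded: "\<And>g \<gamma>. g \<in> A \<Longrightarrow> \<gamma> \<in> carrier G \<Longrightarrow> \<bar>f g \<gamma>\<bar> \<le> B"
    and grad: "\<And>g s. g \<in> A \<Longrightarrow> s \<in> carrier G \<Longrightarrow>
      (\<integral>\<^sup>+\<gamma>. ennreal (\<bar>f g (\<gamma> \<otimes>\<^bsub>G\<^esub> s) - f g \<gamma>\<bar> powr p) \<partial>count_space (carrier G)) < \<infinity>"
    and contr: "\<And>\<gamma>. \<gamma> \<in> carrier G \<Longrightarrow> (\<Sum>g\<in>A. f g (g \<otimes>\<^bsub>G\<^esub> \<gamma>)) + 1 \<le> (\<Sum>g\<in>A. f g \<gamma>)"
  shows "emeasure M (space M) = 0"
proof -
  \<comment> \<open>Asymptotic invariance is stated for nonnegative functions bounded on the whole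
    type. The added constant cancels in the differences and in the contraction inequality, whose two
    sums have equally many terms.\<close>
  define u where "u = (\<lambda>g \<gamma>. if \<gamma> \<in> carrier G then f g \<gamma> + \<bar>B\<bar> else 0)"
  have u: "0 \<le> u g \<gamma>" "u g \<gamma> \<le> 2 * \<bar>B\<bar>" if "g \<in> A" for g \<gamma>
    using bounded[OF that, of \<gamma>] by (auto simp: u_def abs_le_iff) 
  have ugrad: "(\<integral>\<^sup>+\<gamma>. ennreal (\<bar>u g (\<gamma> \<otimes>\<^bsub>G\<^esub> s) - u g \<gamma>\<bar> powr p) \<partial>count_space (carrier G)) < \<infinity>"
    if "g \<in> A" "s \<in> carrier G" for g s
  proof -
    have "(\<integral>\<^sup>+\<gamma>. ennreal (\<bar>u g (\<gamma> \<otimes>\<^bsub>G\<^esub> s) - u g \<gamma>\<bar> powr p) \<partial>count_space (carrier G))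
        = (\<integral>\<^sup>+\<gamma>. ennreal (\<bar>f g (\<gamma> \<otimes>\<^bsub>G\<^esub> s) - f g \<gamma>\<bar> powr p) \<partial>count_space (carrier G))"
      using that by (intro nn_integral_cong) (simp add: u_def)
    then show ?thesis using grad[OF that] by simp
  qed
  define a where "a = (\<lambda>g n. \<integral>\<^sup>+x\<in>F\<^sub>H. ennreal (u g (G.label (\<psi> (\<zeta> n) x))) \<partial>M)"
  define b where "b = (\<lambda>g n. \<integral>\<^sup>+x\<in>F\<^sub>H. ennreal (u g (g \<otimes>\<^bsub>G\<^esub> G.label (\<psi> (\<zeta> n) x))) \<partial>M)"
  have "\<exists>e. e \<longlonglongrightarrow> 0 \<and> (\<forall>n. a g n \<le> b g n + e n)" if g: "g \<in> A" for g
  proof -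
    have gG: "g \<in> carrier G" using g A by auto
    show ?thesis
      unfolding a_def b_def
      by (rule asymptotic_invariance[OF p u[OF g] nn_integral_gradient[OF p S ugrad[OF g] _ int] \<zeta> central gG])
        blast+
  qed
  then obtain e where e: "\<And>g. g \<in> A \<Longrightarrow> e g \<longlonglongrightarrow> 0"
    "\<And>g n. g \<in> A \<Longrightarrow> a g n \<le> b g n + e g n"
    by metis
  have \<zeta>H [simp]: "\<zeta> n \<in> carrier H" for n using \<zeta>(2) by auto
  note [measurable] = H.measurable_act[OF \<zeta>H]
  let ?F = "emeasure M F\<^sub>H"
  have "?F \<le> (\<Sum>g\<in>A. e g n)" for n
  proof -
    \<comment> \<open>Finiteness permits cancelling this sum from an inequality between extended
      reals.\<close>
    have fin: "(\<Sum>g\<in>A. b g n) \<noteq> \<infinity>"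
    proof -
      have "b g n \<noteq> \<infinity>" if "g \<in> A" for g
      proof -
        have "b g n \<le> (\<integral>\<^sup>+x. ennreal (2 * \<bar>B\<bar>) * indicator F\<^sub>H x \<partial>M)"
          unfolding b_def using u[OF that] by (intro nn_integral_mono mult_right_mono ennreal_leI) auto
        also have "\<dots> < \<infinity>"
          using H.domain_finite by (simp add: nn_integral_cmult_indicator ennreal_mult_less_top)
        finally show ?thesis by simp
      qed
      then show ?thesis using A(1) by simp
    qed
    have bmeas: "(\<lambda>x. ennreal (u g (g \<otimes>\<^bsub>G\<^esub> G.label (\<psi> (\<zeta> n) x))) * indicator F\<^sub>H x) \<in> borel_measurable M" for g
      using G.measurable_compose_label[OF H.measurable_act[OF \<zeta>H], of "\<lambda>l. ennreal (u g (g \<otimes>\<^bsub>G\<^esub> l))"]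
      by measurable
    have "?F + (\<Sum>g\<in>A. b g n)
        = (\<integral>\<^sup>+x. indicator F\<^sub>H x + (\<Sum>g\<in>A. ennreal (u g (g \<otimes>\<^bsub>G\<^esub> G.label (\<psi> (\<zeta> n) x))) * indicator F\<^sub>H x) \<partial>M)"
      unfolding b_def using bmeas by (simp add: nn_integral_add nn_integral_sum)
    also have "\<dots> \<le> (\<integral>\<^sup>+x. (\<Sum>g\<in>A. ennreal (u g (G.label (\<psi> (\<zeta> n) x))) * indicator F\<^sub>H x) \<partial>M)"
    proof (rule nn_integral_mono)
      fix x assume x: "x \<in> space M"
      let ?l = "G.label (\<psi> (\<zeta> n) x)"
      have l: "?l \<in> carrier G" using x by (intro G.label_closed H.act_closed) auto
      have gl: "g \<otimes>\<^bsub>G\<^esub> ?l \<in> carrier G" if "g \<in> A" for g using l A that by auto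
      have "1 + (\<Sum>g\<in>A. u g (g \<otimes>\<^bsub>G\<^esub> ?l)) \<le> (\<Sum>g\<in>A. u g ?l)"
        using contr[OF l] l gl by (simp add: u_def sum.distrib)
      then have "ennreal (1 + (\<Sum>g\<in>A. u g (g \<otimes>\<^bsub>G\<^esub> ?l))) \<le> ennreal (\<Sum>g\<in>A. u g ?l)"
        by (rule ennreal_leI)
      then have "1 + (\<Sum>g\<in>A. ennreal (u g (g \<otimes>\<^bsub>G\<^esub> ?l))) \<le> (\<Sum>g\<in>A. ennreal (u g ?l))"
        using u by (simp add: sum_nonneg)
      then show "indicator F\<^sub>H x + (\<Sum>g\<in>A. ennreal (u g (g \<otimes>\<^bsub>G\<^esub> ?l)) * indicator F\<^sub>H x)
        \<le> (\<Sum>g\<in>A. ennreal (u g ?l) * indicator F\<^sub>H x)"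
        by (cases "x \<in> F\<^sub>H") auto
    qed
    also have "\<dots> = (\<Sum>g\<in>A. a g n)"
      unfolding a_def by (rule nn_integral_sum) measurable
    also have "\<dots> \<le> (\<Sum>g\<in>A. b g n + e g n)"
      by (intro sum_mono e(2))
    also have "\<dots> = (\<Sum>g\<in>A. e g n) + (\<Sum>g\<in>A. b g n)"
      by (simp add: sum.distrib add.commute)
    finally show ?thesis using fin by (simp add: ennreal_add_left_cancel_le add.commute)
  qed
  moreover have "(\<lambda>n. \<Sum>g\<in>A. e g n) \<longlonglongrightarrow> (\<Sum>g\<in>A. 0)"
    by (intro tendsto_sum e(1))
  ultimately have "?F \<le> 0"
    by (intro LIMSEQ_le_const[of "\<lambda>n. \<Sum>g\<in>A. e g n"]) auto
  then have F0: "?F = 0" by simp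
  have "emeasure M (space M) = (\<integral>\<^sup>+x. 1 \<partial>M)" by simp
  also have "\<dots> = (\<integral>\<^sup>+h. (\<integral>\<^sup>+x\<in>F\<^sub>H. 1 \<partial>M) \<partial>count_space (carrier H))"
    by (rule H.nn_integral_unfold) simp
  also have "\<dots> = 0" using F0 by simp
  finally show ?thesis .
qed

end

section \<open>Isometry groups\<close>

lemma isometries_image: "f \<in> isometries X d \<Longrightarrow> x \<in> X \<Longrightarrow> f x \<in> X"
  using Bij_imp_funcset by (auto simp: isometries_def)

lemma subgroup_isometries: "subgroup (isometries X d) (BijGroup X)"
proof (rule subgroup.intro)
  show "isometries X d \<subseteq> carrier (BijGroup X)"
    by (auto simp: isometries_def BijGroup_def)
  show "\<one>\<^bsub>BijGroup X\<^esub> \<in> isometries X d"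
    by (simp add: isometries_def BijGroup_def id_Bij)
  fix f assume f: "f \<in> isometries X d"
  then have b: "f \<in> Bij X" by (simp add: isometries_def)
  have iv: "inv_into X f x \<in> X" "f (inv_into X f x) = x" if "x \<in> X" for x
    using b that by (auto simp: Bij_inv_into_mem Bij_def bij_betw_def f_inv_into_f)
  show "inv\<^bsub>BijGroup X\<^esub> f \<in> isometries X d"
    unfolding inv_BijGroup[OF b] isometries_def
  proof (intro CollectI conjI ballI)
    show "restrict (inv_into X f) X \<in> Bij X" by (rule restrict_inv_into_Bij[OF b])
    fix x y assume "x \<in> X" "y \<in> X"
    then have "d (f (inv_into X f x)) (f (inv_into X f y)) = d (inv_into X f x) (inv_into X f y)"
      using f iv(1) unfolding isometries_def by blast
    then show "d (restrict (inv_into X f) X x) (restrict (inv_into X f) X y) = d x y"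
      using iv \<open>x \<in> X\<close> \<open>y \<in> X\<close> by simp
  qed
  fix g assume g: "g \<in> isometries X d"
  then show "f \<otimes>\<^bsub>BijGroup X\<^esub> g \<in> isometries X d"
    using f isometries_image[OF g]
    by (auto simp: isometries_def BijGroup_def compose_Bij compose_eq)
qed

lemma group_Isom: "group (Isom X d)"
  unfolding Isom_def by (rule subgroup.subgroup_is_group[OF subgroup_isometries group_BijGroup])

lemma carrier_Isom: "carrier (Isom X d) = isometries X d"
  by (simp add: Isom_def)

lemma Isom_mult_apply:
  assumes "f \<in> isometries X d" "g \<in> isometries X d" "x \<in> X"
  shows "(f \<otimes>\<^bsub>Isom X d\<^esub> g) x = f (g x)"
  using assms by (auto simp: Isom_def isometries_def BijGroup_def compose_eq)

lemma Isom_one_apply: "x \<in> X \<Longrightarrow> \<one>\<^bsub>Isom X d\<^esub> x = x"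
  by (simp add: Isom_def BijGroup_def)

lemma Isom_inv_closed: "f \<in> isometries X d \<Longrightarrow> inv\<^bsub>Isom X d\<^esub> f \<in> isometries X d"
  using group.inv_closed[OF group_Isom] by (metis carrier_Isom)

lemma Isom_inv_apply:
  assumes "f \<in> isometries X d" "x \<in> X"
  shows "(inv\<^bsub>Isom X d\<^esub> f) (f x) = x" "f ((inv\<^bsub>Isom X d\<^esub> f) x) = x"
proof -
  interpret group "Isom X d" by (rule group_Isom)
  have f: "f \<in> carrier (Isom X d)" using assms by (simp add: carrier_Isom)
  have "(inv\<^bsub>Isom X d\<^esub> f) (f x) = (inv\<^bsub>Isom X d\<^esub> f \<otimes>\<^bsub>Isom X d\<^esub> f) x"
    using assms by (simp add: Isom_mult_apply Isom_inv_closed)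
  then show "(inv\<^bsub>Isom X d\<^esub> f) (f x) = x"
    using f assms by (simp add: Isom_one_apply)
  have "f ((inv\<^bsub>Isom X d\<^esub> f) x) = (f \<otimes>\<^bsub>Isom X d\<^esub> inv\<^bsub>Isom X d\<^esub> f) x"
    using assms by (simp add: Isom_mult_apply Isom_inv_closed)
  then show "f ((inv\<^bsub>Isom X d\<^esub> f) x) = x"
    using f assms by (simp add: Isom_one_apply)
qed

section \<open>The hyperbolic cosine of the distance\<close>

text \<open>The hyperbolic cosine of the distance, which in the hyperboloid model is up to sign the
  Lorentz product of two points. Working with it keeps most estimates algebraic.\<close>

definition ch :: "complex \<times> real \<Rightarrow> complex \<times> real \<Rightarrow> real" where
  "ch p q = 1 + (dist p q)\<^sup>2 / (2 * snd p * snd q)"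

definition orig :: "complex \<times> real" where
  "orig = (0, 1)"

lemma orig_H3 [simp]: "orig \<in> H3"
  by (simp add: orig_def H3_def)

lemma ch_commute: "ch p q = ch q p"
  by (simp add: ch_def dist_commute mult_ac)

lemma ch_self [simp]: "ch p p = 1"
  by (simp add: ch_def)

lemma ch_ge_1: "p \<in> H3 \<Longrightarrow> q \<in> H3 \<Longrightarrow> ch p q \<ge> 1"
  by (simp add: ch_def H3_def)

lemma ch_pos: "p \<in> H3 \<Longrightarrow> q \<in> H3 \<Longrightarrow> ch p q > 0"
  using ch_ge_1[of p q] by simp

lemma cosh_hyp_dist: "p \<in> H3 \<Longrightarrow> q \<in> H3 \<Longrightarrow> cosh (hyp_dist p q) = ch p q"
  using ch_ge_1[of p q] by (simp add: hyp_dist_def ch_def cosh_arcosh_real)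

lemma hyp_dist_nonneg: "hyp_dist p q \<ge> 0"
  using Metric_space.nonneg[OF Metric_space_hyp_dist] .

lemma hyp_dist_less_iff:
  assumes "p \<in> H3" "q \<in> H3" "e \<ge> 0"
  shows "hyp_dist p q < e \<longleftrightarrow> ch p q < cosh e"
  using assms cosh_real_nonneg_less_iff[OF hyp_dist_nonneg assms(3)] by (simp flip: cosh_hyp_dist)

lemma hyp_dist_eq_iff:
  assumes "p \<in> H3" "q \<in> H3" "r \<in> H3" "s \<in> H3"
  shows "hyp_dist p q = hyp_dist r s \<longleftrightarrow> ch p q = ch r s"
proof -
  have "hyp_dist p q = arcosh (ch p q)" "hyp_dist r s = arcosh (ch r s)"
    using assms by (auto simp: hyp_dist_def ch_def)
  then show ?thesis using assms by (metis cosh_hyp_dist)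
qed

text \<open>The triangle inequality in multiplicative form: \<open>cosh (a + b)\<close> is at most
  \<open>2 * cosh a * cosh b\<close>.\<close>

lemma ch_triangle:
  assumes "p \<in> H3" "q \<in> H3" "r \<in> H3"
  shows "ch p r \<le> 2 * ch p q * ch q r"
proof -
  have "ch p r = cosh (hyp_dist p r)" using assms by (simp add: cosh_hyp_dist)
  also have "\<dots> \<le> cosh (hyp_dist p q + hyp_dist q r)"
    using Metric_space.triangle[OF Metric_space_hyp_dist assms] hyp_dist_nonneg
    by (subst cosh_real_nonneg_le_iff) (auto intro: add_nonneg_nonneg)
  also have "\<dots> = cosh (hyp_dist p q) * cosh (hyp_dist q r) + sinh (hyp_dist p q) * sinh (hyp_dist q r)"
    by (rule cosh_add)
  also have "\<dots> \<le> cosh (hyp_dist p q) * cosh (hyp_dist q r) + cosh (hyp_dist p q) * cosh (hyp_dist q r)"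
    using hyp_dist_nonneg by (intro add_mono mult_mono sinh_le_cosh_real) auto
  finally show ?thesis using assms by (simp add: cosh_hyp_dist)
qed

lemma ch_formula:
  assumes "t > 0" "s > 0"
  shows "ch (z, t) (w, s) = ((norm (z - w))\<^sup>2 + t\<^sup>2 + s\<^sup>2) / (2 * t * s)"
proof -
  have "(dist (z, t) (w, s))\<^sup>2 = (norm (z - w))\<^sup>2 + (t - s)\<^sup>2"
    by (simp add: dist_prod_def dist_norm)
  then show ?thesis
    using assms by (simp add: ch_def field_simps power2_eq_square)
qed

lemma isometry_ch:
  assumes "f \<in> isometries H3 hyp_dist" "p \<in> H3" "q \<in> H3"
  shows "ch (f p) (f q) = ch p q"
  using assms isometries_image[OF assms(1)] by (simp add: isometries_def flip: cosh_hyp_dist)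

section \<open>Similarities of the half-space and hyperbolic balls\<close>

definition sim :: "complex \<Rightarrow> real \<Rightarrow> complex \<times> real \<Rightarrow> complex \<times> real" where
  "sim w s p = (w + s *\<^sub>R fst p, s * snd p)"

lemma sim_H3: "s > 0 \<Longrightarrow> p \<in> H3 \<Longrightarrow> sim w s p \<in> H3"
  by (simp add: sim_def H3_def)

text \<open>In \<open>ch_formula\<close> the translation cancels, and numerator and denominator both
  acquire the factor \<open>s\<^sup>2\<close>.\<close>

lemma ch_sim:
  assumes "s > 0" "p \<in> H3" "q \<in> H3"
  shows "ch (sim w s p) (sim w s q) = ch p q"
proof -
  obtain z t y r where [simp]: "p = (z, t)" "q = (y, r)" by (cases p; cases q)
  have pos: "t > 0" "r > 0" using assms by (auto simp: H3_def)
  have "norm (s *\<^sub>R z - s *\<^sub>R y) = s * norm (z - y)"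
    using assms(1) by (simp flip: scaleR_diff_right)
  then show ?thesis
    using assms(1) pos by (simp add: sim_def ch_formula power_mult_distrib field_simps power2_eq_square)
qed

lemma sim_orig: "sim w s orig = (w, s)"
  by (simp add: sim_def orig_def)

lemma sim_inverse: "s > 0 \<Longrightarrow> sim (- (w /\<^sub>R s)) (1 / s) (sim w s p) = p"
  "s > 0 \<Longrightarrow> sim w s (sim (- (w /\<^sub>R s)) (1 / s) p) = p"
  by (simp_all add: sim_def field_simps prod_eq_iff scaleR_add_right scaleR_diff_right)

lemma sim_isometry:
  assumes s: "s > 0"
  shows "restrict (sim w s) H3 \<in> isometries H3 hyp_dist"
proof -
  have "bij_betw (restrict (sim w s) H3) H3 H3"
    by (rule bij_betw_byWitness[where f' = "sim (- (w /\<^sub>R s)) (1 / s)"])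
      (use s in \<open>auto simp: sim_inverse intro!: sim_H3\<close>)
  then have "restrict (sim w s) H3 \<in> Bij H3" by (simp add: Bij_def)
  moreover have "hyp_dist (sim w s p) (sim w s q) = hyp_dist p q" if "p \<in> H3" "q \<in> H3" for p q
    using s that by (simp add: hyp_dist_eq_iff sim_H3 ch_sim)
  ultimately show ?thesis by (simp add: isometries_def)
qed

lemma exists_isometry_to:
  assumes "p \<in> H3"
  obtains f where "f \<in> isometries H3 hyp_dist" "f orig = p"
proof
  show "restrict (sim (fst p) (snd p)) H3 \<in> isometries H3 hyp_dist"
    using assms by (intro sim_isometry) (simp add: H3_def)
  show "restrict (sim (fst p) (snd p)) H3 orig = p" by (simp add: sim_orig)
qed

lemma ch_orig: "t > 0 \<Longrightarrow> ch orig (z, t) = ((norm z)\<^sup>2 + t\<^sup>2 + 1) / (2 * t)"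
  by (simp add: orig_def ch_formula add_ac)

lemma ch_orig_bounds:
  assumes "(z, t) \<in> H3" "ch orig (z, t) \<le> \<tau>"
  shows "(norm z)\<^sup>2 \<le> 2 * t * \<tau>" "t \<le> 2 * \<tau>" "1 \<le> 2 * t * \<tau>"
proof -
  have t: "t > 0" using assms by (simp add: H3_def)
  have *: "(norm z)\<^sup>2 + t\<^sup>2 + 1 \<le> 2 * t * \<tau>"
    using assms t by (simp add: ch_orig field_simps)
  then show "(norm z)\<^sup>2 \<le> 2 * t * \<tau>" "1 \<le> 2 * t * \<tau>"
    using zero_le_power2[of t] zero_le_power2[of "norm z"] by linarith+
  have "t\<^sup>2 \<le> 2 * t * \<tau>"
    using * zero_le_power2[of "norm z"] by linarith
  then have "t * t \<le> t * (2 * \<tau>)" by (simp add: power2_eq_square mult_ac)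
  then show "t \<le> 2 * \<tau>" using t by simp
qed

text \<open>A hyperbolic ball is bounded, hence totally bounded, in the Euclidean metric
  \<open>dist\<close>; \<open>ch_le_of_dist\<close> leads back to the hyperbolic one.\<close>

lemma finite_cover_ball:
  assumes "e > 0"
  shows "\<exists>N. finite N \<and> (\<forall>p\<in>H3. ch orig p \<le> D \<longrightarrow> (\<exists>k\<in>N. dist k p < e))"
proof -
  let ?S = "{p \<in> H3. ch orig p \<le> D}"
  have "norm p \<le> sqrt (4 * \<bar>D\<bar> * \<bar>D\<bar>) + 2 * \<bar>D\<bar>" if "p \<in> ?S" for p
  proof (cases p)
    case (Pair z t)
    have b: "(norm z)\<^sup>2 \<le> 2 * t * D" "t \<le> 2 * D" "t > 0"
      using ch_orig_bounds[of z t D] that Pair by (auto simp: H3_def)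
    then have "D > 0" by linarith
    have "(norm z)\<^sup>2 \<le> 4 * \<bar>D\<bar> * \<bar>D\<bar>"
    proof -
      have "t * D \<le> 2 * D * D"
        using b \<open>D > 0\<close> by (intro mult_right_mono) auto
      then have "(norm z)\<^sup>2 \<le> 4 * D * D" using b(1) by linarith
      then show ?thesis using \<open>D > 0\<close> by simp
    qed
    then have "norm z \<le> sqrt (4 * \<bar>D\<bar> * \<bar>D\<bar>)" by (rule real_le_rsqrt)
    moreover have "norm p \<le> norm z + \<bar>t\<bar>" using norm_Pair_le[of z t] Pair by simp
    ultimately show ?thesis using b \<open>D > 0\<close> by simp
  qed
  then have "bounded ?S" unfolding bounded_iff by blast
  then have "compact (closure ?S)" by (simp only: compact_closure)
  then obtain N where "finite N" "closure ?S \<subseteq> (\<Union>x\<in>N. ball x e)"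
    using assms unfolding compact_eq_totally_bounded by blast
  then have "\<exists>k\<in>N. dist k p < e" if "p \<in> ?S" for p
    using subsetD[OF \<open>closure ?S \<subseteq> _\<close> subsetD[OF closure_subset that]] by auto
  then show ?thesis using \<open>finite N\<close> by blast
qed

text \<open>In the ball the heights are at least \<open>1 / (2 * D)\<close>, so the Euclidean
  distance controls the hyperbolic one.\<close>

lemma ch_le_of_dist:
  assumes "p \<in> H3" "q \<in> H3" "ch orig p \<le> D" "ch orig q \<le> D"
  shows "ch p q \<le> 1 + 2 * D\<^sup>2 * (dist p q)\<^sup>2"
proof -
  have pq: "1 \<le> 2 * snd p * D" "1 \<le> 2 * snd q * D" "snd p > 0" "snd q > 0"
    using ch_orig_bounds(3)[of "fst p" "snd p" D] ch_orig_bounds(3)[of "fst q" "snd q" D] assms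
    by (auto simp: H3_def)
  have "1 * 1 \<le> (2 * snd p * D) * (2 * snd q * D)"
    using pq by (intro mult_mono) linarith+
  then have "1 / (2 * snd p * snd q) \<le> 2 * D\<^sup>2"
    using pq by (simp add: field_simps power2_eq_square)
  then have "(dist p q)\<^sup>2 * (1 / (2 * snd p * snd q)) \<le> (dist p q)\<^sup>2 * (2 * D\<^sup>2)"
    by (intro mult_left_mono) auto
  then show ?thesis by (simp add: ch_def mult_ac)
qed

section \<open>Cocompact lattices of hyperbolic space\<close>

locale cocompact_H3 =
  fixes \<Gamma> :: "(complex \<times> real \<Rightarrow> complex \<times> real) set"
  assumes lattice: "cocompact_lattice (Isom H3 hyp_dist) (Isom_topology H3 hyp_dist) \<Gamma>"
begin

abbreviation I where "I \<equiv> Isom H3 hyp_dist"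

abbreviation G where "G \<equiv> I\<lparr>carrier := \<Gamma>\<rparr>"

lemma subgroup_\<Gamma>: "subgroup \<Gamma> I"
  using lattice by (simp add: cocompact_lattice_def)

sublocale group G
  by (rule subgroup.subgroup_is_group[OF subgroup_\<Gamma> group_Isom])

lemma isom: "\<gamma> \<in> \<Gamma> \<Longrightarrow> \<gamma> \<in> isometries H3 hyp_dist"
  using subgroup.subset[OF subgroup_\<Gamma>] by (auto simp: carrier_Isom)

lemma closed [simp]: "\<gamma> \<in> \<Gamma> \<Longrightarrow> p \<in> H3 \<Longrightarrow> \<gamma> p \<in> H3"
  by (rule isometries_image[OF isom])

lemma mult_apply: "\<gamma> \<in> \<Gamma> \<Longrightarrow> \<delta> \<in> \<Gamma> \<Longrightarrow> p \<in> H3 \<Longrightarrow> (\<gamma> \<otimes>\<^bsub>G\<^esub> \<delta>) p = \<gamma> (\<delta> p)"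
  using Isom_mult_apply[OF isom isom] by simp

lemma inv_G: "\<gamma> \<in> \<Gamma> \<Longrightarrow> inv\<^bsub>G\<^esub> \<gamma> = inv\<^bsub>I\<^esub> \<gamma>"
  using group.m_inv_consistent[OF group_Isom subgroup_\<Gamma>] by simp

lemma inv_apply:
  "\<gamma> \<in> \<Gamma> \<Longrightarrow> p \<in> H3 \<Longrightarrow> (inv\<^bsub>G\<^esub> \<gamma>) (\<gamma> p) = p"
  "\<gamma> \<in> \<Gamma> \<Longrightarrow> p \<in> H3 \<Longrightarrow> \<gamma> ((inv\<^bsub>G\<^esub> \<gamma>) p) = p"
  by (simp_all only: inv_G Isom_inv_apply[OF isom])

lemma inv_\<Gamma> [simp]: "\<gamma> \<in> \<Gamma> \<Longrightarrow> inv\<^bsub>G\<^esub> \<gamma> \<in> \<Gamma>"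
  using inv_closed by simp

lemma mult_\<Gamma> [simp]: "\<gamma> \<in> \<Gamma> \<Longrightarrow> \<delta> \<in> \<Gamma> \<Longrightarrow> \<gamma> \<otimes>\<^bsub>G\<^esub> \<delta> \<in> \<Gamma>"
  using m_closed by simp

lemma ch_act [simp]: "\<gamma> \<in> \<Gamma> \<Longrightarrow> p \<in> H3 \<Longrightarrow> q \<in> H3 \<Longrightarrow> ch (\<gamma> p) (\<gamma> q) = ch p q"
  by (rule isometry_ch[OF isom])

lemma ch_inv_left: "\<gamma> \<in> \<Gamma> \<Longrightarrow> p \<in> H3 \<Longrightarrow> q \<in> H3 \<Longrightarrow> ch ((inv\<^bsub>G\<^esub> \<gamma>) p) q = ch p (\<gamma> q)"
  using ch_act[of \<gamma> "(inv\<^bsub>G\<^esub> \<gamma>) p" q] by (simp add: inv_apply)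

text \<open>A basic neighbourhood for pointwise convergence restricts the images of finitely many
  points only, and discreteness provides one that meets \<open>\<Gamma>\<close> in the identity
  alone.\<close>

lemma isolated_identity:
  obtains K e where "finite K" "K \<subseteq> H3" "e > 0"
    "\<And>\<gamma>. \<gamma> \<in> \<Gamma> \<Longrightarrow> \<forall>p\<in>K. hyp_dist p (\<gamma> p) < e \<Longrightarrow> \<gamma> = \<one>\<^bsub>I\<^esub>"
proof -
  interpret X: Metric_space H3 hyp_dist by (rule Metric_space_hyp_dist)
  let ?P = "product_topology (\<lambda>_. X.mtopology) H3"
  have one: "\<one>\<^bsub>I\<^esub> \<in> \<Gamma>" by (rule subgroup.one_closed[OF subgroup_\<Gamma>])
  have "openin (discrete_topology \<Gamma>) {\<one>\<^bsub>I\<^esub>}" using one by simp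
  then have "openin (subtopology (Isom_topology H3 hyp_dist) \<Gamma>) {\<one>\<^bsub>I\<^esub>}"
    using lattice by (simp add: cocompact_lattice_def)
  then obtain V where V: "openin ?P V" "{\<one>\<^bsub>I\<^esub>} = (V \<inter> isometries H3 hyp_dist) \<inter> \<Gamma>"
    unfolding Isom_topology_def openin_subtopology by auto
  then have "\<one>\<^bsub>I\<^esub> \<in> V" by auto
  then obtain Y where Y: "\<one>\<^bsub>I\<^esub> \<in> (\<Pi>\<^sub>E i\<in>H3. Y i)" "\<And>i. openin X.mtopology (Y i)"
    "finite {i. Y i \<noteq> topspace X.mtopology}" "(\<Pi>\<^sub>E i\<in>H3. Y i) \<subseteq> V"
    using product_topology_open_contains_basis[OF V(1) \<open>\<one>\<^bsub>I\<^esub> \<in> V\<close>] by (elim exE conjE) (rule that; (assumption | erule spec))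
  define K where "K = {i. Y i \<noteq> H3} \<inter> H3"
  have "finite K" using Y(3) by (simp add: K_def)
  have "\<exists>r>0. X.mball p r \<subseteq> Y p" if "p \<in> K" for p
  proof -
    have "p \<in> Y p" using Y(1) that by (auto simp: K_def PiE_iff Isom_one_apply)
    then show ?thesis using Y(2)[of p] unfolding X.openin_mtopology by blast
  qed
  then obtain r where r: "\<And>p. p \<in> K \<Longrightarrow> r p > 0 \<and> X.mball p (r p) \<subseteq> Y p" by metis
  \<comment> \<open>The inserted 1 covers an empty \<open>K\<close>.\<close>
  define e where "e = Min (insert 1 (r ` K))"
  have e: "e > 0" "\<And>p. p \<in> K \<Longrightarrow> e \<le> r p"
    unfolding e_def using \<open>finite K\<close> r by auto
  have "\<gamma> = \<one>\<^bsub>I\<^esub>" if g: "\<gamma> \<in> \<Gamma>" and c: "\<forall>p\<in>K. hyp_dist p (\<gamma> p) < e" for \<gamma>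
  proof -
    have "\<gamma> \<in> (\<Pi>\<^sub>E i\<in>H3. Y i)"
    proof (rule PiE_I)
      fix p assume p: "p \<in> H3"
      show "\<gamma> p \<in> Y p"
      proof (cases "p \<in> K")
        case True
        then have "\<gamma> p \<in> X.mball p (r p)" using bspec[OF c True] e(2)[OF True] p g by simp
        then show ?thesis using r[OF True] by blast
      next
        case False
        then show ?thesis using p g by (simp add: K_def)
      qed
    next
      fix p assume "p \<notin> H3"
      then show "\<gamma> p = undefined"
        using isom[OF g] by (intro extensional_arb[of \<gamma> H3]) (simp_all add: isometries_def Bij_def)
    qed
    then show ?thesis using Y(4) V(2) g isom[OF g] by blast
  qed
  then show thesis using that[of K e] \<open>finite K\<close> e(1) by (auto simp: K_def)
qed

text \<open>Pigeonhole: among infinitely many such elements, two would move the finite set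
  \<open>K\<close> of \<open>isolated_identity\<close> to almost the same places, so that their
  quotient would be the identity.\<close>

lemma finite_return_set: "finite {\<gamma> \<in> \<Gamma>. ch orig (\<gamma> orig) \<le> D}"
proof (rule ccontr)
  let ?S = "{\<gamma> \<in> \<Gamma>. ch orig (\<gamma> orig) \<le> D}"
  assume inf: "infinite ?S"
  then obtain \<gamma>0 where "\<gamma>0 \<in> ?S" using infinite_imp_nonempty by blast
  then have D: "D \<ge> 1" using ch_ge_1[of orig "\<gamma>0 orig"] by auto
  obtain K e where K: "finite K" "K \<subseteq> H3" "e > 0"
    "\<And>\<gamma>. \<gamma> \<in> \<Gamma> \<Longrightarrow> \<forall>p\<in>K. hyp_dist p (\<gamma> p) < e \<Longrightarrow> \<gamma> = \<one>\<^bsub>I\<^esub>"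
    by (rule isolated_identity) blast
  define B where "B = Max (insert 1 ((\<lambda>p. 2 * D * ch orig p) ` K))"
  have B: "B \<ge> 1" "\<And>p. p \<in> K \<Longrightarrow> 2 * D * ch orig p \<le> B"
    unfolding B_def using K(1) by (auto intro!: Max_ge simp del: Max_insert)
  have bound: "ch orig (\<gamma> p) \<le> B" if "\<gamma> \<in> ?S" "p \<in> K" for \<gamma> p
  proof -
    have p: "p \<in> H3" and g: "\<gamma> \<in> \<Gamma>" using that K by auto
    have "ch orig (\<gamma> p) \<le> 2 * ch orig (\<gamma> orig) * ch (\<gamma> orig) (\<gamma> p)"
      using p g by (intro ch_triangle) auto
    also have "\<dots> \<le> 2 * D * ch orig p"
      using that g p ch_pos[of orig p] D ch_pos[of orig "\<gamma> orig"]
      by (intro mult_mono) auto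
    also have "\<dots> \<le> B" by (rule B(2)[OF that(2)])
    finally show ?thesis .
  qed
  \<comment> \<open>With this value, a Euclidean distance below \<open>2 * \<delta>\<close> within
    the ball of \<open>ch\<close>-radius \<open>B\<close> forces \<open>ch\<close> below
    \<open>cosh e\<close>, by \<open>ch_le_of_dist\<close>.\<close>
  define \<delta> where "\<delta> = sqrt ((cosh e - 1) / (2 * B\<^sup>2)) / 2"
  have ce: "cosh e > 1" using K(3) cosh_real_nonneg_less_iff[of 0 e] by simp
  then have \<delta>: "\<delta> > 0" using B by (simp add: \<delta>_def)
  obtain N where N: "finite N" "\<forall>p\<in>H3. ch orig p \<le> B \<longrightarrow> (\<exists>k\<in>N. dist k p < \<delta>)"
    using finite_cover_ball[OF \<delta>, of B] by (elim exE conjE)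
  define c where "c = (\<lambda>p. SOME k. k \<in> N \<and> dist k p < \<delta>)"
  have c: "c p \<in> N \<and> dist (c p) p < \<delta>" if "p \<in> H3" "ch orig p \<le> B" for p
    unfolding c_def using mp[OF bspec[OF N(2) that(1)] that(2)]
    by (intro someI_ex[of "\<lambda>k. k \<in> N \<and> dist k p < \<delta>"]) blast
  \<comment> \<open>\<open>F \<gamma>\<close> records a net point near the image of each point of
    \<open>K\<close>; it takes finitely many values.\<close>
  define F where "F = (\<lambda>\<gamma>. \<lambda>p\<in>K. c (\<gamma> p))"
  have "F ` ?S \<subseteq> (\<Pi>\<^sub>E p\<in>K. N)"
  proof
    fix y assume "y \<in> F ` ?S"
    then obtain \<gamma> where \<gamma>: "y = F \<gamma>" "\<gamma> \<in> ?S" by blast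
    have "c (\<gamma> p) \<in> N" if "p \<in> K" for p
      using c[of "\<gamma> p"] bound[OF \<gamma>(2) that] \<gamma>(2) subsetD[OF K(2) that] by simp
    then show "y \<in> (\<Pi>\<^sub>E p\<in>K. N)" unfolding \<gamma>(1) F_def by (intro restrict_PiE_iff[THEN iffD2]) blast
  qed
  then have "finite (F ` ?S)"
    by (rule finite_subset) (intro finite_PiE K(1) N(1))
  then have "\<not> inj_on F ?S" using inf finite_imageD by blast
  then obtain \<gamma> \<delta>' where gd: "\<gamma> \<in> ?S" "\<delta>' \<in> ?S" "\<gamma> \<noteq> \<delta>'" "F \<gamma> = F \<delta>'"
    by (auto simp: inj_on_def)
  then have g: "\<gamma> \<in> \<Gamma>" "\<delta>' \<in> \<Gamma>" by auto
  let ?h = "inv\<^bsub>G\<^esub> \<delta>' \<otimes>\<^bsub>G\<^esub> \<gamma>"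
  have "?h = \<one>\<^bsub>I\<^esub>"
  proof (rule K(4); (intro ballI)?)
    show "?h \<in> \<Gamma>" by (intro mult_\<Gamma> inv_\<Gamma> g)
    fix p assume p: "p \<in> K"
    then have pH: "p \<in> H3" using K by auto
    have "c (\<gamma> p) = c (\<delta>' p)" using fun_cong[OF gd(4), of p] p by (simp add: F_def)
    then have "dist (\<delta>' p) (\<gamma> p) < 2 * \<delta>"
      using c[of "\<gamma> p"] c[of "\<delta>' p"] bound[OF gd(1) p] bound[OF gd(2) p] g pH
        dist_triangle_half_r[of "c (\<gamma> p)" "\<delta>' p" "2 * \<delta>" "\<gamma> p"] by (simp add: dist_commute)
    then have "(dist (\<delta>' p) (\<gamma> p))\<^sup>2 < (2 * \<delta>)\<^sup>2" by (intro power_strict_mono) auto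
    also have "(2 * \<delta>)\<^sup>2 = (cosh e - 1) / (2 * B\<^sup>2)"
      using ce by (simp add: \<delta>_def)
    finally have "2 * B\<^sup>2 * (dist (\<delta>' p) (\<gamma> p))\<^sup>2 < cosh e - 1"
      using B by (simp add: field_simps)
    moreover have "ch (\<delta>' p) (\<gamma> p) \<le> 1 + 2 * B\<^sup>2 * (dist (\<delta>' p) (\<gamma> p))\<^sup>2"
      using g pH bound[OF gd(1) p] bound[OF gd(2) p] by (intro ch_le_of_dist) auto
    ultimately have "ch (\<delta>' p) (\<gamma> p) < cosh e" by linarith
    moreover have "ch p (?h p) = ch (\<delta>' p) (\<gamma> p)"
      using g pH ch_inv_left[of \<delta>' "\<gamma> p" p] by (simp only: mult_apply inv_\<Gamma> ch_commute closed)
    ultimately show "hyp_dist p (?h p) < e"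
      using K(3) pH closed[OF mult_\<Gamma>[OF inv_\<Gamma>[OF g(2)] g(1)] pH] by (subst hyp_dist_less_iff) auto
  qed
  then have "\<delta>' \<otimes>\<^bsub>G\<^esub> ?h = \<delta>' \<otimes>\<^bsub>G\<^esub> \<one>\<^bsub>G\<^esub>" by simp
  moreover have "\<delta>' \<otimes>\<^bsub>G\<^esub> ?h = \<gamma>" "\<delta>' \<otimes>\<^bsub>G\<^esub> \<one>\<^bsub>G\<^esub> = \<delta>'"
    using g m_assoc[of \<delta>' "inv\<^bsub>G\<^esub> \<delta>'" \<gamma>] r_inv[of \<delta>'] l_one[of \<gamma>] r_one[of \<delta>'] by simp_all
  ultimately show False using gd(3) by simp
qed

text \<open>The isometries that move some orbit point to within \<open>n\<close> of
  \<open>orig\<close> form open sets, saturated under right multiplication by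
  \<open>\<Gamma>\<close>, which exhaust the group. By compactness of the coset space one of them is
  the whole group.\<close>

lemma cobounded:
  obtains R where "R \<ge> 1" "\<And>p. p \<in> H3 \<Longrightarrow> \<exists>\<gamma>\<in>\<Gamma>. ch p (\<gamma> orig) \<le> R"
proof -
  interpret X: Metric_space H3 hyp_dist by (rule Metric_space_hyp_dist)
  interpret I: group I by (rule group_Isom)
  let ?P = "product_topology (\<lambda>_. X.mtopology) H3" and ?T = "Isom_topology H3 hyp_dist"
  let ?q = "\<lambda>g. g <#\<^bsub>I\<^esub> \<Gamma>"
  obtain Q where Q: "quotient_map ?T Q ?q" "compact_space Q"
    using lattice by (auto simp: cocompact_lattice_def)
  have isoP: "isometries H3 hyp_dist \<subseteq> topspace ?P"
  proof
    fix f assume f: "f \<in> isometries H3 hyp_dist"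
    then have "f \<in> extensional H3" by (simp add: isometries_def Bij_def)
    then show "f \<in> topspace ?P" using isometries_image[OF f] by (simp add: PiE_iff)
  qed
  then have top: "topspace ?T = isometries H3 hyp_dist"
    unfolding Isom_topology_def by (simp add: Int_absorb1)
  define W where "W = (\<lambda>n::nat. {g \<in> isometries H3 hyp_dist. \<exists>\<gamma>\<in>\<Gamma>. hyp_dist orig (g (\<gamma> orig)) < real n})"
  define U where "U = (\<lambda>n. ?q ` W n)"
  \<comment> \<open>Passing to another representative of the coset only changes which orbit point is
    moved near \<open>orig\<close>.\<close>
  have W_sat: "g \<in> W n" if "g \<in> isometries H3 hyp_dist" "?q g \<in> U n" for g n
  proof -
    from that(2) obtain h where h: "h \<in> W n" "?q g = ?q h" by (auto simp: U_def)
    then obtain \<gamma> where \<gamma>: "\<gamma> \<in> \<Gamma>" "hyp_dist orig (h (\<gamma> orig)) < real n"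
      and hi: "h \<in> isometries H3 hyp_dist"
      by (auto simp: W_def)
    have "h = h \<otimes>\<^bsub>I\<^esub> \<one>\<^bsub>I\<^esub>" using hi by (simp add: carrier_Isom)
    then have "h \<in> ?q h"
      using subgroup.one_closed[OF subgroup_\<Gamma>] by (force simp: l_coset_def)
    then obtain \<delta> where \<delta>: "\<delta> \<in> \<Gamma>" "h = g \<otimes>\<^bsub>I\<^esub> \<delta>"
      using h(2) by (auto simp: l_coset_def)
    then have "h (\<gamma> orig) = g ((\<delta> \<otimes>\<^bsub>G\<^esub> \<gamma>) orig)"
      using that(1) \<gamma>(1) by (simp add: Isom_mult_apply isom)
    then show ?thesis
      using that(1) \<gamma> \<delta>(1) mult_\<Gamma>[OF \<delta>(1) \<gamma>(1)] unfolding W_def by auto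
  qed
  have W_open: "openin ?T (W n)" for n
  proof -
    have "openin ?T {g \<in> topspace ?T. g (\<gamma> orig) \<in> X.mball orig (real n)}" if "\<gamma> \<in> \<Gamma>" for \<gamma>
    proof (rule openin_continuous_map_preimage)
      show "continuous_map ?T X.mtopology (\<lambda>g. g (\<gamma> orig))"
        unfolding Isom_topology_def using that
        by (intro continuous_map_from_subtopology continuous_map_product_projection) auto
      show "openin X.mtopology (X.mball orig (real n))" by (rule X.openin_mball)
    qed
    then have "openin ?T (\<Union>\<gamma>\<in>\<Gamma>. {g \<in> topspace ?T. g (\<gamma> orig) \<in> X.mball orig (real n)})"
      by (intro openin_Union) auto
    also have "(\<Union>\<gamma>\<in>\<Gamma>. {g \<in> topspace ?T. g (\<gamma> orig) \<in> X.mball orig (real n)}) = W n"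
      unfolding top W_def by (auto simp: isometries_image)
    finally show ?thesis .
  qed
  have topQ: "topspace Q = ?q ` isometries H3 hyp_dist"
    using Q(1) unfolding quotient_map_def top by auto
  have "openin Q (U n)" for n
  proof -
    have "U n \<subseteq> topspace Q" unfolding U_def topQ W_def by auto
    moreover have "{g \<in> topspace ?T. ?q g \<in> U n} = W n"
    proof (rule subset_antisym; rule subsetI)
      show "g \<in> W n" if "g \<in> {g \<in> topspace ?T. ?q g \<in> U n}" for g
        using that W_sat by (simp add: top)
      show "g \<in> {g \<in> topspace ?T. ?q g \<in> U n}" if "g \<in> W n" for g
        using that by (auto simp: top U_def) (simp add: W_def)
    qed
    ultimately show ?thesis
      using Q(1)[unfolded quotient_map_def, THEN conjunct2, rule_format, of "U n"] W_open[of n] by simp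
  qed
  moreover have "topspace Q \<subseteq> \<Union> (range U)"
  proof
    fix y assume "y \<in> topspace Q"
    then obtain g where g: "g \<in> isometries H3 hyp_dist" "y = ?q g" by (auto simp: topQ)
    obtain n where "hyp_dist orig (g (\<one>\<^bsub>I\<^esub> orig)) < real n" using reals_Archimedean2 by blast
    then have "g \<in> W n" using g subgroup.one_closed[OF subgroup_\<Gamma>] by (auto simp: W_def)
    then show "y \<in> \<Union> (range U)" using g by (auto simp: U_def)
  qed
  ultimately obtain \<F> where \<F>: "finite \<F>" "\<F> \<subseteq> range U" "topspace Q \<subseteq> \<Union> \<F>"
    using Q(2) unfolding compact_space_def compactin_def
    by (metis (no_types, lifting) rangeE)
  then obtain J where J: "finite J" "\<F> = U ` J" by (meson finite_subset_image)
  define n where "n = Max (insert 0 J)"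
  have n: "j \<le> n" if "j \<in> J" for j using J that by (auto simp: n_def)
  have mono: "W i \<subseteq> W j" if "i \<le> j" for i j
  proof
    fix g assume "g \<in> W i"
    then obtain \<gamma> where g: "g \<in> isometries H3 hyp_dist" "\<gamma> \<in> \<Gamma>" "hyp_dist orig (g (\<gamma> orig)) < real i"
      by (auto simp: W_def)
    moreover from g(3) that have "hyp_dist orig (g (\<gamma> orig)) < real j" by linarith
    ultimately show "g \<in> W j" by (auto simp: W_def)
  qed
  have all: "g \<in> W n" if g: "g \<in> isometries H3 hyp_dist" for g
  proof -
    have "?q g \<in> topspace Q" using g by (auto simp: topQ)
    then obtain j where "j \<in> J" "?q g \<in> U j" using \<F>(3) J(2) by auto
    then show ?thesis using W_sat[OF g] mono[OF n] by blast
  qed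
  have "\<exists>\<gamma>\<in>\<Gamma>. ch p (\<gamma> orig) \<le> cosh (real n)" if p: "p \<in> H3" for p
  proof -
    \<comment> \<open>The inverse of \<open>f\<close> carries \<open>p\<close> to
      \<open>orig\<close>, so an orbit point that it moves near \<open>orig\<close> lies near
      \<open>p\<close>.\<close>
    obtain f where f: "f \<in> isometries H3 hyp_dist" "f orig = p" using exists_isometry_to[OF p] .
    have "inv\<^bsub>I\<^esub> f \<in> W n" by (rule all[OF Isom_inv_closed[OF f(1)]])
    then obtain \<gamma> where \<gamma>: "\<gamma> \<in> \<Gamma>" "hyp_dist orig ((inv\<^bsub>I\<^esub> f) (\<gamma> orig)) < real n"
      by (auto simp: W_def)
    have m: "(inv\<^bsub>I\<^esub> f) (\<gamma> orig) \<in> H3"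
      using \<gamma> isometries_image[OF Isom_inv_closed[OF f(1)]] by auto
    then have "ch orig ((inv\<^bsub>I\<^esub> f) (\<gamma> orig)) < cosh (real n)"
      using \<gamma>(2) by (simp add: hyp_dist_less_iff)
    moreover have "ch orig ((inv\<^bsub>I\<^esub> f) (\<gamma> orig)) = ch p (\<gamma> orig)"
      using isometry_ch[OF f(1) orig_H3 m] f \<gamma>(1) by (simp add: Isom_inv_apply)
    ultimately show ?thesis using \<gamma>(1) by force
  qed
  then show thesis using that[of "cosh (real n)"] cosh_real_ge_1 by blast
qed

end

section \<open>Klein model and Busemann functions\<close>

text \<open>The Klein ball model: the hyperboloid coordinates divided by the time coordinate.\<close>

definition kl :: "complex \<times> real \<Rightarrow> complex \<times> real" where
  "kl p = (let d = (norm (fst p))\<^sup>2 + (snd p)\<^sup>2 + 1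
           in ((2 / d) *\<^sub>R fst p, ((norm (fst p))\<^sup>2 + (snd p)\<^sup>2 - 1) / d))"

text \<open>Up to sign the Lorentz product of the hyperboloid points is \<open>ch p q\<close>, and
  their time coordinates are \<open>ch orig p\<close> and \<open>ch orig q\<close>; divide the
  product by both.\<close>

lemma inner_kl:
  assumes "p \<in> H3" "q \<in> H3"
  shows "kl p \<bullet> kl q = 1 - ch p q / (ch orig p * ch orig q)"
proof -
  obtain z t w s where [simp]: "p = (z, t)" "q = (w, s)" by (cases p; cases q)
  have pos: "t > 0" "s > 0" using assms by (auto simp: H3_def)
  define A where "A = (norm z)\<^sup>2 + t\<^sup>2"
  define B where "B = (norm w)\<^sup>2 + s\<^sup>2"
  have AB: "A + 1 > 0" "B + 1 > 0" by (auto simp: A_def B_def add_nonneg_pos)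
  have n: "(norm (z - w))\<^sup>2 + t\<^sup>2 + s\<^sup>2 = A + B - 2 * (z \<bullet> w)"
    by (simp add: A_def B_def power2_norm_eq_inner inner_diff_left inner_diff_right inner_commute)
  have "kl p \<bullet> kl q = (4 * (z \<bullet> w) + (A - 1) * (B - 1)) / ((A + 1) * (B + 1))"
    using AB by (simp add: kl_def Let_def inner_prod_def A_def[symmetric] B_def[symmetric] add_divide_distrib)
  also have "4 * (z \<bullet> w) + (A - 1) * (B - 1) = (A + 1) * (B + 1) - 2 * (A + B - 2 * (z \<bullet> w))"
    by (simp add: algebra_simps)
  also have "\<dots> / ((A + 1) * (B + 1)) = 1 - 2 * (A + B - 2 * (z \<bullet> w)) / ((A + 1) * (B + 1))"
    using AB by (simp add: diff_divide_distrib)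
  also have "2 * (A + B - 2 * (z \<bullet> w)) / ((A + 1) * (B + 1)) = ch p q / (ch orig p * ch orig q)"
  proof -
    define u where "u = A + B - 2 * (z \<bullet> w)"
    have "ch p q = u / (2 * t * s)" "ch orig p = (A + 1) / (2 * t)" "ch orig q = (B + 1) / (2 * s)"
      using pos by (simp_all add: ch_orig ch_formula n A_def B_def u_def)
    then show ?thesis using pos AB unfolding u_def[symmetric] by simp
  qed
  finally show ?thesis .
qed

lemma norm_kl_le_1:
  assumes "p \<in> H3"
  shows "norm (kl p) \<le> 1"
proof -
  have "(norm (kl p))\<^sup>2 \<le> 1\<^sup>2"
    using assms by (simp add: power2_norm_eq_inner inner_kl)
  then show ?thesis by (rule power2_le_imp_le) simp
qed

text \<open>By \<open>inner_kl\<close> the squared distance is at most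
  \<open>2 * ch p q / (ch orig p * ch orig q)\<close>, and the triangle inequality replaces
  \<open>ch orig q\<close> by \<open>ch orig p\<close>. So points a bounded distance apart approach
  each other in the Klein ball at the rate \<open>1 / ch orig p\<close>.\<close>

lemma norm_kl_diff_le:
  assumes "p \<in> H3" "q \<in> H3"
  shows "norm (kl p - kl q) \<le> 2 * ch p q / ch orig p"
proof -
  have pos: "ch orig p > 0" "ch orig q > 0" "ch p q > 0" using assms by (auto intro: ch_pos)
  have le: "ch orig p \<le> 2 * ch orig q * ch p q"
    using ch_triangle[OF orig_H3 assms(2,1)] by (simp add: ch_commute)
  have "(norm (kl p - kl q))\<^sup>2 = kl p \<bullet> kl p + kl q \<bullet> kl q - 2 * (kl p \<bullet> kl q)"
    by (simp add: power2_norm_eq_inner inner_diff_left inner_diff_right inner_commute)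
  also have "\<dots> = 2 * ch p q / (ch orig p * ch orig q) - 1 / (ch orig p * ch orig p) - 1 / (ch orig q * ch orig q)"
    using assms by (simp add: inner_kl)
  also have "\<dots> \<le> 2 * ch p q / (ch orig p * ch orig q)"
    using pos by (simp add: order_trans[of _ 0])
  also have "\<dots> \<le> (2 * ch p q / ch orig p)\<^sup>2"
  proof -
    have "1 / ch orig q \<le> 2 * ch p q / ch orig p"
      using le pos by (simp add: field_simps)
    then have "(2 * ch p q / ch orig p) * (1 / ch orig q) \<le> (2 * ch p q / ch orig p) * (2 * ch p q / ch orig p)"
      using pos by (intro mult_left_mono) auto
    then show ?thesis by (simp add: power2_eq_square)
  qed
  finally show ?thesis
    by (rule power2_le_imp_le) (use pos in auto)
qed

text \<open>The difference of two Busemann-type functions; it extends to a Lipschitz function on the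
  closed Klein ball.\<close>

definition buse :: "complex \<times> real \<Rightarrow> complex \<times> real \<Rightarrow> real" where
  "buse q x = ln (ch q x / ch orig x)"

lemma ch_ratio_bounds:
  assumes "q \<in> H3" "x \<in> H3"
  shows "1 / (2 * ch orig q) \<le> ch q x / ch orig x" "ch q x / ch orig x \<le> 2 * ch orig q"
proof -
  have pos: "ch orig x > 0" "ch orig q > 0" using assms by (auto intro: ch_pos)
  show "1 / (2 * ch orig q) \<le> ch q x / ch orig x"
    using pos ch_triangle[OF orig_H3 assms] by (simp add: field_simps)
  show "ch q x / ch orig x \<le> 2 * ch orig q"
    using pos ch_triangle[OF assms(1) orig_H3 assms(2)] by (simp add: field_simps ch_commute)
qed

lemma buse_lower:
  assumes "q \<in> H3" "x \<in> H3"
  shows "- ln (2 * ch orig q) \<le> buse q x"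
proof -
  have "- ln (2 * ch orig q) = ln (1 / (2 * ch orig q))"
    using ch_pos[OF orig_H3 assms(1)] by (simp add: ln_div)
  also have "\<dots> \<le> buse q x"
    unfolding buse_def
    by (rule ln_mono[OF ch_ratio_bounds(1)[OF assms]]) (use ch_pos assms in auto)
  finally show ?thesis .
qed

lemma buse_upper:
  assumes "q \<in> H3" "x \<in> H3"
  shows "buse q x \<le> ln (2 * ch orig q)"
  unfolding buse_def
  by (rule ln_mono[OF ch_ratio_bounds(2)[OF assms]]) (use ch_pos assms in auto)

lemma ln_diff_le:
  fixes a b m :: real
  assumes "0 < m" "m \<le> a" "m \<le> b"
  shows "\<bar>ln a - ln b\<bar> \<le> \<bar>a - b\<bar> / m"
proof -
  have "ln x - ln y \<le> \<bar>x - y\<bar> / m" if "m \<le> x" "m \<le> y" for x y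
  proof -
    have "ln x - ln y = ln (x / y)" using that assms by (simp add: ln_div)
    also have "\<dots> \<le> x / y - 1" using that assms by (intro ln_le_minus_one) auto
    also have "\<dots> = (x - y) / y" using that assms by (simp add: field_simps)
    also have "\<dots> \<le> \<bar>x - y\<bar> / y" using that assms by (intro divide_right_mono) auto
    also have "\<dots> \<le> \<bar>x - y\<bar> / m" using that assms by (intro divide_left_mono) auto
    finally show ?thesis .
  qed
  from this[of a b] this[of b a] show ?thesis using assms by (simp add: abs_le_iff abs_minus_commute)
qed

text \<open>By \<open>inner_kl\<close> the ratio \<open>ch q x / ch orig x\<close> is an affine
  function of \<open>kl x\<close>, and it stays above \<open>1 / (2 * ch orig q)\<close>, where the
  logarithm is Lipschitz.\<close>

lemma buse_diff_le:
  assumes "q \<in> H3" "x \<in> H3" "y \<in> H3"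
  shows "\<bar>buse q x - buse q y\<bar> \<le> 4 * (ch orig q)\<^sup>2 * ch x y / ch orig x"
proof -
  let ?Q = "ch orig q"
  have Q: "?Q > 0" using assms by (auto intro: ch_pos)
  have r: "ch q p / ch orig p = ?Q * (1 - kl q \<bullet> kl p)" if "p \<in> H3" for p
    using inner_kl[OF assms(1) that] Q by simp
  have "\<bar>ch q x / ch orig x - ch q y / ch orig y\<bar> = ?Q * \<bar>kl q \<bullet> (kl x - kl y)\<bar>"
    using Q by (simp add: r assms inner_diff_right abs_mult abs_minus_commute flip: right_diff_distrib)
  also have "\<dots> \<le> ?Q * (norm (kl q) * norm (kl x - kl y))"
    using Q by (intro mult_left_mono Cauchy_Schwarz_ineq2) auto
  also have "\<dots> \<le> ?Q * (1 * (2 * ch x y / ch orig x))"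
    using Q assms by (intro mult_left_mono mult_mono norm_kl_le_1 norm_kl_diff_le) auto
  finally have d: "\<bar>ch q x / ch orig x - ch q y / ch orig y\<bar> \<le> ?Q * (2 * ch x y / ch orig x)" by simp
  have "\<bar>buse q x - buse q y\<bar> \<le> \<bar>ch q x / ch orig x - ch q y / ch orig y\<bar> / (1 / (2 * ?Q))"
    unfolding buse_def using Q assms by (intro ln_diff_le ch_ratio_bounds) auto
  also have "\<dots> \<le> ?Q * (2 * ch x y / ch orig x) / (1 / (2 * ?Q))"
    using Q by (intro divide_right_mono d) auto
  finally show ?thesis by (simp add: power2_eq_square mult_ac)
qed

text \<open>In the hyperboloid model this is the normalised positive combination of two points.\<close>

lemma weighted_midpoint:
  assumes "p \<in> H3" "q \<in> H3" "\<alpha> > 0" "\<beta> > 0"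
  shows "\<exists>P\<in>H3. \<forall>x\<in>H3. ch x P = (\<alpha> * ch x p + \<beta> * ch x q) / sqrt (\<alpha>\<^sup>2 + \<beta>\<^sup>2 + 2 * \<alpha> * \<beta> * ch p q)"
proof -
  obtain z a w b where [simp]: "p = (z, a)" "q = (w, b)" by (cases p; cases q)
  have pos: "a > 0" "b > 0" using assms by (auto simp: H3_def)
  \<comment> \<open>In suitable linear coordinates the hyperboloid point of \<open>(z, a)\<close>
    has the entries 1, \<open>z\<close> and \<open>(norm z)\<^sup>2 + a\<^sup>2\<close>, all divided
    by \<open>a\<close>. Hence \<open>A + B\<close> is the first entry of the combination.\<close>
  define A where "A = \<alpha> / a"
  define B where "B = \<beta> / b"
  have AB: "A > 0" "B > 0" "\<alpha> = A * a" "\<beta> = B * b" using pos assms by (auto simp: A_def B_def)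
  define n2 where "n2 = \<alpha>\<^sup>2 + \<beta>\<^sup>2 + 2 * \<alpha> * \<beta> * ch p q"
  define n where "n = sqrt n2"
  have n2: "n2 = A * B * (norm (z - w))\<^sup>2 + (A + B) * (A * a\<^sup>2 + B * b\<^sup>2)"
    unfolding n2_def AB using pos by (simp add: ch_formula field_simps power2_eq_square)
  have "n2 > 0"
    unfolding n2 using AB pos by (intro add_nonneg_pos mult_nonneg_nonneg mult_pos_pos add_pos_pos) auto
  then have n: "n > 0" "n\<^sup>2 = n2" by (auto simp: n_def)
  \<comment> \<open>Read off from the combination divided by \<open>n\<close>: its first entries
    must be \<open>1 / t\<close> and \<open>y / t\<close>.\<close>
  define t where "t = n / (A + B)"
  define y where "y = (1 / (A + B)) *\<^sub>R (A *\<^sub>R z + B *\<^sub>R w)"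
  have t: "t > 0" using n AB by (simp add: t_def)
  \<comment> \<open>Parallel axis identity in one real variable, used for the real and imaginary
    parts.\<close>
  have coord: "A * (v - x)\<^sup>2 + B * (v - u)\<^sup>2
      = (A + B) * (v - (A * x + B * u) / (A + B))\<^sup>2 + A * B / (A + B) * (x - u)\<^sup>2" for v x u :: real
  proof -
    define m where "m = (A * x + B * u) / (A + B)"
    have S: "A + B > 0" using AB by simp
    have m: "(A + B) * m = A * x + B * u" using S by (simp add: m_def)
    have "(A + B) * (A * (v - x)\<^sup>2 + B * (v - u)\<^sup>2) = ((A + B) * v - (A * x + B * u))\<^sup>2 + A * B * (x - u)\<^sup>2"
      by (simp add: power2_eq_square algebra_simps)
    also have "((A + B) * v - (A * x + B * u))\<^sup>2 = (A + B) * ((A + B) * (v - m)\<^sup>2)"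
      unfolding m[symmetric] by (simp add: power2_eq_square algebra_simps)
    finally have "(A + B) * (A * (v - x)\<^sup>2 + B * (v - u)\<^sup>2)
        = (A + B) * ((A + B) * (v - m)\<^sup>2 + A * B / (A + B) * (x - u)\<^sup>2)"
      using S by (simp add: distrib_left)
    then show ?thesis using S by (simp add: m_def)
  qed
  have P: "ch x (y, t) = (\<alpha> * ch x p + \<beta> * ch x q) / n" if "x \<in> H3" for x
  proof -
    obtain v s where [simp]: "x = (v, s)" by (cases x)
    have s: "s > 0" using that by (simp add: H3_def)
    have Re_y: "Re y = (A * Re z + B * Re w) / (A + B)" "Im y = (A * Im z + B * Im w) / (A + B)"
      by (simp_all add: y_def)
    have split: "A * (norm (v - z))\<^sup>2 + B * (norm (v - w))\<^sup>2
        = (A + B) * (norm (v - y))\<^sup>2 + A * B / (A + B) * (norm (z - w))\<^sup>2"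
      using coord[of "Re v" "Re z" "Re w"] coord[of "Im v" "Im z" "Im w"]
      unfolding cmod_power2 minus_complex.simps Re_y distrib_left by linarith
    have "(A + B) * t\<^sup>2 = n2 / (A + B)"
      using AB n by (simp add: t_def power_divide power2_eq_square)
    also have "\<dots> = A * B / (A + B) * (norm (z - w))\<^sup>2 + (A * a\<^sup>2 + B * b\<^sup>2)"
      unfolding n2 using AB by (simp add: add_divide_distrib)
    finally have tt: "(A + B) * t\<^sup>2 = A * B / (A + B) * (norm (z - w))\<^sup>2 + (A * a\<^sup>2 + B * b\<^sup>2)" .
    have "(\<alpha> * ch x p + \<beta> * ch x q) / n
        = (A * ((norm (v - z))\<^sup>2 + s\<^sup>2 + a\<^sup>2) + B * ((norm (v - w))\<^sup>2 + s\<^sup>2 + b\<^sup>2)) / (2 * s * n)"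
      using s pos n(1) by (simp add: AB(3,4) ch_formula field_simps)
    also have "A * ((norm (v - z))\<^sup>2 + s\<^sup>2 + a\<^sup>2) + B * ((norm (v - w))\<^sup>2 + s\<^sup>2 + b\<^sup>2)
        = (A + B) * ((norm (v - y))\<^sup>2 + s\<^sup>2 + t\<^sup>2)"
      using split tt by (simp add: algebra_simps)
    also have "(A + B) * ((norm (v - y))\<^sup>2 + s\<^sup>2 + t\<^sup>2) / (2 * s * n) = ch x (y, t)"
    proof -
      have "n = t * (A + B)" using AB by (simp add: t_def)
      then show ?thesis using s t AB by (simp add: ch_formula)
    qed
    finally show ?thesis ..
  qed
  have "(y, t) \<in> H3" using t by (simp add: H3_def)
  then show ?thesis using P unfolding n_def n2_def by blast
qed

section \<open>Counting orbit points\<close>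

text \<open>The boxes have height \<open>2\<^sup>k / (2\<tau>)\<close>, so those meeting the ball have \<open>2\<^sup>k \<le> 4\<tau>\<^sup>2\<close>.\<close>

lemma box_cover:
  assumes \<tau>: "\<tau> \<ge> 1"
  shows "\<exists>(B :: (nat \<times> int \<times> int) set) b. finite B \<and> real (card B) \<le> 272 * \<tau>\<^sup>2 \<and>
    (\<forall>q\<in>H3. ch orig q \<le> \<tau> \<longrightarrow> b q \<in> B) \<and>
    (\<forall>q\<in>H3. \<forall>r\<in>H3. ch orig q \<le> \<tau> \<longrightarrow> ch orig r \<le> \<tau> \<longrightarrow> b q = b r \<longrightarrow> ch q r \<le> 5 / 2)"
proof -
  define h where "h = (\<lambda>k::nat. 2 ^ k / (2 * \<tau>))"
  have h_pos: "h k > 0" for k using \<tau> by (simp add: h_def)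
  define kk where "kk = (\<lambda>t::real. nat \<lfloor>log 2 (2 * \<tau> * t)\<rfloor>)"
  have kk: "h (kk t) \<le> t" "t < 2 * h (kk t)" if "1 \<le> 2 * t * \<tau>" for t
  proof -
    have x: "2 * \<tau> * t \<ge> 1" using that by (simp add: mult_ac)
    then have l: "log 2 (2 * \<tau> * t) \<ge> 0" by simp
    have k: "real (kk t) \<le> log 2 (2 * \<tau> * t)" "log 2 (2 * \<tau> * t) < real (kk t) + 1"
      using l unfolding kk_def by (simp_all add: floor_less_iff)
    have "2 powr real (kk t) \<le> 2 powr log 2 (2 * \<tau> * t)" using k(1) by simp
    then show "h (kk t) \<le> t" using x \<tau> by (simp add: h_def powr_realpow field_simps)
    have "2 powr log 2 (2 * \<tau> * t) < 2 powr (real (kk t) + 1)" using k(2) by simp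
    then show "t < 2 * h (kk t)" using x \<tau> by (simp add: h_def powr_realpow powr_add field_simps)
  qed
  \<comment> \<open>In the layer of heights from \<open>h k\<close> to \<open>2 * h k\<close> the
    ball has horizontal radius at most \<open>2 * sqrt (\<tau> * h k)\<close>, which is
    \<open>2 * sqrt (\<tau> / h k)\<close> box widths.\<close>
  define L where "L = (\<lambda>k. \<lceil>2 * sqrt (\<tau> / h k)\<rceil>)"
  define ks where "ks = {k::nat. 2 ^ k \<le> 4 * \<tau>\<^sup>2}"
  define B where "B = (SIGMA k:ks. {- L k..L k} \<times> {- L k..L k})"
  define b where "b = (\<lambda>q::complex \<times> real. let k = kk (snd q) in
    (k, \<lfloor>Re (fst q) / h k\<rfloor>, \<lfloor>Im (fst q) / h k\<rfloor>))"
  have "ks \<subseteq> {..nat \<lceil>4 * \<tau>\<^sup>2\<rceil>}"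
  proof
    fix k assume "k \<in> ks"
    then have "2 ^ k \<le> 4 * \<tau>\<^sup>2" by (simp add: ks_def)
    moreover have "real k < 2 ^ k" by (rule of_nat_less_two_power)
    ultimately have "real k \<le> 4 * \<tau>\<^sup>2" by linarith
    then show "k \<in> {..nat \<lceil>4 * \<tau>\<^sup>2\<rceil>}" by (simp add: le_nat_iff) linarith
  qed
  then have fin_ks: "finite ks" by (rule finite_subset) simp
  have finB: "finite B" unfolding B_def using fin_ks by auto
  \<comment> \<open>The number of boxes in a layer is of order \<open>\<tau> / h k\<close>, so it
    decreases geometrically in \<open>k\<close> and the total is of the order of the lowest
    layer.\<close>
  have level: "real (card ({- L k..L k} \<times> {- L k..L k})) \<le> 136 * \<tau>\<^sup>2 * (1 / 2) ^ k" if "k \<in> ks" for k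
  proof -
    define s where "s = sqrt (\<tau> / h k)"
    have hk: "h k \<le> 2 * \<tau>"
      using that \<tau> by (simp add: ks_def h_def field_simps power2_eq_square)
    have s2: "s\<^sup>2 = \<tau> / h k" using \<tau> h_pos[of k] by (simp add: s_def)
    have s2': "1 \<le> 2 * s\<^sup>2" unfolding s2 using hk h_pos[of k] by (simp add: field_simps)
    have s0: "s \<ge> 0" using \<tau> h_pos[of k] by (simp add: s_def)
    have L: "L k \<ge> 0" "real_of_int (L k) \<le> 2 * s + 1"
      using s0 unfolding L_def s_def[symmetric] by linarith+
    have "real (card ({- L k..L k} \<times> {- L k..L k})) = (real_of_int (2 * L k + 1))\<^sup>2"
      using L(1) by (simp add: card_cartesian_product power2_eq_square)
    also have "\<dots> \<le> (4 * s + 3)\<^sup>2"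
      using L by (intro power_mono) auto
    \<comment> \<open>The linear term is bounded by \<open>24 * s \<le> 16 * s\<^sup>2 + 9\<close>,
      and the constants are absorbed by \<open>1 \<le> 2 * s\<^sup>2\<close>.\<close>
    also have "\<dots> \<le> 68 * s\<^sup>2"
      using s2' zero_le_power2[of "4 * s - 3"] by (simp add: power2_eq_square algebra_simps)
    also have "\<dots> = 136 * \<tau>\<^sup>2 * (1 / 2) ^ k"
      unfolding s2 using \<tau> by (simp add: h_def power2_eq_square power_divide)
    finally show ?thesis .
  qed
  have "real (card B) = (\<Sum>k\<in>ks. real (card ({- L k..L k} \<times> {- L k..L k})))"
    unfolding B_def using fin_ks by (subst card_SigmaI) auto
  also have "\<dots> \<le> (\<Sum>k\<in>ks. 136 * \<tau>\<^sup>2 * (1 / 2) ^ k)"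
    by (intro sum_mono level)
  also have "\<dots> = 136 * \<tau>\<^sup>2 * (\<Sum>k\<in>ks. (1 / 2) ^ k)"
    by (simp add: sum_distrib_left)
  also have "\<dots> \<le> 136 * \<tau>\<^sup>2 * (\<Sum>k. (1 / 2) ^ k)"
    using fin_ks by (intro mult_left_mono sum_le_suminf) (auto intro: summable_geometric)
  also have "\<dots> = 272 * \<tau>\<^sup>2" by (simp add: suminf_geometric)
  finally have cardB: "real (card B) \<le> 272 * \<tau>\<^sup>2" .
  have inB: "b q \<in> B" if "q \<in> H3" "ch orig q \<le> \<tau>" for q
  proof -
    obtain z t where q: "q = (z, t)" by (cases q)
    have t: "(norm z)\<^sup>2 \<le> 2 * t * \<tau>" "t \<le> 2 * \<tau>" "1 \<le> 2 * t * \<tau>"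
      using ch_orig_bounds[of z t \<tau>] that by (auto simp: q)
    define k where "k = kk t"
    have k: "h k \<le> t" "t < 2 * h k" using kk[OF t(3)] by (auto simp: k_def)
    have "2 ^ k / (2 * \<tau>) \<le> 2 * \<tau>" using k(1) t(2) by (simp add: h_def)
    then have "k \<in> ks" using \<tau> by (simp add: ks_def field_simps power2_eq_square)
    have "norm z / h k \<le> 2 * sqrt (\<tau> / h k)"
    proof (rule power2_le_imp_le)
      have "(norm z)\<^sup>2 \<le> 4 * h k * \<tau>"
        using t(1) k(2) \<tau> mult_right_mono[of t "2 * h k" \<tau>] by linarith
      then have "(norm z)\<^sup>2 / (h k)\<^sup>2 \<le> 4 * h k * \<tau> / (h k)\<^sup>2"
        by (intro divide_right_mono) auto
      also have "\<dots> = 4 * (\<tau> / h k)" using h_pos[of k] by (simp add: power2_eq_square)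
      finally show "(norm z / h k)\<^sup>2 \<le> (2 * sqrt (\<tau> / h k))\<^sup>2"
        using \<tau> h_pos[of k] by (simp add: power_divide power_mult_distrib)
      show "0 \<le> 2 * sqrt (\<tau> / h k)" using \<tau> h_pos[of k] by simp
    qed
    then have nz: "norm z / h k \<le> L k" unfolding L_def by linarith
    have fl: "\<lfloor>x / h k\<rfloor> \<in> {- L k..L k}" if "\<bar>x\<bar> \<le> norm z" for x
    proof -
      have "\<bar>x / h k\<bar> \<le> norm z / h k"
        using that h_pos[of k] by (simp add: abs_divide divide_right_mono)
      then have "- real_of_int (L k) \<le> x / h k" "x / h k \<le> real_of_int (L k)" using nz by linarith+
      then show ?thesis by (simp add: le_floor_iff floor_le_iff)
    qed
    show ?thesis
      using fl[OF abs_Re_le_cmod] fl[OF abs_Im_le_cmod] \<open>k \<in> ks\<close>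
      unfolding b_def B_def q by (simp add: Let_def k_def)
  qed
  have close: "ch q r \<le> 5 / 2" if "q \<in> H3" "r \<in> H3" "ch orig q \<le> \<tau>" "ch orig r \<le> \<tau>" "b q = b r" for q r
  proof -
    obtain z t w s where q: "q = (z, t)" and r: "r = (w, s)" by (cases q; cases r)
    have t: "1 \<le> 2 * t * \<tau>" and s: "1 \<le> 2 * s * \<tau>"
      using ch_orig_bounds(3)[of z t \<tau>] ch_orig_bounds(3)[of w s \<tau>] that by (auto simp: q r)
    define H where "H = h (kk t)"
    have kk': "kk s = kk t" using that(5) by (simp add: b_def q r Let_def)
    have H: "H > 0" "H \<le> t" "t < 2 * H" "H \<le> s" "s < 2 * H"
      using kk[OF t] kk[OF s] h_pos by (auto simp: H_def kk')
    have fl: "\<lfloor>Re z / H\<rfloor> = \<lfloor>Re w / H\<rfloor>" "\<lfloor>Im z / H\<rfloor> = \<lfloor>Im w / H\<rfloor>"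
      using that(5) by (simp_all add: b_def q r Let_def kk' H_def)
    have diff: "(x - y)\<^sup>2 \<le> H\<^sup>2" if "\<lfloor>x / H\<rfloor> = \<lfloor>y / H\<rfloor>" for x y
    proof -
      have "\<bar>x / H - y / H\<bar> \<le> 1" using that by linarith
      then have "\<bar>x - y\<bar> \<le> H" using H(1) by (simp add: field_simps flip: diff_divide_distrib)
      then show ?thesis by (metis H(1) abs_le_square_iff abs_of_pos)
    qed
    \<comment> \<open>All three coordinates differ by at most \<open>H\<close> and both heights are
      at least \<open>H\<close>, whence the bound \<open>1 + 3 / 2\<close>.\<close>
    have "\<bar>t - s\<bar> \<le> H" using H by linarith
    then have "(t - s)\<^sup>2 \<le> H\<^sup>2" using H(1) by (metis abs_le_square_iff abs_of_pos)
    then have "(norm (z - w))\<^sup>2 + (t - s)\<^sup>2 \<le> 3 * H\<^sup>2"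
      using diff[OF fl(1)] diff[OF fl(2)] by (simp add: cmod_power2)
    moreover have "H\<^sup>2 \<le> t * s" unfolding power2_eq_square using H by (intro mult_mono) auto
    moreover have "t * s > 0" using H by simp
    ultimately show ?thesis
      using H by (simp add: q r ch_formula field_simps power2_eq_square)
  qed
  show ?thesis
    using finB cardB inB close by (intro exI[of _ B] exI[of _ b]) blast
qed

lemma card_le_fibres:
  assumes "finite B" "\<And>x. x \<in> A \<Longrightarrow> f x \<in> B"
    and "\<And>x. x \<in> A \<Longrightarrow> finite {y \<in> A. f y = f x} \<and> card {y \<in> A. f y = f x} \<le> c"
  shows "finite A \<and> card A \<le> c * card B"
proof -
  have A: "A = (\<Union>b\<in>B. {y \<in> A. f y = b})" using assms(2) by auto
  have fib: "finite {y \<in> A. f y = b} \<and> card {y \<in> A. f y = b} \<le> c" for b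
  proof (cases "\<exists>x\<in>A. f x = b")
    case True
    then show ?thesis using assms(3) by auto
  next
    case False
    then have "{y \<in> A. f y = b} = {}" by auto
    then show ?thesis by (simp only: finite.emptyI card.empty) simp
  qed
  have "finite A" using fib assms(1) by (subst A) blast
  moreover have "card A \<le> c * card B"
  proof -
    have "card A \<le> (\<Sum>b\<in>B. card {y \<in> A. f y = b})"
      by (subst A) (rule card_UN_le[OF assms(1)])
    also have "\<dots> \<le> (\<Sum>b\<in>B. c)" using fib by (intro sum_mono) blast
    finally show ?thesis by (simp add: mult.commute)
  qed
  ultimately show ?thesis by blast
qed

context cocompact_H3 begin

text \<open>Two group elements whose orbit points share a box of \<open>box_cover\<close> differ by
  an element of the finite set \<open>R\<close>, so each box accounts for at most
  \<open>card R\<close> elements. Moving \<open>P\<close> to \<open>orig\<close> by a similarity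
  makes the constant independent of \<open>P\<close>.\<close>

lemma orbit_count_upper:
  "\<exists>K>0. \<forall>P\<in>H3. \<forall>\<tau>\<ge>1. finite {\<gamma> \<in> \<Gamma>. ch P (\<gamma> orig) \<le> \<tau>} \<and>
      real (card {\<gamma> \<in> \<Gamma>. ch P (\<gamma> orig) \<le> \<tau>}) \<le> K * \<tau>\<^sup>2"
proof -
  define R where "R = {\<gamma> \<in> \<Gamma>. ch orig (\<gamma> orig) \<le> 5 / 2}"
  have "finite R" unfolding R_def by (rule finite_return_set)
  define K where "K = real (card R) * 272 + 1"
  have "finite {\<gamma> \<in> \<Gamma>. ch P (\<gamma> orig) \<le> \<tau>} \<and> real (card {\<gamma> \<in> \<Gamma>. ch P (\<gamma> orig) \<le> \<tau>}) \<le> K * \<tau>\<^sup>2"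
    if P: "P \<in> H3" and \<tau>: "\<tau> \<ge> 1" for P \<tau>
  proof -
    let ?A = "{\<gamma> \<in> \<Gamma>. ch P (\<gamma> orig) \<le> \<tau>}"
    have s: "snd P > 0" using P by (simp add: H3_def)
    \<comment> \<open>This similarity need not normalise \<Gamma>; it only transports values of
      \<open>ch\<close>.\<close>
    define N where "N = sim (- (fst P /\<^sub>R snd P)) (1 / snd P)"
    have N: "N p \<in> H3" "ch orig (N p) = ch P p" if "p \<in> H3" for p
    proof -
      show "N p \<in> H3" unfolding N_def using s that by (intro sim_H3) auto
      have "N P = orig"
        using sim_inverse(1)[OF s, of "fst P" orig] by (simp add: N_def sim_orig)
      moreover have "ch (N P) (N p) = ch P p"
        unfolding N_def using s that P by (intro ch_sim) auto
      ultimately show "ch orig (N p) = ch P p" by simp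
    qed
    have NN: "ch (N p) (N q) = ch p q" if "p \<in> H3" "q \<in> H3" for p q
      unfolding N_def using s that by (intro ch_sim) auto
    obtain B :: "(nat \<times> int \<times> int) set" and b where B: "finite B" "real (card B) \<le> 272 * \<tau>\<^sup>2"
      "\<forall>q\<in>H3. ch orig q \<le> \<tau> \<longrightarrow> b q \<in> B"
      "\<forall>q\<in>H3. \<forall>r\<in>H3. ch orig q \<le> \<tau> \<longrightarrow> ch orig r \<le> \<tau> \<longrightarrow> b q = b r \<longrightarrow> ch q r \<le> 5 / 2"
      using box_cover[OF \<tau>] by (elim exE conjE)
    define f where "f = (\<lambda>\<gamma>. b (N (\<gamma> orig)))"
    have fin: "finite ?A \<and> card ?A \<le> card R * card B"
    proof (rule card_le_fibres[OF B(1), of _ f])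
      fix \<gamma> assume g: "\<gamma> \<in> ?A"
      then show "f \<gamma> \<in> B"
        unfolding f_def using mp[OF bspec[OF B(3) N(1)]] N(2) by simp
      have gG: "\<gamma> \<in> \<Gamma>" using g by simp
      let ?F = "{\<delta> \<in> ?A. f \<delta> = f \<gamma>}"
      let ?t = "\<lambda>\<delta>. inv\<^bsub>G\<^esub> \<gamma> \<otimes>\<^bsub>G\<^esub> \<delta>"
      have sub: "?t ` ?F \<subseteq> R"
      proof
        fix \<eta> assume "\<eta> \<in> ?t ` ?F"
        then obtain \<delta> where d: "\<eta> = ?t \<delta>" "\<delta> \<in> \<Gamma>" "ch P (\<delta> orig) \<le> \<tau>" "f \<delta> = f \<gamma>" by blast
        have "ch (N (\<gamma> orig)) (N (\<delta> orig)) \<le> 5 / 2"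
          using B(4) g d N[of "\<gamma> orig"] N[of "\<delta> orig"] unfolding f_def by (simp del: split_paired_All)
        then have "ch (\<gamma> orig) (\<delta> orig) \<le> 5 / 2" using NN g d by simp
        moreover have "ch orig (\<eta> orig) = ch (\<gamma> orig) (\<delta> orig)"
          using ch_inv_left[OF gG closed[OF d(2) orig_H3] orig_H3]
          unfolding d(1) mult_apply[OF inv_\<Gamma>[OF gG] d(2) orig_H3] by (simp add: ch_commute)
        ultimately show "\<eta> \<in> R"
          unfolding R_def using mult_\<Gamma>[OF inv_\<Gamma>[OF gG] d(2)] d(1) by simp
      qed
      have inj: "inj_on ?t ?F"
      proof (rule inj_onI)
        fix x y assume "x \<in> ?F" "y \<in> ?F" "?t x = ?t y"
        then show "x = y" using Units_l_cancel[of "inv\<^bsub>G\<^esub> \<gamma>" x y] gG inv_\<Gamma>[OF gG] Units_eq by simp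
      qed
      show "finite ?F \<and> card ?F \<le> card R"
        using inj_on_finite[OF inj sub \<open>finite R\<close>] card_inj_on_le[OF inj sub \<open>finite R\<close>] by blast
    qed
    then have "real (card ?A) \<le> real (card R * card B)"
      by (intro of_nat_mono) (rule conjunct2)
    also have "\<dots> = real (card R) * real (card B)" by (rule of_nat_mult)
    also have "\<dots> \<le> real (card R) * (272 * \<tau>\<^sup>2)" by (intro mult_left_mono B(2)) simp
    also have "\<dots> \<le> K * \<tau>\<^sup>2" by (simp add: K_def algebra_simps)
    finally show ?thesis using fin by blast
  qed
  note main = this
  have "K > 0" by (simp add: K_def add_nonneg_pos)
  then show ?thesis by (intro exI[of _ K] conjI[of "K > 0"] ballI allI impI main)
qed

text \<open>A grid of \<open>m\<^sup>2\<close> points on the horosphere of height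
  \<open>1 / m\<close> is spaced so widely that no two of them share a nearby orbit point.\<close>

lemma orbit_count_lower:
  "\<exists>\<kappa>>0. \<forall>m::nat\<ge>1. m\<^sup>2 \<le> card {\<gamma> \<in> \<Gamma>. ch orig (\<gamma> orig) \<le> \<kappa> * real m}"
proof -
  obtain R where R: "R \<ge> 1" "\<And>p. p \<in> H3 \<Longrightarrow> \<exists>\<gamma>\<in>\<Gamma>. ch p (\<gamma> orig) \<le> R"
    by (rule cobounded) blast
  \<comment> \<open>From the triangle inequality: grid points have \<open>ch\<close> at most
    \<open>((2 * R)\<^sup>2 + 1) * m\<close> from \<open>orig\<close>, and at most \<open>R\<close>
    from their orbit points.\<close>
  define \<kappa> where "\<kappa> = 2 * ((2 * R)\<^sup>2 + 1) * R"
  have "m\<^sup>2 \<le> card {\<gamma> \<in> \<Gamma>. ch orig (\<gamma> orig) \<le> \<kappa> * real m}" if m: "m \<ge> 1" for m :: nat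
  proof -
    let ?S = "{\<gamma> \<in> \<Gamma>. ch orig (\<gamma> orig) \<le> \<kappa> * real m}"
    \<comment> \<open>The spacing \<open>2 * R / m\<close> makes \<open>ch\<close> of distinct grid
      points at least \<open>1 + 2 * R\<^sup>2\<close>, whereas a common orbit point would give at
      most \<open>2 * R\<^sup>2\<close>.\<close>
    define p where "p = (\<lambda>(i::nat, j::nat). (Complex (2 * R * real i / real m) (2 * R * real j / real m), 1 / real m))"
    have pH: "p ij \<in> H3" for ij using m by (cases ij) (simp add: p_def H3_def)
    define c where "c = (\<lambda>ij. SOME \<gamma>. \<gamma> \<in> \<Gamma> \<and> ch (p ij) (\<gamma> orig) \<le> R)"
    have c: "c ij \<in> \<Gamma> \<and> ch (p ij) (c ij orig) \<le> R" for ij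
      unfolding c_def using R(2)[OF pH[of ij]]
      by (intro someI_ex[of "\<lambda>\<gamma>. \<gamma> \<in> \<Gamma> \<and> ch (p ij) (\<gamma> orig) \<le> R"]) blast
    have cl: "ch orig (c ij orig) \<le> \<kappa> * real m" if "ij \<in> {..<m} \<times> {..<m}" for ij
    proof -
      obtain i j where ij0: "ij = (i, j)" by (cases ij)
      with that have ij: "ij = (i, j)" "i < m" "j < m" by auto
      have sq: "(2 * R * real i / real m)\<^sup>2 \<le> (2 * R)\<^sup>2" if "i < m" for i
        using that R by (intro power_mono) (auto simp: field_simps)
      have "ch orig (p ij) = ((2 * R * real i / real m)\<^sup>2 + (2 * R * real j / real m)\<^sup>2 + (1 / real m)\<^sup>2 + 1) * (real m / 2)"
        using m by (simp add: ij p_def ch_orig cmod_power2)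
      also have "\<dots> \<le> ((2 * R)\<^sup>2 + (2 * R)\<^sup>2 + 1 + 1) * (real m / 2)"
        using sq[OF ij(2)] sq[OF ij(3)] m by (intro mult_right_mono add_mono) (auto simp: power_le_one)
      also have "\<dots> = ((2 * R)\<^sup>2 + 1) * real m" by (simp add: algebra_simps)
      finally have "ch orig (p ij) \<le> ((2 * R)\<^sup>2 + 1) * real m" .
      then have "2 * ch orig (p ij) * ch (p ij) (c ij orig) \<le> 2 * (((2 * R)\<^sup>2 + 1) * real m) * R"
        using c[of ij] R pH[of ij] ch_pos[of "p ij" "c ij orig"] ch_pos[OF orig_H3 pH[of ij]]
        by (intro mult_mono) auto
      moreover have "ch orig (c ij orig) \<le> 2 * ch orig (p ij) * ch (p ij) (c ij orig)"
        using c[of ij] pH[of ij] by (intro ch_triangle) auto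
      ultimately show ?thesis by (simp add: \<kappa>_def mult_ac)
    qed
    have inj: "inj_on c ({..<m} \<times> {..<m})"
    proof (rule inj_onI, rule ccontr)
      fix ij kl' assume eq: "c ij = c kl'" and ne: "ij \<noteq> kl'"
      obtain i j k l where ij: "ij = (i, j)" "kl' = (k, l)" by (cases ij; cases kl')
      have "ch (p ij) (p kl') \<le> 2 * ch (p ij) (c ij orig) * ch (c ij orig) (p kl')"
        using c[of ij] pH by (intro ch_triangle) auto
      also have "\<dots> \<le> 2 * R * R"
        using c[of ij] c[of kl'] eq R pH[of kl'] pH[of ij] ch_pos[of "c ij orig" "p kl'"]
          ch_pos[of "p ij" "c ij orig"]
        by (intro mult_mono) (auto simp: ch_commute)
      finally have le: "ch (p ij) (p kl') \<le> 2 * R\<^sup>2" by (simp add: power2_eq_square)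
      have "ch (p ij) (p kl') = 1 + 2 * R\<^sup>2 * ((real i - real k)\<^sup>2 + (real j - real l)\<^sup>2)"
      proof -
        have scale: "2 * R * real x / real m - 2 * R * real y / real m = 2 * R / real m * (real x - real y)"
          for x y by (simp add: algebra_simps diff_divide_distrib)
        have "(dist (p ij) (p kl'))\<^sup>2 = (2 * R / real m)\<^sup>2 * ((real i - real k)\<^sup>2 + (real j - real l)\<^sup>2)"
          by (simp add: p_def ij dist_prod_def dist_norm cmod_power2 scale power_mult_distrib distrib_left
              del: times_divide_eq_left times_divide_eq_right)
        moreover have "snd (p ij) = 1 / real m" "snd (p kl') = 1 / real m" by (simp_all add: p_def ij)
        ultimately show ?thesis
          using m by (simp add: ch_def power_divide power_mult_distrib power2_eq_square)
      qed
      moreover have "1 \<le> (real i - real k)\<^sup>2 + (real j - real l)\<^sup>2"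
      proof -
        have one: "1 \<le> (real x - real y)\<^sup>2" if "x \<noteq> y" for x y :: nat
        proof -
          have "1 \<le> \<bar>real x - real y\<bar>" using that by linarith
          then show ?thesis using abs_le_square_iff[of 1 "real x - real y"] by simp
        qed
        have "i \<noteq> k \<or> j \<noteq> l" using ne ij by auto
        then show ?thesis
        proof
          assume "i \<noteq> k"
          then show ?thesis using one[of i k] zero_le_power2[of "real j - real l"] by linarith
        next
          assume "j \<noteq> l"
          then show ?thesis using one[of j l] zero_le_power2[of "real i - real k"] by linarith
        qed
      qed
      then have "2 * R\<^sup>2 * 1 \<le> 2 * R\<^sup>2 * ((real i - real k)\<^sup>2 + (real j - real l)\<^sup>2)"
        by (intro mult_left_mono) auto
      ultimately show False using le by linarith
    qed
    have "card ({..<m} \<times> {..<m}) \<le> card ?S"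
      using cl c by (intro card_inj_on_le[OF inj] finite_return_set) blast
    then show ?thesis by (simp add: card_cartesian_product power2_eq_square)
  qed
  note main = this
  have "\<kappa> > 0" using R(1) by (simp add: \<kappa>_def add_nonneg_pos)
  then show ?thesis by (intro exI[of _ \<kappa>] conjI allI impI main)
qed

end

section \<open>Busemann differences along the orbit: summability and averages\<close>

context cocompact_H3 begin

text \<open>Dyadic summation: at most \<open>K * (2 ^ (j + 1))\<^sup>2\<close> elements contribute
  at most \<open>2 powr (- p * j)\<close> each. The ratio \<open>2 powr (2 - p)\<close> of this
  geometric series is below 1 exactly for \<open>p > 2\<close>.\<close>

lemma orbit_series_finite:
  assumes p: "p > 2"
  shows "(\<integral>\<^sup>+\<gamma>. ennreal (ch orig (\<gamma> orig) powr - p) \<partial>count_space \<Gamma>) < \<infinity>"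
proof -
  obtain K where K: "K > 0"
    "\<forall>P\<in>H3. \<forall>\<tau>\<ge>1. finite {\<gamma> \<in> \<Gamma>. ch P (\<gamma> orig) \<le> \<tau>} \<and>
      real (card {\<gamma> \<in> \<Gamma>. ch P (\<gamma> orig) \<le> \<tau>}) \<le> K * \<tau>\<^sup>2"
    using orbit_count_upper by (elim exE conjE)
  note count = mp[OF spec[OF bspec[OF K(2)]]]
  define S where "S = (\<lambda>j::nat. {\<gamma> \<in> \<Gamma>. ch orig (\<gamma> orig) \<le> 2 ^ (j + 1)})"
  define r where "r = 2 powr (2 - p)"
  have r: "0 < r" "r < 1" using p powr_less_mono[of "2 - p" 0 2] by (auto simp: r_def)
  have "(\<integral>\<^sup>+\<gamma>. ennreal (ch orig (\<gamma> orig) powr - p) \<partial>count_space \<Gamma>)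
      \<le> (\<integral>\<^sup>+\<gamma>. (\<Sum>j. ennreal (2 powr (- p * real j)) * indicator (S j) \<gamma>) \<partial>count_space \<Gamma>)"
  proof (rule nn_integral_mono)
    fix \<gamma> assume "\<gamma> \<in> space (count_space \<Gamma>)"
    then have g: "\<gamma> \<in> \<Gamma>" by simp
    let ?c = "ch orig (\<gamma> orig)"
    have c: "?c \<ge> 1" using g by (intro ch_ge_1) auto
    define j where "j = nat \<lfloor>log 2 ?c\<rfloor>"
    have j: "real j \<le> log 2 ?c" "log 2 ?c < real j + 1"
      using c unfolding j_def by (simp_all add: floor_less_iff)
    have "2 powr log 2 ?c < 2 powr (real j + 1)" using j(2) by simp
    then have "?c < 2 ^ (j + 1)" using c by (simp add: powr_add powr_realpow)
    then have "\<gamma> \<in> S j" using g by (simp add: S_def)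
    have "2 powr real j \<le> 2 powr log 2 ?c" using j(1) by simp
    then have "2 powr real j \<le> ?c" using c by simp
    then have "?c powr - p \<le> (2 powr real j) powr - p" using p by (intro powr_mono2') auto
    also have "\<dots> = 2 powr (- p * real j)" by (simp add: powr_powr mult.commute)
    finally have le: "?c powr - p \<le> 2 powr (- p * real j)" .
    define t where "t = (\<lambda>i. ennreal (2 powr (- p * real i)) * indicator (S i) \<gamma>)"
    have "ennreal (?c powr - p) \<le> t j"
      unfolding t_def using \<open>\<gamma> \<in> S j\<close> ennreal_leI[OF le] by simp
    also have "\<dots> \<le> (\<Sum>i. t i)"
      using sum_le_suminf[of t "{j}"] by simp
    finally show "ennreal (?c powr - p) \<le> (\<Sum>j. ennreal (2 powr (- p * real j)) * indicator (S j) \<gamma>)"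
      unfolding t_def .
  qed
  also have "\<dots> = (\<Sum>j. \<integral>\<^sup>+\<gamma>. ennreal (2 powr (- p * real j)) * indicator (S j) \<gamma> \<partial>count_space \<Gamma>)"
    by (intro nn_integral_suminf) simp
  also have "\<dots> \<le> (\<Sum>j. ennreal (4 * K * r ^ j))"
  proof (intro suminf_le)
    fix j :: nat
    have fin: "finite (S j)" "real (card (S j)) \<le> K * (2 ^ (j + 1))\<^sup>2"
      using count[OF orig_H3, of "2 ^ (j + 1)"] unfolding S_def
      by (simp_all only: one_le_power one_le_numeral)
    have "(\<integral>\<^sup>+\<gamma>. ennreal (2 powr (- p * real j)) * indicator (S j) \<gamma> \<partial>count_space \<Gamma>)
        = ennreal (2 powr (- p * real j)) * ennreal (real (card (S j)))"
      using fin(1) by (subst nn_integral_cmult_indicator)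
        (auto simp: S_def ennreal_of_nat_eq_real_of_nat)
    also have "\<dots> = ennreal (2 powr (- p * real j) * real (card (S j)))"
      by (rule ennreal_mult[symmetric]) auto
    also have "\<dots> \<le> ennreal (2 powr (- p * real j) * (K * (2 ^ (j + 1))\<^sup>2))"
      by (intro ennreal_leI mult_left_mono fin(2)) auto
    also have "2 powr (- p * real j) * (K * (2 ^ (j + 1))\<^sup>2) = 4 * K * r ^ j"
    proof -
      have "(2 ^ j)\<^sup>2 = 2 powr (2 * real j)"
        by (simp add: powr_realpow[symmetric] powr_powr power2_eq_square powr_add[symmetric])
      moreover have "r ^ j = 2 powr (- p * real j) * 2 powr (2 * real j)"
        by (simp add: r_def powr_realpow[symmetric] powr_powr powr_add[symmetric] algebra_simps)
      ultimately show ?thesis by (simp add: power_mult_distrib)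
    qed
    finally show "(\<integral>\<^sup>+\<gamma>. ennreal (2 powr (- p * real j)) * indicator (S j) \<gamma> \<partial>count_space \<Gamma>)
        \<le> ennreal (4 * K * r ^ j)" .
  qed auto
  also have "\<dots> < \<infinity>"
  proof -
    have "summable (\<lambda>j. 4 * K * r ^ j)" using r by (intro summable_mult summable_geometric) simp
    then have "(\<Sum>j. ennreal (4 * K * r ^ j)) = ennreal (\<Sum>j. 4 * K * r ^ j)"
      using K r by (intro suminf_ennreal2) auto
    then show ?thesis by simp
  qed
  finally show ?thesis .
qed

text \<open>The distance from \<open>\<gamma> orig\<close> to \<open>\<gamma> (s orig)\<close> does
  not depend on \<open>\<gamma>\<close>, so \<open>buse_diff_le\<close> bounds the difference by a
  multiple of \<open>1 / ch orig (\<gamma> orig)\<close>.\<close>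

lemma buse_gradient_finite:
  assumes p: "p > 2" and q: "q \<in> H3" and s: "s \<in> \<Gamma>"
  shows "(\<integral>\<^sup>+\<gamma>. ennreal (\<bar>buse q ((\<gamma> \<otimes>\<^bsub>G\<^esub> s) orig) - buse q (\<gamma> orig)\<bar> powr p) \<partial>count_space \<Gamma>) < \<infinity>"
proof -
  define c where "c = 4 * (ch orig q)\<^sup>2 * ch orig (s orig)"
  have c: "c \<ge> 0" using ch_pos[of orig "s orig"] s by (simp add: c_def)
  have "(\<integral>\<^sup>+\<gamma>. ennreal (\<bar>buse q ((\<gamma> \<otimes>\<^bsub>G\<^esub> s) orig) - buse q (\<gamma> orig)\<bar> powr p) \<partial>count_space \<Gamma>)
      \<le> (\<integral>\<^sup>+\<gamma>. ennreal (c powr p) * ennreal (ch orig (\<gamma> orig) powr - p) \<partial>count_space \<Gamma>)"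
  proof (rule nn_integral_mono)
    fix \<gamma> assume "\<gamma> \<in> space (count_space \<Gamma>)"
    then have g: "\<gamma> \<in> \<Gamma>" by simp
    have pos: "ch orig (\<gamma> orig) > 0" using g by (intro ch_pos) auto
    have m: "(\<gamma> \<otimes>\<^bsub>G\<^esub> s) orig = \<gamma> (s orig)" by (rule mult_apply[OF g s orig_H3])
    have "\<bar>buse q (\<gamma> orig) - buse q (\<gamma> (s orig))\<bar> \<le> c / ch orig (\<gamma> orig)"
      using buse_diff_le[OF q, of "\<gamma> orig" "\<gamma> (s orig)"] g s by (simp add: c_def)
    then have "\<bar>buse q ((\<gamma> \<otimes>\<^bsub>G\<^esub> s) orig) - buse q (\<gamma> orig)\<bar> powr p \<le> (c / ch orig (\<gamma> orig)) powr p"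
      unfolding m using p by (intro powr_mono2) (auto simp: abs_minus_commute)
    also have "\<dots> = c powr p * ch orig (\<gamma> orig) powr - p"
      using c pos by (simp add: powr_divide powr_minus_divide)
    finally show "ennreal (\<bar>buse q ((\<gamma> \<otimes>\<^bsub>G\<^esub> s) orig) - buse q (\<gamma> orig)\<bar> powr p)
        \<le> ennreal (c powr p) * ennreal (ch orig (\<gamma> orig) powr - p)"
      by (simp add: ennreal_leI flip: ennreal_mult)
  qed
  also have "\<dots> = ennreal (c powr p) * (\<integral>\<^sup>+\<gamma>. ennreal (ch orig (\<gamma> orig) powr - p) \<partial>count_space \<Gamma>)"
    by (rule nn_integral_cmult) simp
  also have "\<dots> < \<infinity>"
    using orbit_series_finite[OF p] by (simp add: ennreal_mult_less_top)
  finally show ?thesis .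
qed

text \<open>The points of the orbit with \<open>ch q x \<le> e * ch orig x\<close> lie in a ball of half the radius, so
  they are outnumbered by the points where \<open>buse q x \<ge> 1\<close>.\<close>

lemma buse_sum_ge:
  obtains T where "\<And>x. x \<in> H3 \<Longrightarrow> (\<Sum>\<gamma>\<in>{\<gamma> \<in> \<Gamma>. ch orig (\<gamma> orig) \<le> T}. buse (\<gamma> orig) x) \<ge> 1"
proof -
  obtain K where K: "K > 0"
    "\<forall>P\<in>H3. \<forall>\<tau>\<ge>1. finite {\<gamma> \<in> \<Gamma>. ch P (\<gamma> orig) \<le> \<tau>} \<and>
      real (card {\<gamma> \<in> \<Gamma>. ch P (\<gamma> orig) \<le> \<tau>}) \<le> K * \<tau>\<^sup>2"
    using orbit_count_upper by (elim exE conjE)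
  note count = mp[OF spec[OF bspec[OF K(2)]]]
  obtain \<kappa> where \<kappa>: "\<kappa> > 0"
    "\<forall>m::nat\<ge>1. m\<^sup>2 \<le> card {\<gamma> \<in> \<Gamma>. ch orig (\<gamma> orig) \<le> \<kappa> * real m}"
    using orbit_count_lower by (elim exE conjE)
  define A where "A = exp (1::real)"
  have A: "A > 0" "ln A = 1" by (auto simp: A_def)
  \<comment> \<open>\<open>C * T\<close> will be the value of \<open>K * \<tau>\<^sup>2\<close> that
    bounds the number of bad elements.\<close>
  define C where "C = K * (1 + A)\<^sup>2 / 2"
  have C: "C > 0" using K A by (simp add: C_def add_pos_pos)
  define c1 where "c1 = C * \<kappa>"
  define c2 where "c2 = 2 * C * \<kappa> * sqrt (2 * \<kappa>)"
  have c12: "c1 > 0" "c2 > 0" using C \<kappa> by (auto simp: c1_def c2_def)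
  \<comment> \<open>With \<open>T = \<kappa> * n\<^sup>2\<close> the lower count has order
    \<open>n ^ 4\<close>, while the loss is at most \<open>c1 * n\<^sup>2 + c2 * n ^ 3\<close>. The
    summand \<open>2 / \<kappa>\<close> ensures \<open>T \<ge> 2\<close>.\<close>
  define n where "n = nat \<lceil>2 + c1 + c2 + 2 / \<kappa>\<rceil>"
  have n: "real n \<ge> 2 + c1 + c2 + 2 / \<kappa>" unfolding n_def by linarith
  have n2: "real n \<ge> 2" "real n \<ge> 2 / \<kappa>" "real n \<ge> 1 + c1 + c2"
  proof -
    have "2 / \<kappa> > 0" using \<kappa>(1) by simp
    then show "real n \<ge> 2" "real n \<ge> 2 / \<kappa>" "real n \<ge> 1 + c1 + c2"
      using n c12 by linarith+
  qed
  define m where "m = n\<^sup>2"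
  define T where "T = \<kappa> * real m"
  have nn: "real n \<le> real m" using n2(1) by (simp add: m_def power2_eq_square)
  have m: "m \<ge> 1" using nn n2 by linarith
  have T: "T \<ge> 2"
  proof -
    have "2 / \<kappa> \<le> real m" using nn n2 by linarith
    then show ?thesis using \<kappa> by (simp add: T_def field_simps)
  qed
  have arith: "1 + C * T * (1 + ln (2 * T)) \<le> (real m)\<^sup>2"
  proof -
    have "ln (2 * T) = 2 * ln (sqrt (2 * T))" using T by (simp add: ln_sqrt)
    also have "\<dots> \<le> 2 * sqrt (2 * T)"
      using T ln_le_minus_one[of "sqrt (2 * T)"] by simp
    also have "sqrt (2 * T) = sqrt (2 * \<kappa>) * real n"
      by (simp add: T_def m_def real_sqrt_mult)
    finally have "C * T * (1 + ln (2 * T)) \<le> C * T * (1 + 2 * (sqrt (2 * \<kappa>) * real n))"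
      using C T by (intro mult_left_mono) auto
    also have "\<dots> = c1 * (real n)\<^sup>2 + c2 * (real n) ^ 3"
      by (simp add: T_def m_def c1_def c2_def power2_eq_square power3_eq_cube algebra_simps)
    also have "\<dots> \<le> c1 * (real n) ^ 3 + c2 * (real n) ^ 3"
      using c12 n2 power_increasing[of 2 3 "real n"] by simp
    finally have pow: "C * T * (1 + ln (2 * T)) \<le> c1 * (real n) ^ 3 + c2 * (real n) ^ 3" .
    have "1 + C * T * (1 + ln (2 * T)) \<le> 1 * (real n) ^ 3 + (c1 + c2) * (real n) ^ 3"
    proof -
      have "1 \<le> (real n) ^ 3" using n2 by (intro one_le_power) linarith
      with pow show ?thesis unfolding distrib_right by linarith
    qed
    also have "\<dots> = (1 + c1 + c2) * (real n) ^ 3" by (simp add: algebra_simps)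
    also have "\<dots> \<le> real n * (real n) ^ 3"
      using n2 by (intro mult_right_mono) auto
    also have "\<dots> = (real m)\<^sup>2" by (simp add: m_def power2_eq_square power3_eq_cube)
    finally show ?thesis .
  qed
  let ?S = "{\<gamma> \<in> \<Gamma>. ch orig (\<gamma> orig) \<le> T}"
  have finS: "finite ?S" by (rule finite_return_set)
  have main: "(\<Sum>\<gamma>\<in>?S. buse (\<gamma> orig) x) \<ge> 1" if x: "x \<in> H3" for x
  proof -
    define E where "E = ch orig x"
    have E: "E \<ge> 1" using ch_ge_1[OF orig_H3 x] by (simp add: E_def)
    define Bd where "Bd = {\<gamma> \<in> ?S. ch (\<gamma> orig) x \<le> A * E}"
    have BdS: "Bd \<subseteq> ?S" unfolding Bd_def by blast
    note finB = finite_subset[OF BdS finS] BdS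
    \<comment> \<open>A bad orbit point has \<open>ch\<close> at most \<open>T\<close> from
      \<open>orig\<close> and at most \<open>A * E\<close> from \<open>x\<close>; this weight brings
      both bounds to order \<open>T\<close>. As the normalising factor is at least
      \<open>sqrt (2 * T)\<close>, the bad points have \<open>ch\<close> of order
      \<open>sqrt T\<close> from \<open>P\<close>.\<close>
    define \<beta> where "\<beta> = T / E"
    have \<beta>: "\<beta> > 0" using T E by (simp add: \<beta>_def)
    define nu where "nu = sqrt (1\<^sup>2 + \<beta>\<^sup>2 + 2 * 1 * \<beta> * ch orig x)"
    obtain P where P: "P \<in> H3" "\<forall>y\<in>H3. ch y P = (1 * ch y orig + \<beta> * ch y x) / nu"
      using weighted_midpoint[OF orig_H3 x zero_less_one \<beta>] unfolding nu_def by blast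
    have "\<beta> * E = T" using E by (simp add: \<beta>_def)
    then have nu: "nu \<ge> sqrt (2 * T)"
      unfolding nu_def E_def[symmetric] by (intro real_sqrt_le_mono) (simp add: mult.assoc)
    have s2T: "sqrt (2 * T) > 0" using T by simp
    then have nu0: "nu > 0" using nu by linarith
    define \<tau> where "\<tau> = (1 + A) * T / sqrt (2 * T)"
    have \<tau>2: "\<tau>\<^sup>2 = (1 + A)\<^sup>2 * T / 2"
      using T by (simp add: \<tau>_def power_divide power_mult_distrib power2_eq_square)
    have \<tau>: "\<tau> \<ge> 1"
    proof -
      have "1 * 1 \<le> (1 + A)\<^sup>2 * (T / 2)" using A T by (intro mult_mono one_le_power) auto
      then have "1\<^sup>2 \<le> \<tau>\<^sup>2" by (simp add: \<tau>2)
      moreover have "\<tau> \<ge> 0" using A T by (simp add: \<tau>_def)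
      ultimately show ?thesis by (rule power2_le_imp_le)
    qed
    have "Bd \<subseteq> {\<gamma> \<in> \<Gamma>. ch P (\<gamma> orig) \<le> \<tau>}"
    proof
      fix \<gamma> assume g: "\<gamma> \<in> Bd"
      then have gG: "\<gamma> \<in> \<Gamma>" and g1: "ch orig (\<gamma> orig) \<le> T" and g2: "ch (\<gamma> orig) x \<le> A * E"
        by (auto simp: Bd_def)
      have "ch P (\<gamma> orig) = (ch orig (\<gamma> orig) + \<beta> * ch (\<gamma> orig) x) / nu"
        using bspec[OF P(2) closed[OF gG orig_H3]] by (simp add: ch_commute)
      also have "\<dots> \<le> (T + \<beta> * (A * E)) / nu"
        using g1 g2 \<beta> nu0 by (intro divide_right_mono add_mono mult_left_mono) auto
      also have "\<dots> = (1 + A) * T / nu"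
        using \<open>\<beta> * E = T\<close> by (simp add: algebra_simps)
      also have "\<dots> \<le> \<tau>"
        unfolding \<tau>_def
        by (intro divide_left_mono mult_pos_pos mult_nonneg_nonneg nu nu0 s2T) (use A T in auto)
      finally show "\<gamma> \<in> {\<gamma> \<in> \<Gamma>. ch P (\<gamma> orig) \<le> \<tau>}" using gG by simp
    qed
    then have "real (card Bd) \<le> real (card {\<gamma> \<in> \<Gamma>. ch P (\<gamma> orig) \<le> \<tau>})"
      using count[OF P(1) \<tau>] by (intro of_nat_mono card_mono) auto
    also have "\<dots> \<le> K * \<tau>\<^sup>2" using count[OF P(1) \<tau>] by blast
    also have "\<dots> = C * T" by (simp add: \<tau>2 C_def)
    finally have cardB: "real (card Bd) \<le> C * T" .
    have good: "buse (\<gamma> orig) x \<ge> 1" if "\<gamma> \<in> ?S - Bd" for \<gamma>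
    proof -
      have "A * E < ch (\<gamma> orig) x" using that by (auto simp: Bd_def)
      then have "A \<le> ch (\<gamma> orig) x / ch orig x" using E by (simp add: E_def field_simps)
      then have "ln A \<le> buse (\<gamma> orig) x" unfolding buse_def using A by (intro ln_mono) auto
      then show ?thesis using A by simp
    qed
    have bad: "buse (\<gamma> orig) x \<ge> - ln (2 * T)" if "\<gamma> \<in> Bd" for \<gamma>
    proof -
      have g: "\<gamma> \<in> \<Gamma>" "ch orig (\<gamma> orig) \<le> T" using that by (auto simp: Bd_def)
      have "ln (2 * ch orig (\<gamma> orig)) \<le> ln (2 * T)"
        using g ch_pos[of orig "\<gamma> orig"] by (intro ln_mono) auto
      then show ?thesis using buse_lower[of "\<gamma> orig" x] g x by simp
    qed
    have cS: "(real m)\<^sup>2 \<le> real (card ?S)"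
      using of_nat_mono[OF mp[OF spec[OF \<kappa>(2)] m], where 'a = real] unfolding T_def by simp
    have "(\<Sum>\<gamma>\<in>?S. buse (\<gamma> orig) x) = (\<Sum>\<gamma>\<in>?S - Bd. buse (\<gamma> orig) x) + (\<Sum>\<gamma>\<in>Bd. buse (\<gamma> orig) x)"
      by (rule sum.subset_diff[OF finB(2) finS])
    also have "\<dots> \<ge> (\<Sum>\<gamma>\<in>?S - Bd. 1) + (\<Sum>\<gamma>\<in>Bd. - ln (2 * T))"
      by (intro add_mono sum_mono good bad)
    also have "(\<Sum>\<gamma>\<in>?S - Bd. 1) + (\<Sum>\<gamma>\<in>Bd. - ln (2 * T)) = real (card (?S - Bd)) - real (card Bd) * ln (2 * T)"
      by simp
    also have "real (card (?S - Bd)) = real (card ?S) - real (card Bd)"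
      using finB card_mono[OF finS finB(2)] by (simp add: card_Diff_subset)
    finally have "(\<Sum>\<gamma>\<in>?S. buse (\<gamma> orig) x) \<ge> real (card ?S) - real (card Bd) * (1 + ln (2 * T))"
      by (simp add: algebra_simps)
    moreover have "real (card Bd) * (1 + ln (2 * T)) \<le> C * T * (1 + ln (2 * T))"
      using T by (intro mult_right_mono cardB) auto
    ultimately show ?thesis using arith cS by linarith
  qed
  then show thesis by (rule that)
qed

text \<open>Since \<open>\<gamma>\<close> is an isometry, moving \<open>x\<close> by it interchanges
  numerator and denominator of the ratio, with the base point replaced by its image under the
  inverse.\<close>

lemma buse_act:
  assumes "\<gamma> \<in> \<Gamma>" "x \<in> H3"
  shows "buse (\<gamma> orig) (\<gamma> x) = - buse ((inv\<^bsub>G\<^esub> \<gamma>) orig) x"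
proof -
  have "ch orig (\<gamma> x) = ch ((inv\<^bsub>G\<^esub> \<gamma>) orig) x" using assms by (simp only: ch_inv_left orig_H3)
  moreover have "ch ((inv\<^bsub>G\<^esub> \<gamma>) orig) x > 0" "ch orig x > 0"
    using ch_pos closed[OF inv_\<Gamma>[OF assms(1)] orig_H3] assms(2) by auto
  ultimately show ?thesis
    using assms by (simp only: buse_def ch_act orig_H3) (simp add: ln_div)
qed

text \<open>The elements with \<open>ch orig (\<gamma> orig) \<le> T\<close> form a set closed under
  inverses, so by \<open>buse_act\<close> the left sum is minus the right one, which is at least
  1.\<close>

lemma buse_family_contracted:
  obtains A where "finite A" "A \<subseteq> \<Gamma>"
    "\<And>\<delta>. \<delta> \<in> \<Gamma> \<Longrightarrow> (\<Sum>\<gamma>\<in>A. buse (\<gamma> orig) ((\<gamma> \<otimes>\<^bsub>G\<^esub> \<delta>) orig)) + 1 \<le> (\<Sum>\<gamma>\<in>A. buse (\<gamma> orig) (\<delta> orig))"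
proof -
  obtain T where T: "\<And>x. x \<in> H3 \<Longrightarrow> (\<Sum>\<gamma>\<in>{\<gamma> \<in> \<Gamma>. ch orig (\<gamma> orig) \<le> T}. buse (\<gamma> orig) x) \<ge> 1"
    by (rule buse_sum_ge) blast
  let ?A = "{\<gamma> \<in> \<Gamma>. ch orig (\<gamma> orig) \<le> T}"
  have inv_A: "inv\<^bsub>G\<^esub> \<gamma> \<in> ?A" if g: "\<gamma> \<in> ?A" for \<gamma>
  proof -
    have "ch orig ((inv\<^bsub>G\<^esub> \<gamma>) orig) = ch orig (\<gamma> orig)"
      using g ch_inv_left[of \<gamma> orig orig] by (simp only: mem_Collect_eq orig_H3 ch_commute)
    then show ?thesis using g inv_\<Gamma>[of \<gamma>] by (simp only: mem_Collect_eq)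
  qed
  have inv_inv': "inv\<^bsub>G\<^esub> (inv\<^bsub>G\<^esub> \<gamma>) = \<gamma>" if "\<gamma> \<in> ?A" for \<gamma>
    using that by (intro inv_inv) simp
  have bij: "bij_betw (m_inv G) ?A ?A"
    using inv_A inv_inv' by (intro bij_betw_byWitness[where f' = "m_inv G"]) blast+
  have contr: "(\<Sum>\<gamma>\<in>?A. buse (\<gamma> orig) ((\<gamma> \<otimes>\<^bsub>G\<^esub> \<delta>) orig)) + 1 \<le> (\<Sum>\<gamma>\<in>?A. buse (\<gamma> orig) (\<delta> orig))"
    if d: "\<delta> \<in> \<Gamma>" for \<delta>
  proof -
    have "(\<Sum>\<gamma>\<in>?A. buse (\<gamma> orig) ((\<gamma> \<otimes>\<^bsub>G\<^esub> \<delta>) orig)) = (\<Sum>\<gamma>\<in>?A. - buse ((inv\<^bsub>G\<^esub> \<gamma>) orig) (\<delta> orig))"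
    proof (rule sum.cong[OF refl])
      fix \<gamma> assume "\<gamma> \<in> ?A"
      then have g: "\<gamma> \<in> \<Gamma>" by simp
      show "buse (\<gamma> orig) ((\<gamma> \<otimes>\<^bsub>G\<^esub> \<delta>) orig) = - buse ((inv\<^bsub>G\<^esub> \<gamma>) orig) (\<delta> orig)"
        unfolding mult_apply[OF g d orig_H3] by (rule buse_act[OF g closed[OF d orig_H3]])
    qed
    also have "\<dots> = - (\<Sum>\<gamma>\<in>?A. buse (\<gamma> orig) (\<delta> orig))"
      unfolding sum_negf
      by (subst sum.reindex_bij_betw[OF bij, of "\<lambda>\<gamma>. buse (\<gamma> orig) (\<delta> orig)"]) (rule refl)
    finally show ?thesis using T[OF closed[OF d orig_H3]] by linarith
  qed
  have "finite ?A" by (rule finite_return_set)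
  moreover have "?A \<subseteq> \<Gamma>" by blast
  ultimately show thesis using contr by (rule that)
qed

end

section \<open>Contradiction from the central copy of the integers\<close>

theorem corollary1p5:
  fixes \<Gamma> :: "(complex \<times> real \<Rightarrow> complex \<times> real) set"
    and g :: nat
    and \<Sigma> :: "'s topology"
    and x\<^sub>0 :: 's
    and \<Lambda> :: "('l, 'm) monoid_scheme"
    and \<epsilon> :: real
  assumes "cocompact_lattice (Isom H3 hyp_dist) (Isom_topology H3 hyp_dist) \<Gamma>"
    and "g \<ge> 2"
    and "closed_orientable_surface g \<Sigma>"
    and "x\<^sub>0 \<in> topspace \<Sigma>"
    and "central_extension integer_group \<Lambda> (fundamental_group \<Sigma> x\<^sub>0)"
    and "\<epsilon> > 0"
  shows "\<not> Lq_measure_equivalent TYPE('x) (2 + \<epsilon>) ((Isom H3 hyp_dist)\<lparr>carrier := \<Gamma>\<rparr>) \<Lambda>"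
proof
  assume "Lq_measure_equivalent TYPE('x) (2 + \<epsilon>) ((Isom H3 hyp_dist)\<lparr>carrier := \<Gamma>\<rparr>) \<Lambda>"
  interpret L: cocompact_H3 \<Gamma> by unfold_locales (rule assms(1))
  have p: "2 + \<epsilon> > 2" "2 + \<epsilon> \<ge> 1" using assms(6) by auto
  from \<open>Lq_measure_equivalent _ _ _ _\<close> obtain S T and M :: "'x measure" and \<phi> \<psi> F\<^sub>G F\<^sub>H where
    S: "finite_generating_set L.G S" and T: "finite_generating_set \<Lambda> T"
    and ME: "measure_coupling L.G \<Lambda> M \<phi> \<psi> F\<^sub>G F\<^sub>H"
    and int: "\<forall>h\<in>carrier \<Lambda>. (\<integral>\<^sup>+y\<in>F\<^sub>G. ennreal (real (word_length L.G S
        (me_cocycle L.G \<psi> \<phi> F\<^sub>G h y)) powr (2 + \<epsilon>)) \<partial>M) < \<infinity>"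
    unfolding Lq_measure_equivalent_def by (elim exE conjE)
  have "group \<Lambda>" using assms(5) by (simp add: central_extension_def)
  then interpret \<Lambda>: group \<Lambda> .
  interpret C: coupling L.G \<Lambda> M \<phi> \<psi> F\<^sub>G F\<^sub>H
  proof unfold_locales
    show "free_mp_action L.G M \<phi>" "free_mp_action \<Lambda> M \<psi>"
      "finite_fundamental_domain L.G M \<phi> F\<^sub>G" "finite_fundamental_domain \<Lambda> M \<psi> F\<^sub>H"
      using ME by (simp_all add: measure_coupling_def)
    show "countable (carrier L.G)" by (rule L.finite_generating_set_countable[OF S])
    show "countable (carrier \<Lambda>)" by (rule \<Lambda>.finite_generating_set_countable[OF T])
    show "\<phi> g (\<psi> h x) = \<psi> h (\<phi> g x)"
      if "g \<in> carrier L.G" "h \<in> carrier \<Lambda>" "x \<in> space M" for g h x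
      using ME that unfolding measure_coupling_def by blast
  qed
  obtain i where i: "i \<in> mon integer_group \<Lambda>"
    "\<forall>a\<in>carrier integer_group. \<forall>e\<in>carrier \<Lambda>. i a \<otimes>\<^bsub>\<Lambda>\<^esub> e = e \<otimes>\<^bsub>\<Lambda>\<^esub> i a"
    using assms(5) unfolding central_extension_def by blast
  \<comment> \<open>The nonnegative powers of a generator of the central subgroup form an injective
    sequence.\<close>
  define \<zeta> where "\<zeta> = (\<lambda>n::nat. i (int n))"
  have inj: "inj \<zeta>"
  proof (rule injI)
    fix m n assume "\<zeta> m = \<zeta> n"
    moreover have "inj i" using i(1) by (simp add: mon_def)
    ultimately show "m = n" by (auto simp: \<zeta>_def dest: injD)
  qed
  have ran: "range \<zeta> \<subseteq> carrier \<Lambda>"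
    using i(1) by (auto simp: \<zeta>_def mon_def hom_def Pi_iff)
  have central: "\<zeta> n \<otimes>\<^bsub>\<Lambda>\<^esub> h = h \<otimes>\<^bsub>\<Lambda>\<^esub> \<zeta> n" if "h \<in> carrier \<Lambda>" for n h
    using i(2) that by (simp add: \<zeta>_def)
  obtain A where A: "finite A" "A \<subseteq> \<Gamma>"
    and contr: "\<And>\<delta>. \<delta> \<in> \<Gamma> \<Longrightarrow> (\<Sum>\<gamma>\<in>A. buse (\<gamma> orig) ((\<gamma> \<otimes>\<^bsub>L.G\<^esub> \<delta>) orig)) + 1
      \<le> (\<Sum>\<gamma>\<in>A. buse (\<gamma> orig) (\<delta> orig))"
    by (rule L.buse_family_contracted) blast
  \<comment> \<open>A uniform bound over the finite family; the inserted 0 covers an empty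
    \<open>A\<close>.\<close>
  define B where "B = Max (insert 0 ((\<lambda>\<gamma>. ln (2 * ch orig (\<gamma> orig))) ` A))"
  have bounded: "\<bar>buse (\<gamma> orig) (\<delta> orig)\<bar> \<le> B" if "\<gamma> \<in> A" "\<delta> \<in> carrier L.G" for \<gamma> \<delta>
  proof -
    have "\<gamma> orig \<in> H3" "\<delta> orig \<in> H3" using that A(2) by auto
    then have "\<bar>buse (\<gamma> orig) (\<delta> orig)\<bar> \<le> ln (2 * ch orig (\<gamma> orig))"
      using buse_lower[of "\<gamma> orig" "\<delta> orig"] buse_upper[of "\<gamma> orig" "\<delta> orig"] by linarith
    also have "\<dots> \<le> B" unfolding B_def using A(1) that(1) by (intro Max_ge) auto
    finally show ?thesis .
  qed
  have "emeasure M (space M) = 0"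
  proof (rule C.no_strictly_contracted_family[OF p(2) S _ inj ran central A(1),
        where f = "\<lambda>\<gamma> \<delta>. buse (\<gamma> orig) (\<delta> orig)" and B = B])
    show "A \<subseteq> carrier L.G" using A(2) by simp
    show "(\<integral>\<^sup>+y\<in>F\<^sub>G. ennreal (real (word_length L.G S (me_cocycle L.G \<psi> \<phi> F\<^sub>G h y)) powr (2 + \<epsilon>)) \<partial>M) < \<infinity>"
      if "h \<in> carrier \<Lambda>" for h
      by (rule bspec[OF int that])
    show "\<bar>buse (\<gamma> orig) (\<delta> orig)\<bar> \<le> B" if "\<gamma> \<in> A" "\<delta> \<in> carrier L.G" for \<gamma> \<delta>
      by (rule bounded[OF that])
    show "(\<integral>\<^sup>+\<delta>. ennreal (\<bar>buse (\<gamma> orig) ((\<delta> \<otimes>\<^bsub>L.G\<^esub> s) orig) - buse (\<gamma> orig) (\<delta> orig)\<bar> powr (2 + \<epsilon>))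
        \<partial>count_space (carrier L.G)) < \<infinity>" if "\<gamma> \<in> A" "s \<in> carrier L.G" for \<gamma> s
      using L.buse_gradient_finite[OF p(1), of "\<gamma> orig" s] that A(2) by auto
    show "(\<Sum>\<gamma>\<in>A. buse (\<gamma> orig) ((\<gamma> \<otimes>\<^bsub>L.G\<^esub> \<delta>) orig)) + 1 \<le> (\<Sum>\<gamma>\<in>A. buse (\<gamma> orig) (\<delta> orig))"
      if "\<delta> \<in> carrier L.G" for \<delta>
      using contr[of \<delta>] that by simp
  qed
  then show False using ME by (simp add: measure_coupling_def)
qed

end
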